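(* Let $\sigma\colon\mathbb{R}\to\mathbb{R}_+$ be a twice continuously differentiable function such that, for some $0<\delta\le 1$ and some $L\in\mathbb{R}$, $\sigma(y)\in(\delta,1/\delta)$ for all $y\in\mathbb{R}$ and $\max\{\|\sigma'\|_\infty,\|\sigma''\|_\infty\}<L$. Let $x\in\mathbb{R}$, let $B=(B_t)_{t\in[0,1]}$ be a one-dimensional Brownian motion on some filtered probability space, and let $M^x=(M^x_t)_{t\in[0,1]}$ be the solution of $dM^x_t=\sigma(M^x_t)\,dB_t$, $M^x_0=x$. Let $\mathbb{Q}^x$ be the law of $M^x$ on $(\mathcal{C},\mathcal{F})$ and let $\mathbb{P}^x$ be the law on $(\mathcal{C},\mathcal{F})$ of the solution $N^x$ of $dN^x_t=dB_t$, $N^x_0=x$ (that is, of Brownian motion started at $x$). Then, almost surely, $$\lim_{k\to\infty}\frac{1}{2^k}\log\left(\frac{d\mathbb{Q}^x}{d\mathbb{P}^x}\Big|_{\mathcal{F}^{2^k}}\Big(\big(M^x_{\ell\cdot 2^{-k}}\big)_{\ell=0}^{2^k}\Big)\right)=\frac12\int_0^1\left\{\sigma(M^x_s)^2-1-\log\sigma(M^x_s)^2\right\}ds.$$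
   Context: $\mathcal{C}=C([0,1],\mathbb{R})$, $X_t(\omega)=\omega(t)$ is the canonical process on $\mathcal{C}$, $\mathcal{F}=\sigma(X_t:t\in[0,1])$, and for $n\ge 1$, $\mathcal{F}^n=\sigma(X_{k/n}:k=0,1,\dots,n)$. For probability measures $\mathbb{Q},\mathbb{P}$ on $(\mathcal{C},\mathcal{F})$ with $\mathbb{Q}|_{\mathcal{F}^n}\ll\mathbb{P}|_{\mathcal{F}^n}$, $\frac{d\mathbb{Q}}{d\mathbb{P}}|_{\mathcal{F}^n}$ denotes the Radon–Nikodym density of $\mathbb{Q}|_{\mathcal{F}^n}$ with respect to $\mathbb{P}|_{\mathcal{F}^n}$; being $\mathcal{F}^n$-measurable, it is viewed as a function of the path values $(\omega(\ell/n))_{\ell=0}^n$. *)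

theory Defs
  imports "HOL-Probability.Probability"
begin

section \<open>Path space\<close>

text \<open>
  A continuous function on \<open>[0,1]\<close> is represented by the total function that agrees with it
  on \<open>[0,1]\<close> and is \<^const>\<open>undefined\<close> elsewhere, so that this set is in bijection with
  \<open>C([0,1],\<real>)\<close>.
\<close>

definition path_space :: "(real \<Rightarrow> real) set" where
  "path_space = {w \<in> extensional {0..1}. continuous_on {0..1} w}"

text \<open>The sigma-algebra generated by the coordinates \<open>X\<^sub>t\<close>, \<open>t \<in> T\<close>; used for \<open>T \<subseteq> [0,1]\<close>.\<close>

definition path_sigma :: "real set \<Rightarrow> (real \<Rightarrow> real) measure" where
  "path_sigma T = sigma path_space {{w \<in> path_space. w t \<in> A} | t A. t \<in> T \<and> A \<in> sets borel}"

definition path_algebra :: "(real \<Rightarrow> real) measure" where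
  "path_algebra = path_sigma {0..1}"

definition grid_algebra :: "nat \<Rightarrow> (real \<Rightarrow> real) measure" where
  "grid_algebra n = path_sigma {real k / real n | k. k \<le> n}"

definition path_of :: "(real \<Rightarrow> 'a \<Rightarrow> real) \<Rightarrow> 'a \<Rightarrow> real \<Rightarrow> real" where
  "path_of X \<omega> = (\<lambda>t\<in>{0..1}. X t \<omega>)"

definition path_law :: "'a measure \<Rightarrow> (real \<Rightarrow> 'a \<Rightarrow> real) \<Rightarrow> (real \<Rightarrow> real) measure" where
  "path_law W X = distr W path_algebra (path_of X)"

text \<open>
  The density on the grid sigma-algebra is kept as a function of the whole path. Being measurable
  with respect to \<^term>\<open>grid_algebra n\<close>, its value at \<open>w\<close> depends only on the numbers
  \<open>w (l / n)\<close>, \<open>l \<le> n\<close>.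
\<close>

abbreviation grid_restr :: "(real \<Rightarrow> real) measure \<Rightarrow> nat \<Rightarrow> (real \<Rightarrow> real) measure" where
  "grid_restr P n \<equiv> restr_to_subalg P (grid_algebra n)"

definition grid_density ::
    "(real \<Rightarrow> real) measure \<Rightarrow> (real \<Rightarrow> real) measure \<Rightarrow> nat \<Rightarrow> (real \<Rightarrow> real) \<Rightarrow> ennreal" where
  "grid_density Q P n = RN_deriv (grid_restr P n) (grid_restr Q n)"

section \<open>Brownian motion with respect to a filtration on \<open>[0,1]\<close>\<close>

definition filtered_prob_space :: "'a measure \<Rightarrow> (real \<Rightarrow> 'a measure) \<Rightarrow> bool" where
  "filtered_prob_space W F \<longleftrightarrow>
     prob_space W \<and>
     (\<forall>t\<in>{0..1}. subalgebra W (F t)) \<and>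
     (\<forall>s t. 0 \<le> s \<and> s \<le> t \<and> t \<le> 1 \<longrightarrow> subalgebra (F t) (F s))"

definition continuous_adapted ::
    "'a measure \<Rightarrow> (real \<Rightarrow> 'a measure) \<Rightarrow> (real \<Rightarrow> 'a \<Rightarrow> real) \<Rightarrow> bool" where
  "continuous_adapted W F X \<longleftrightarrow>
     (\<forall>t\<in>{0..1}. X t \<in> borel_measurable (F t)) \<and>
     (\<forall>\<omega>\<in>space W. continuous_on {0..1} (\<lambda>t. X t \<omega>))"

definition brownian_motion ::
    "'a measure \<Rightarrow> (real \<Rightarrow> 'a measure) \<Rightarrow> (real \<Rightarrow> 'a \<Rightarrow> real) \<Rightarrow> bool" where
  "brownian_motion W F B \<longleftrightarrow>
     continuous_adapted W F B \<and>
     (AE \<omega> in W. B 0 \<omega> = 0) \<and>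
     (\<forall>s t. 0 \<le> s \<and> s < t \<and> t \<le> 1 \<longrightarrow>
        distributed W lborel (\<lambda>\<omega>. B t \<omega> - B s \<omega>) (normal_density 0 (sqrt (t - s))) \<and>
        prob_space.indep_set W (sets (F s))
          {(\<lambda>\<omega>. B t \<omega> - B s \<omega>) -` A \<inter> space W | A. A \<in> sets borel})"

section \<open>The Ito integral on \<open>[0,1]\<close>\<close>

text \<open>
  A simple integrand is \<open>\<Sum>i<n. \<xi>\<^sub>i 1\<^bsub>(\<tau>\<^sub>i, \<tau>\<^sub>i\<^sub>+\<^sub>1]\<^esub>\<close> with deterministic times
  \<open>0 \<le> \<tau>\<^sub>0 \<le> \<dots> \<le> \<tau>\<^sub>n \<le> 1\<close> and bounded \<open>\<xi>\<^sub>i\<close> that are measurable with respect to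
  \<open>F (\<tau>\<^sub>i)\<close>.
\<close>

definition simple_integrand ::
    "'a measure \<Rightarrow> (real \<Rightarrow> 'a measure) \<Rightarrow> nat \<Rightarrow> (nat \<Rightarrow> real) \<Rightarrow> (nat \<Rightarrow> 'a \<Rightarrow> real) \<Rightarrow> bool" where
  "simple_integrand W F n \<tau> \<xi> \<longleftrightarrow>
     0 \<le> \<tau> 0 \<and> \<tau> n \<le> 1 \<and> (\<forall>i<n. \<tau> i \<le> \<tau> (Suc i)) \<and>
     (\<forall>i<n. \<xi> i \<in> borel_measurable (F (\<tau> i)) \<and> (\<exists>C. \<forall>\<omega>\<in>space W. \<bar>\<xi> i \<omega>\<bar> \<le> C))"

definition simple_process ::
    "nat \<Rightarrow> (nat \<Rightarrow> real) \<Rightarrow> (nat \<Rightarrow> 'a \<Rightarrow> real) \<Rightarrow> real \<Rightarrow> 'a \<Rightarrow> real" where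
  "simple_process n \<tau> \<xi> s \<omega> = (\<Sum>i<n. \<xi> i \<omega> * indicator {\<tau> i<..\<tau> (Suc i)} s)"

definition simple_integral ::
    "(real \<Rightarrow> 'a \<Rightarrow> real) \<Rightarrow> nat \<Rightarrow> (nat \<Rightarrow> real) \<Rightarrow> (nat \<Rightarrow> 'a \<Rightarrow> real) \<Rightarrow> real \<Rightarrow> 'a \<Rightarrow> real" where
  "simple_integral B n \<tau> \<xi> t \<omega> =
     (\<Sum>i<n. \<xi> i \<omega> * (B (min (\<tau> (Suc i)) t) \<omega> - B (min (\<tau> i) t) \<omega>))"

definition progressively_measurable ::
    "(real \<Rightarrow> 'a measure) \<Rightarrow> (real \<Rightarrow> 'a \<Rightarrow> real) \<Rightarrow> bool" where
  "progressively_measurable F H \<longleftrightarrow>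
     (\<forall>t\<in>{0..1}. (\<lambda>(s, \<omega>). H s \<omega>) \<in> borel_measurable (restrict_space borel {0..t} \<Otimes>\<^sub>M F t))"

text \<open>
  \<open>I\<close> is a version, with almost surely continuous paths, of \<open>t \<mapsto> \<integral>\<^sub>0\<^sup>t H\<^sub>s dB\<^sub>s\<close>
  for a square-integrable progressively measurable \<open>H\<close>: the \<open>L\<^sup>2\<close>-limit of the
  integrals of simple integrands that converge to \<open>H\<close> in \<open>L\<^sup>2\<close>. Since the Ito integral
  is only determined up to indistinguishability, it is a relation rather than a function.
\<close>

definition ito_integral ::
    "'a measure \<Rightarrow> (real \<Rightarrow> 'a measure) \<Rightarrow> (real \<Rightarrow> 'a \<Rightarrow> real) \<Rightarrow> (real \<Rightarrow> 'a \<Rightarrow> real) \<Rightarrow>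
     (real \<Rightarrow> 'a \<Rightarrow> real) \<Rightarrow> bool" where
  "ito_integral W F B H I \<longleftrightarrow>
     progressively_measurable F H \<and>
     (\<integral>\<^sup>+\<omega>. (\<integral>\<^sup>+s\<in>{0..1}. ennreal ((H s \<omega>)\<^sup>2) \<partial>lborel) \<partial>W) < \<infinity> \<and>
     (\<forall>t\<in>{0..1}. I t \<in> borel_measurable W) \<and>
     (AE \<omega> in W. continuous_on {0..1} (\<lambda>t. I t \<omega>)) \<and>
     (\<exists>n \<tau> \<xi>.
        (\<forall>k. simple_integrand W F (n k) (\<tau> k) (\<xi> k)) \<and>
        (\<lambda>k. \<integral>\<^sup>+\<omega>. (\<integral>\<^sup>+s\<in>{0..1}.
                ennreal ((simple_process (n k) (\<tau> k) (\<xi> k) s \<omega> - H s \<omega>)\<^sup>2) \<partial>lborel) \<partial>W)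
          \<longlonglongrightarrow> 0 \<and>
        (\<forall>t\<in>{0..1}.
           (\<lambda>k. \<integral>\<^sup>+\<omega>. ennreal ((simple_integral B (n k) (\<tau> k) (\<xi> k) t \<omega> - I t \<omega>)\<^sup>2) \<partial>W)
             \<longlonglongrightarrow> 0))"

text \<open>\<open>X\<close> solves \<open>dX\<^sub>t = \<sigma>(X\<^sub>t) dB\<^sub>t\<close>, \<open>X\<^sub>0 = x\<close>, for \<open>t \<in> [0,1]\<close>.\<close>

definition sde_solution ::
    "'a measure \<Rightarrow> (real \<Rightarrow> 'a measure) \<Rightarrow> (real \<Rightarrow> 'a \<Rightarrow> real) \<Rightarrow> (real \<Rightarrow> real) \<Rightarrow> real \<Rightarrow>
     (real \<Rightarrow> 'a \<Rightarrow> real) \<Rightarrow> bool" where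
  "sde_solution W F B \<sigma> x X \<longleftrightarrow>
     continuous_adapted W F X \<and>
     (\<exists>I. ito_integral W F B (\<lambda>s \<omega>. \<sigma> (X s \<omega>)) I \<and>
          (AE \<omega> in W. \<forall>t\<in>{0..1}. X t \<omega> = x + I t \<omega>)) \<and>
     (AE \<omega> in W. X 0 \<omega> = x)"

end

theory Submission
  imports Defs
begin

text \<open>
  Let \<open>\<Lambda>' = 1/\<sigma>\<close>, \<open>G = \<Lambda>\<^sup>-\<^sup>1\<close> and \<open>n = 2^k\<close>. On the grid, the law of
  \<open>G (\<Lambda> x + B)\<close> has an explicit density \<open>Z\<close> with respect to that of \<open>x + B\<close>, and
  \<open>(ln Z) / n\<close>, evaluated at \<open>M\<close>, is half the difference of the quadratic variations of
  \<open>M\<close> and \<open>\<Lambda> M\<close> minus a Riemann sum of \<open>ln (\<sigma> M)\<close>, which converges to the claimed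
  limit. It remains to compare the density \<open>D\<close> of the law of \<open>M\<close> with \<open>Z\<close>.

  From below, \<open>Q (D e^k \<le> Z)\<close> is at most \<open>e^-k \<integral> Z dP \<le> e^-k\<close>, so that Borel-Cantelli
  applies. From above, \<open>D \<le> K Z\<close> for a constant \<open>K\<close>: by Ito's formula \<open>U = \<Lambda> M\<close> solves
  \<open>dU = dB + b(U) dt\<close> with \<open>b = \<beta>'\<close> for the bounded function \<open>\<beta> = - ln (\<sigma> G) / 2\<close>, and
  a transition of its Euler scheme from \<open>u\<close> to \<open>v\<close> is dominated by \<open>exp (\<beta> v - \<beta> u)\<close> times a
  centred Gaussian transition of slightly larger variance. Along a chain these factors telescope,
  and as the step size tends to zero the law of \<open>U\<close> on a grid is seen to be at most \<open>K\<close> times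
  that of \<open>\<Lambda> x + B\<close>. Ito's formula itself is proved along dyadic grids, from the second
  moment and the orthogonality of \<open>M\<^sub>t - M\<^sub>s - \<sigma>(M\<^sub>s) (B\<^sub>t - B\<^sub>s)\<close>.
\<close>

section \<open>Grids, Taylor bounds and Riemann sums\<close>

text \<open>The factor 1 / 2^k decides what has to be proved: a comparison of \<open>D\<close> and
  \<open>Z\<close> up to a factor exp (o (2^k)) along the path of \<open>M\<close> is enough. So no
  formula for \<open>D\<close> is needed, and the drift that separates \<Lambda> M from \<Lambda> x
  + B may be ignored in \<open>Z\<close>. The two comparisons differ in depth. Under its own law a
  density rarely falls far below another candidate, whatever that candidate is, so the lower bound
  is free once the candidate has mass at most 1. The upper bound needs a true domination of laws. It
  is proved for Euler schemes, where it is a statement about Gaussian transitions, with a constant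
  that does not depend on the step size; it survives the limit because it can be tested on
  continuous functions. Dyadic grids serve the almost sure limits: second moments of order 1 / n are
  summable along n = 2^k, though not over all n.\<close>

lemma taylor2_bound:
  fixes f f1 f2 :: "real \<Rightarrow> real"
  assumes f: "\<And>y. (f has_real_derivative f1 y) (at y)"
    and f1: "\<And>y. (f1 has_real_derivative f2 y) (at y)"
    and C: "\<And>y. \<bar>f2 y\<bar> \<le> C"
  shows "\<bar>f (y + d) - f y - f1 y * d\<bar> \<le> C * d\<^sup>2"
proof (cases "d = 0")
  case False
  define a b where "a = min y (y + d) - 1" and "b = max y (y + d) + 1"
  have "\<exists>t. (if y + d < y then y + d < t \<and> t < y else y < t \<and> t < y + d) \<and>
      f (y + d) = (\<Sum>m<2. ([f, f1, f2] ! m) y / fact m * (y + d - y) ^ m) + ([f, f1, f2] ! 2) t / fact 2 * (y + d - y) ^ 2"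
  proof (rule Taylor[where a = a and b = b])
    show "\<forall>m t. m < 2 \<and> a \<le> t \<and> t \<le> b \<longrightarrow>
        (([f, f1, f2] ! m) has_real_derivative ([f, f1, f2] ! Suc m) t) (at t)"
      using f f1 by (auto simp: less_2_cases_iff)
  qed (use False in \<open>auto simp: a_def b_def\<close>)
  then obtain t where "f (y + d) = f y + f1 y * d + f2 t / 2 * d\<^sup>2"
    by (auto simp: numeral_2_eq_2)
  then have "\<bar>f (y + d) - f y - f1 y * d\<bar> = \<bar>f2 t\<bar> / 2 * d\<^sup>2"
    by (simp add: abs_mult)
  also have "\<dots> \<le> C * d\<^sup>2"
    using C[of t] by (intro mult_right_mono) auto
  finally show ?thesis .
qed simp

text \<open>Lagrange remainder; its factor 1/6 is given away, as 1/2 is in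
  \<open>taylor2_bound\<close>.\<close>

lemma taylor3_bound:
  fixes f f1 f2 :: "real \<Rightarrow> real"
  assumes f: "\<And>y. (f has_real_derivative f1 y) (at y)"
    and f1: "\<And>y. (f1 has_real_derivative f2 y) (at y)"
    and f2: "\<And>y. (f2 has_real_derivative f3 y) (at y)"
    and C: "\<And>y. \<bar>f3 y\<bar> \<le> C"
  shows "\<bar>f (y + d) - f y - f1 y * d - f2 y / 2 * d\<^sup>2\<bar> \<le> C * \<bar>d\<bar> ^ 3"
proof (cases "d = 0")
  case False
  define a b where "a = min y (y + d) - 1" and "b = max y (y + d) + 1"
  have "\<exists>t. (if y + d < y then y + d < t \<and> t < y else y < t \<and> t < y + d) \<and>
      f (y + d) = (\<Sum>m<3. ([f, f1, f2, f3] ! m) y / fact m * (y + d - y) ^ m) + ([f, f1, f2, f3] ! 3) t / fact 3 * (y + d - y) ^ 3"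
  proof (rule Taylor[where a = a and b = b])
    show "\<forall>m t. m < 3 \<and> a \<le> t \<and> t \<le> b \<longrightarrow>
        (([f, f1, f2, f3] ! m) has_real_derivative ([f, f1, f2, f3] ! Suc m) t) (at t)"
      using f f1 f2 by (auto simp: eval_nat_numeral less_Suc_eq)
  qed (use False in \<open>auto simp: a_def b_def\<close>)
  then obtain t where "f (y + d) = f y + f1 y * d + f2 y / 2 * d\<^sup>2 + f3 t / 6 * d ^ 3"
    by (auto simp: eval_nat_numeral fact_numeral)
  then have "\<bar>f (y + d) - f y - f1 y * d - f2 y / 2 * d\<^sup>2\<bar> = \<bar>f3 t\<bar> / 6 * \<bar>d\<bar> ^ 3"
    by (simp add: abs_mult power_abs)
  also have "\<dots> \<le> C * \<bar>d\<bar> ^ 3"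
    using C[of t] by (intro mult_right_mono) auto
  finally show ?thesis .
qed simp

text \<open>In terms of e + w the recursion reads e (l + 1) + w <= (1 + a) (e l + w), plain
  geometric growth; this is why the defect is taken as a w.\<close>

lemma discrete_gronwall:
  fixes e :: "nat \<Rightarrow> real"
  assumes "e 0 = 0" and "0 \<le> a"
    and step: "\<And>l. l < N \<Longrightarrow> e (Suc l) \<le> (1 + a) * e l + a * w"
    and "l \<le> N"
  shows "e l \<le> ((1 + a) ^ l - 1) * w"
  using \<open>l \<le> N\<close>
proof (induction l)
  case 0
  then show ?case using assms by simp
next
  case (Suc l)
  then have "e (Suc l) \<le> (1 + a) * e l + a * w" using step by simp
  also have "\<dots> \<le> (1 + a) * (((1 + a) ^ l - 1) * w) + a * w"
    using Suc \<open>0 \<le> a\<close> by (intro add_right_mono mult_left_mono) auto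
  finally show ?case by (simp add: algebra_simps)
qed

lemma lipschitz_of_deriv_bound:
  fixes f f1 :: "real \<Rightarrow> real"
  assumes f: "\<And>y. (f has_real_derivative f1 y) (at y)" and C: "\<And>y. \<bar>f1 y\<bar> \<le> C"
  shows "\<bar>f y - f z\<bar> \<le> C * \<bar>y - z\<bar>"
  using field_differentiable_bound[of UNIV f f1 C y z] f C by (simp add: has_field_derivative_at_within)

text \<open>Uniform continuity at the scale of the mesh, for all pairs of times and not only for
  grid points, since integrals over whole cells are compared with point values.\<close>

lemma uniform_grid_modulus:
  fixes f :: "real \<Rightarrow> real"
  assumes "continuous_on {0..1} f" "0 < e"
  obtains K where "\<And>k s t. k \<ge> K \<Longrightarrow> s \<in> {0..1} \<Longrightarrow> t \<in> {0..1} \<Longrightarrow> \<bar>s - t\<bar> \<le> 1 / 2 ^ k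
      \<Longrightarrow> \<bar>f s - f t\<bar> < e"
proof -
  have "uniformly_continuous_on {0..1} f"
    using assms by (intro compact_uniformly_continuous) auto
  then obtain d where d: "d > 0" "\<And>s t. s \<in> {0..1} \<Longrightarrow> t \<in> {0..1} \<Longrightarrow> dist s t < d \<Longrightarrow> dist (f s) (f t) < e"
    using \<open>0 < e\<close> unfolding uniformly_continuous_on_def by metis
  obtain K where K: "(1 / 2) ^ K < d" using real_arch_pow_inv[OF d(1), of "1/2"] by auto
  show ?thesis
  proof (rule that[of K])
    fix k s t assume *: "k \<ge> K" "s \<in> {0..1}" "t \<in> {0..1}" "\<bar>s - t\<bar> \<le> (1::real) / 2 ^ k"
    have "(1 / 2 :: real) ^ k \<le> (1 / 2) ^ K" using * by (intro power_decreasing) auto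
    then have "dist s t < d" using * K by (simp add: dist_real_def power_one_over)
    then show "\<bar>f s - f t\<bar> < e" using d(2)[of s t] * by (simp add: dist_real_def)
  qed
qed

lemma grid_in_unit: "l \<le> n \<Longrightarrow> real l / real n \<in> {0..1}"
  by (cases "n = 0") (auto simp: divide_simps)

lemma grid_le: "i \<le> j \<Longrightarrow> real i / real n \<le> real j / real n"
  by (simp add: divide_right_mono)

text \<open>\<open>nat \<lfloor>T * 2 ^ k\<rfloor>\<close> counts the complete cells of the k-th
  dyadic grid before T. Sums over them approximate quantities up to time T without T being a grid
  point.\<close>

lemma floor_grid:
  assumes "T \<in> {0..1::real}"
  shows "nat \<lfloor>T * 2 ^ k\<rfloor> \<le> 2 ^ k" "\<bar>real (nat \<lfloor>T * 2 ^ k\<rfloor>) / 2 ^ k - T\<bar> \<le> 1 / 2 ^ k"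
    "real (nat \<lfloor>T * 2 ^ k\<rfloor>) / 2 ^ k \<le> T"
proof -
  have "T * 2 ^ k \<le> 2 ^ k" using assms by (simp add: mult_left_le_one_le)
  then have "\<lfloor>T * 2 ^ k\<rfloor> \<le> 2 ^ k"
    by (metis floor_mono floor_of_int of_int_numeral of_int_power)
  then show "nat \<lfloor>T * 2 ^ k\<rfloor> \<le> 2 ^ k" by (simp add: nat_le_iff)
  have 0: "0 \<le> T * 2 ^ k" using assms by simp
  have 1: "real (nat \<lfloor>T * 2 ^ k\<rfloor>) = of_int \<lfloor>T * 2 ^ k\<rfloor>" using 0 by simp
  have 2: "of_int \<lfloor>T * 2 ^ k\<rfloor> \<le> T * 2 ^ k" "T * 2 ^ k < of_int \<lfloor>T * 2 ^ k\<rfloor> + 1" by linarith+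
  show "real (nat \<lfloor>T * 2 ^ k\<rfloor>) / 2 ^ k \<le> T" using 2(1) 1 by (simp add: field_simps)
  show "\<bar>real (nat \<lfloor>T * 2 ^ k\<rfloor>) / 2 ^ k - T\<bar> \<le> 1 / 2 ^ k"
  proof -
    have "real (nat \<lfloor>T * 2 ^ k\<rfloor>) / 2 ^ k - T = (of_int \<lfloor>T * 2 ^ k\<rfloor> - T * 2 ^ k) / 2 ^ k"
      unfolding 1 by (simp add: diff_divide_distrib)
    moreover have "\<bar>of_int \<lfloor>T * 2 ^ k\<rfloor> - T * 2 ^ k\<bar> \<le> 1" using 2 by linarith
    ultimately show ?thesis by (simp add: divide_right_mono)
  qed
qed

lemma floor_grid_tendsto:
  assumes "T \<in> {0..1::real}"
  shows "(\<lambda>k. real (nat \<lfloor>T * 2 ^ k\<rfloor>) / 2 ^ k) \<longlonglongrightarrow> T"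
proof (rule LIMSEQ_I)
  fix r :: real assume "0 < r"
  then obtain K where K: "(1 / 2) ^ K < r" using real_arch_pow_inv[of r "1/2"] by auto
  have "norm (real (nat \<lfloor>T * 2 ^ k\<rfloor>) / 2 ^ k - T) < r" if "k \<ge> K" for k
  proof -
    have "(1 / 2 :: real) ^ k \<le> (1 / 2) ^ K" using that by (intro power_decreasing) auto
    then show ?thesis using floor_grid(2)[OF assms, of k] K by (simp add: power_one_over)
  qed
  then show "\<exists>no. \<forall>n\<ge>no. norm (real (nat \<lfloor>T * 2 ^ n\<rfloor>) / 2 ^ n - T) < r" by blast
qed

lemma integral_grid_split:
  fixes f :: "real \<Rightarrow> real"
  assumes "continuous_on {0..1} f" and "N \<le> n"
  shows "integral {0..real N / real n} f = (\<Sum>l<N. integral {real l / real n..real (Suc l) / real n} f)"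
  using \<open>N \<le> n\<close>
proof (induction N)
  case (Suc N)
  have "f integrable_on {0..real (Suc N) / real n}"
    using grid_in_unit[OF Suc.prems]
    by (intro integrable_continuous_real continuous_on_subset[OF assms(1)]) auto
  then have "integral {0..real N / real n} f + integral {real N / real n..real (Suc N) / real n} f
      = integral {0..real (Suc N) / real n} f"
    by (intro Henstock_Kurzweil_Integration.integral_combine grid_le) auto
  then show ?case using Suc by simp
qed simp

lemma integral_minus_const_bound:
  fixes f :: "real \<Rightarrow> real"
  assumes "continuous_on {a..b} f" "a \<le> b" and "\<And>s. s \<in> {a..b} \<Longrightarrow> \<bar>f s - c\<bar> \<le> e"
  shows "\<bar>integral {a..b} f - c * (b - a)\<bar> \<le> e * (b - a)"
proof -
  have int: "f integrable_on {a..b}" using assms by (intro integrable_continuous_real)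
  have "integral {a..b} (\<lambda>s. f s - c) = integral {a..b} f - c * (b - a)"
    using int \<open>a \<le> b\<close> by (subst Henstock_Kurzweil_Integration.integral_diff) auto
  moreover have "norm (integral {a..b} (\<lambda>s. f s - c)) \<le> e * (b - a)"
    using assms by (intro integral_bound) (auto intro!: continuous_intros)
  ultimately show ?thesis by simp
qed

text \<open>The offset j selects left (0) or right (1) endpoints: the stochastic sums evaluate at
  the left, while the Gaussian density ratio contains \<sigma> at the point of arrival.\<close>

lemma riemann_sum_tendsto:
  fixes f :: "real \<Rightarrow> real"
  assumes f: "continuous_on {0..1} f" and T: "T \<in> {0..1}" and j: "j \<le> 1"
  shows "(\<lambda>k. \<Sum>l<nat \<lfloor>T * 2 ^ k\<rfloor>. f (real (l + j) / 2 ^ k) * (1 / 2 ^ k)) \<longlonglongrightarrow> integral {0..T} f"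
proof -
  let ?N = "\<lambda>k. nat \<lfloor>T * 2 ^ k\<rfloor>"
  let ?S = "\<lambda>k. \<Sum>l<?N k. f (real (l + j) / 2 ^ k) * (1 / 2 ^ k)"
  \<comment> \<open>The incomplete last cell is missing from the sum; continuity of the indefinite
    integral makes this harmless.\<close>
  have "continuous_on {0..1} (\<lambda>t. integral {0..t} f)"
    by (intro indefinite_integral_continuous_1 integrable_continuous_real f)
  moreover have "\<forall>\<^sub>F k in sequentially. real (?N k) / 2 ^ k \<in> {0..1}"
    using grid_in_unit[OF floor_grid(1)[OF T]] by (auto intro!: always_eventually)
  ultimately have 1: "(\<lambda>k. integral {0..real (?N k) / 2 ^ k} f) \<longlonglongrightarrow> integral {0..T} f"
    using continuous_on_tendsto_compose[OF _ floor_grid_tendsto[OF T] T] by blast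
  have 2: "(\<lambda>k. integral {0..real (?N k) / 2 ^ k} f - ?S k) \<longlonglongrightarrow> 0"
  proof (rule LIMSEQ_I)
    fix r :: real assume "0 < r"
    from uniform_grid_modulus[OF f half_gt_zero[OF this]] obtain K
      where K: "\<And>k s t. k \<ge> K \<Longrightarrow> s \<in> {0..1} \<Longrightarrow> t \<in> {0..1} \<Longrightarrow> \<bar>s - t\<bar> \<le> 1 / 2 ^ k
        \<Longrightarrow> \<bar>f s - f t\<bar> < r / 2" by blast
    have "norm (integral {0..real (?N k) / 2 ^ k} f - ?S k - 0) < r" if "k \<ge> K" for k
    proof -
      have *: "\<bar>integral {real l / 2 ^ k..real (Suc l) / 2 ^ k} f - f (real (l + j) / 2 ^ k) * (1 / 2 ^ k)\<bar> \<le> r / 2 * (1 / 2 ^ k)"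
        if "l < ?N k" for l
      proof -
        have le: "real l / 2 ^ k \<le> real (Suc l) / 2 ^ k" by (simp add: divide_right_mono)
        have l: "Suc l \<le> 2 ^ k" "l + j \<le> 2 ^ k" using that floor_grid(1)[OF T, of k] j by linarith+
        have len: "real (Suc l) / 2 ^ k - real l / 2 ^ k = 1 / 2 ^ k" by (simp add: field_simps)
        have u: "real l / 2 ^ k \<in> {0..1}" "real (Suc l) / 2 ^ k \<in> {0..1}" "real (l + j) / 2 ^ k \<in> {0..1}"
          using grid_in_unit[of l "2 ^ k"] grid_in_unit[of "Suc l" "2 ^ k"] grid_in_unit[of "l + j" "2 ^ k"] l by auto
        have m: "real l / 2 ^ k \<le> real (l + j) / 2 ^ k" "real (l + j) / 2 ^ k \<le> real (Suc l) / 2 ^ k"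
          using j by (auto simp: divide_right_mono)
        have "\<bar>f s - f (real (l + j) / 2 ^ k)\<bar> \<le> r / 2" if "s \<in> {real l / 2 ^ k..real (Suc l) / 2 ^ k}" for s
        proof -
          have "s \<in> {0..1}" "\<bar>s - real (l + j) / 2 ^ k\<bar> \<le> 1 / 2 ^ k"
            using that u(1,2) m len unfolding atLeastAtMost_iff abs_le_iff by linarith+
          then show ?thesis using K[OF \<open>k \<ge> K\<close> _ u(3)] by (intro less_imp_le) auto
        qed
        from integral_minus_const_bound[OF continuous_on_subset[OF f] le this] u show ?thesis
          unfolding len by auto
      qed
      have "integral {0..real (?N k) / 2 ^ k} f - ?S k =
        (\<Sum>l<?N k. integral {real l / 2 ^ k..real (Suc l) / 2 ^ k} f - f (real (l + j) / 2 ^ k) * (1 / 2 ^ k))"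
        using integral_grid_split[OF f floor_grid(1)[OF T]] by (simp add: sum_subtractf)
      also have "\<bar>\<dots>\<bar> \<le> (\<Sum>l<?N k. r / 2 * (1 / 2 ^ k))"
        by (rule order.trans[OF sum_abs sum_mono]) (use * in auto)
      also have "\<dots> = r / 2 * (real (?N k) / 2 ^ k)" by simp
      also have "\<dots> \<le> r / 2" using grid_in_unit[OF floor_grid(1)[OF T, of k]] \<open>0 < r\<close>
        by (intro mult_left_le) auto
      finally show ?thesis using \<open>0 < r\<close> by simp
    qed
    then show "\<exists>no. \<forall>n\<ge>no. norm (integral {0..real (?N n) / 2 ^ n} f - ?S n - 0) < r" by blast
  qed
  from tendsto_diff[OF 1 2] show ?thesis by simp
qed

lemma continuous_on_of_deriv:
  fixes f :: "real \<Rightarrow> real"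
  assumes "\<And>y. (f has_real_derivative f1 y) (at y)"
  shows "continuous_on A f"
  by (rule DERIV_continuous_on, rule has_field_derivative_at_within, rule assms)

section \<open>Square integrable functions and Brownian increments\<close>

definition sq_int :: "'a measure \<Rightarrow> ('a \<Rightarrow> real) \<Rightarrow> bool" where
  "sq_int M f \<longleftrightarrow> f \<in> borel_measurable M \<and> integrable M (\<lambda>x. (f x)\<^sup>2)"

lemma sq_int_measurable [measurable_dest]: "sq_int M f \<Longrightarrow> f \<in> borel_measurable M"
  and sq_int_integrable: "sq_int M f \<Longrightarrow> integrable M (\<lambda>x. (f x)\<^sup>2)"
  by (auto simp: sq_int_def)

lemma young_abs: "\<bar>x * y\<bar> \<le> x\<^sup>2 + (y::real)\<^sup>2"
proof -
  have "0 \<le> (\<bar>x\<bar> - \<bar>y\<bar>)\<^sup>2" "0 \<le> \<bar>x * y\<bar>" by auto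
  moreover have "(\<bar>x\<bar> - \<bar>y\<bar>)\<^sup>2 = x\<^sup>2 + y\<^sup>2 - 2 * \<bar>x * y\<bar>"
    by (simp add: power2_eq_square abs_mult algebra_simps)
  ultimately show ?thesis by linarith
qed

text \<open>The weight s is kept free: a suitable choice imitates Cauchy-Schwarz in
  \<open>integral_mult_L2_tendsto_zero\<close>, and the square root of the mesh balances two factors
  of different orders in \<open>AE_sum_\<rho>_cross\<close>.\<close>

lemma weighted_young: "2 * \<bar>x * y\<bar> \<le> s * x\<^sup>2 + y\<^sup>2 / s" if "0 < s" for x y s :: real
proof -
  have "0 \<le> (s * \<bar>x\<bar> - \<bar>y\<bar>)\<^sup>2" by simp
  then have "2 * s * \<bar>x * y\<bar> \<le> s\<^sup>2 * x\<^sup>2 + y\<^sup>2"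
    by (simp add: power2_eq_square algebra_simps abs_mult)
  then show ?thesis using that by (simp add: field_simps power2_eq_square)
qed

lemma square_add_le: "(x + y)\<^sup>2 \<le> 2 * x\<^sup>2 + 2 * (y::real)\<^sup>2"
  using zero_le_power2[of "x - y"] by (simp add: power2_eq_square algebra_simps)

lemma square_add3_le: "(x + y + z)\<^sup>2 \<le> 3 * x\<^sup>2 + 3 * y\<^sup>2 + 3 * (z::real)\<^sup>2"
  using zero_le_power2[of "x - y"] zero_le_power2[of "x - z"] zero_le_power2[of "y - z"]
  by (simp add: power2_eq_square algebra_simps)

lemma sq_int_mult_integrable:
  assumes "sq_int M f" "sq_int M g"
  shows "integrable M (\<lambda>x. f x * g x)"
proof (rule Bochner_Integration.integrable_bound)
  show "integrable M (\<lambda>x. (f x)\<^sup>2 + (g x)\<^sup>2)" using assms by (auto simp: sq_int_def)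
  show "(\<lambda>x. f x * g x) \<in> borel_measurable M" using assms by (auto simp: sq_int_def)
  show "AE x in M. norm (f x * g x) \<le> norm ((f x)\<^sup>2 + (g x)\<^sup>2)"
    using young_abs by (auto intro!: AE_I2)
qed

lemma sq_int_add:
  assumes "sq_int M f" "sq_int M g"
  shows "sq_int M (\<lambda>x. f x + g x)"
  using sq_int_mult_integrable[OF assms] assms
  by (auto simp: sq_int_def power2_sum mult.assoc)

lemma sq_int_cmult:
  assumes "sq_int M f"
  shows "sq_int M (\<lambda>x. c * f x)"
  using assms by (auto simp: sq_int_def power_mult_distrib)

lemma sq_int_diff:
  assumes "sq_int M f" "sq_int M g"
  shows "sq_int M (\<lambda>x. f x - g x)"
  using sq_int_add[OF assms(1) sq_int_cmult[OF assms(2), of "- 1"]] by simp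

lemma sq_int_zero: "sq_int M (\<lambda>x. 0)"
  by (simp add: sq_int_def)

lemma sq_int_sum:
  assumes "\<And>i. i \<in> I \<Longrightarrow> sq_int M (f i)"
  shows "sq_int M (\<lambda>x. \<Sum>i\<in>I. f i x)"
  using assms by (induction I rule: infinite_finite_induct) (auto intro: sq_int_add sq_int_zero)

lemma sq_int_bounded_mult:
  assumes "sq_int M f" "g \<in> borel_measurable M" "\<And>x. x \<in> space M \<Longrightarrow> \<bar>g x\<bar> \<le> c"
  shows "sq_int M (\<lambda>x. g x * f x)"
proof -
  have "integrable M (\<lambda>x. (g x * f x)\<^sup>2)"
  proof (rule Bochner_Integration.integrable_bound)
    show "integrable M (\<lambda>x. c\<^sup>2 * (f x)\<^sup>2)" using assms by (auto simp: sq_int_def)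
    show "(\<lambda>x. (g x * f x)\<^sup>2) \<in> borel_measurable M" using assms by (auto simp: sq_int_def)
    show "AE x in M. norm ((g x * f x)\<^sup>2) \<le> norm (c\<^sup>2 * (f x)\<^sup>2)"
      using assms(3) abs_le_square_iff[of _ c]
      by (auto intro!: AE_I2 mult_right_mono simp: power_mult_distrib)
         (meson abs_ge_self abs_le_square_iff order_trans)
  qed
  then show ?thesis using assms by (auto simp: sq_int_def)
qed

lemma (in finite_measure) sq_int_bounded:
  assumes "g \<in> borel_measurable M" "\<And>x. x \<in> space M \<Longrightarrow> \<bar>g x\<bar> \<le> c"
  shows "sq_int M g"
  using sq_int_bounded_mult[of M "\<lambda>_. 1" g c] assms by (simp add: sq_int_def)

lemma (in finite_measure) sq_int_imp_integrable: "sq_int M f \<Longrightarrow> integrable M f"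
  by (auto simp: sq_int_def intro: square_integrable_imp_integrable)

text \<open>The Ito integral is specified through nonnegative integrals; this turns bounds on them
  into square integrability.\<close>

lemma sq_int_nn:
  assumes "f \<in> borel_measurable M" "(\<integral>\<^sup>+x. ennreal ((f x)\<^sup>2) \<partial>M) \<le> ennreal c" "0 \<le> c"
  shows "sq_int M f" "(\<integral>x. (f x)\<^sup>2 \<partial>M) \<le> c"
proof -
  have "integrable M (\<lambda>x. (f x)\<^sup>2)"
    using assms by (intro integrableI_nonneg) (auto simp: le_less_trans)
  then show "sq_int M f" using assms by (auto simp: sq_int_def)
  then have "ennreal (\<integral>x. (f x)\<^sup>2 \<partial>M) = (\<integral>\<^sup>+x. ennreal ((f x)\<^sup>2) \<partial>M)"
    by (intro nn_integral_eq_integral[symmetric]) (auto simp: sq_int_def)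
  then have "ennreal (\<integral>x. (f x)\<^sup>2 \<partial>M) \<le> ennreal c" using assms(2) by simp
  then show "(\<integral>x. (f x)\<^sup>2 \<partial>M) \<le> c" using assms(3) by (simp add: ennreal_le_iff)
qed

text \<open>Continuity of the L2 inner product, by which orthogonality to the past survives the
  limit from simple integrals to Ito integrals.\<close>

lemma integral_mult_L2_tendsto_zero:
  assumes Z: "sq_int M Z" and X: "\<And>k. sq_int M (X k)" and lim: "(\<lambda>k. \<integral>x. (X k x)\<^sup>2 \<partial>M) \<longlonglongrightarrow> 0"
  shows "(\<lambda>k. \<integral>x. Z x * X k x \<partial>M) \<longlonglongrightarrow> 0"
proof (rule LIMSEQ_I)
  fix e :: real assume "0 < e"
  define A where "A = (\<integral>x. (Z x)\<^sup>2 \<partial>M)"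
  \<comment> \<open>Weight for Young's inequality: it makes \<open>h * A\<close> at most
    \<open>e\<close>, and the added 1 keeps the denominator positive when \<open>A\<close> is
    0.\<close>
  define h where "h = e / (A + 1)"
  have "0 \<le> A" unfolding A_def by simp
  then have "0 < h" using \<open>0 < e\<close> by (simp add: h_def)
  from LIMSEQ_D[OF lim, of "e * h"] obtain K where K: "\<And>k. k \<ge> K \<Longrightarrow> (\<integral>x. (X k x)\<^sup>2 \<partial>M) < e * h"
    using \<open>0 < e\<close> \<open>0 < h\<close> by auto
  have "norm ((\<integral>x. Z x * X k x \<partial>M) - 0) < e" if "k \<ge> K" for k
  proof -
    have pw: "\<bar>Z x * X k x\<bar> \<le> (h * (Z x)\<^sup>2 + (X k x)\<^sup>2 / h) / 2" for x
      using weighted_young[OF \<open>0 < h\<close>, of "Z x" "X k x"] by simp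
    have "norm (\<integral>x. Z x * X k x \<partial>M) \<le> (\<integral>x. (h * (Z x)\<^sup>2 + (X k x)\<^sup>2 / h) / 2 \<partial>M)"
      using pw Z X sq_int_mult_integrable[OF Z X]
      by (intro order.trans[OF integral_norm_bound integral_mono]) (auto simp: sq_int_def)
    also have "\<dots> = (h * A + (\<integral>x. (X k x)\<^sup>2 \<partial>M) / h) / 2"
      using Z X unfolding A_def by (auto simp: sq_int_def)
    also have "\<dots> < (e + e) / 2"
    proof -
      have "h * A \<le> e" using \<open>0 \<le> A\<close> \<open>0 < e\<close> by (simp add: h_def field_simps)
      moreover have "(\<integral>x. (X k x)\<^sup>2 \<partial>M) / h < e" using K[OF that] \<open>0 < h\<close> by (simp add: field_simps)
      ultimately show ?thesis by simp
    qed
    finally show ?thesis by simp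
  qed
  then show "\<exists>no. \<forall>k\<ge>no. norm ((\<integral>x. Z x * X k x \<partial>M) - 0) < e" by blast
qed

text \<open>Summable first moments make the sum of all absolute values finite almost surely, and the
  terms of a convergent series vanish. The geometric rate is what dyadic grids provide.\<close>

lemma AE_tendsto_zero_geometric:
  fixes S :: "nat \<Rightarrow> 'a \<Rightarrow> real"
  assumes [measurable]: "\<And>k. S k \<in> borel_measurable M"
    and bound: "\<And>k. (\<integral>\<^sup>+x. ennreal \<bar>S k x\<bar> \<partial>M) \<le> ennreal (C * q ^ k)"
    and "0 \<le> C" "0 \<le> q" "q < 1"
  shows "AE x in M. (\<lambda>k. S k x) \<longlonglongrightarrow> 0"
proof -
  have "(\<integral>\<^sup>+x. (\<Sum>k. ennreal \<bar>S k x\<bar>) \<partial>M) = (\<Sum>k. \<integral>\<^sup>+x. ennreal \<bar>S k x\<bar> \<partial>M)"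
    by (rule nn_integral_suminf) simp
  also have "\<dots> \<le> (\<Sum>k. ennreal (C * q ^ k))"
    using bound by (intro suminf_le) auto
  also have "\<dots> = ennreal (\<Sum>k. C * q ^ k)"
    using assms by (intro suminf_ennreal2) (auto intro!: summable_mult summable_geometric)
  also have "\<dots> < \<infinity>" by simp
  finally have "AE x in M. (\<Sum>k. ennreal \<bar>S k x\<bar>) \<noteq> \<infinity>"
    by (intro nn_integral_PInf_AE) auto
  then show ?thesis
  proof eventually_elim
    case (elim x)
    then have "summable (\<lambda>k. \<bar>S k x\<bar>)"
      by (intro summable_suminf_not_top) (auto simp: top_ennreal_def)
    then have "(\<lambda>k. \<bar>S k x\<bar>) \<longlonglongrightarrow> 0" by (rule summable_LIMSEQ_zero)
    then show ?case by (simp add: tendsto_rabs_zero_iff)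
  qed
qed

lemma AE_tendsto_zero_geometric_sq:
  assumes S: "\<And>k. sq_int M (S k)"
    and bound: "\<And>k. (\<integral>x. (S k x)\<^sup>2 \<partial>M) \<le> C * q ^ k"
    and "0 \<le> C" "0 \<le> q" "q < 1"
  shows "AE x in M. (\<lambda>k. S k x) \<longlonglongrightarrow> 0"
proof -
  have "AE x in M. (\<lambda>k. (S k x)\<^sup>2) \<longlonglongrightarrow> 0"
  proof (rule AE_tendsto_zero_geometric)
    fix k
    show "(\<lambda>x. (S k x)\<^sup>2) \<in> borel_measurable M" using S by (auto simp: sq_int_def)
    have "(\<integral>\<^sup>+x. ennreal \<bar>(S k x)\<^sup>2\<bar> \<partial>M) = ennreal (\<integral>x. (S k x)\<^sup>2 \<partial>M)"
      using S[of k] by (subst nn_integral_eq_integral) (auto simp: sq_int_def)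
    also have "\<dots> \<le> ennreal (C * q ^ k)" using bound by (intro ennreal_leI) auto
    finally show "(\<integral>\<^sup>+x. ennreal \<bar>(S k x)\<^sup>2\<bar> \<partial>M) \<le> ennreal (C * q ^ k)" .
  qed fact+
  then show ?thesis
  proof eventually_elim
    case (elim x)
    then have "(\<lambda>k. sqrt ((S k x)\<^sup>2)) \<longlonglongrightarrow> sqrt 0" by (intro tendsto_real_sqrt)
    then show ?case by (simp add: tendsto_rabs_zero_iff)
  qed
qed

section \<open>Brownian increments: independence, moments, orthogonality\<close>

locale brownian_setup =
  fixes W :: "'a measure" and F :: "real \<Rightarrow> 'a measure" and B :: "real \<Rightarrow> 'a \<Rightarrow> real"
  assumes filtered: "filtered_prob_space W F" and brownian: "brownian_motion W F B"

sublocale brownian_setup \<subseteq> prob_space W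
  using filtered by (simp add: filtered_prob_space_def)

context brownian_setup
begin

lemma meas_mono:
  assumes "f \<in> measurable (F s) N" "0 \<le> s" "s \<le> t" "t \<le> 1"
  shows "f \<in> measurable (F t) N"
  using filtered assms by (auto simp: filtered_prob_space_def intro: measurable_from_subalg)

lemma meas_W:
  assumes "f \<in> measurable (F s) N" "s \<in> {0..1}"
  shows "f \<in> measurable W N"
  using filtered assms by (auto simp: filtered_prob_space_def intro: measurable_from_subalg)

lemma space_F: "s \<in> {0..1} \<Longrightarrow> space (F s) = space W"
  using filtered by (auto simp: filtered_prob_space_def subalgebra_def)

lemma sets_F: "s \<in> {0..1} \<Longrightarrow> sets (F s) \<subseteq> sets W"
  using filtered by (auto simp: filtered_prob_space_def subalgebra_def)

lemma B_adapted: "s \<in> {0..1} \<Longrightarrow> B s \<in> borel_measurable (F s)"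
  using brownian by (auto simp: brownian_motion_def continuous_adapted_def)

lemma B_continuous: "\<omega> \<in> space W \<Longrightarrow> continuous_on {0..1} (\<lambda>t. B t \<omega>)"
  using brownian by (auto simp: brownian_motion_def continuous_adapted_def)

lemma B_0: "AE \<omega> in W. B 0 \<omega> = 0"
  using brownian by (auto simp: brownian_motion_def)

lemma dB_distributed:
  assumes "0 \<le> s" "s < t" "t \<le> 1"
  shows "distributed W lborel (\<lambda>\<omega>. B t \<omega> - B s \<omega>) (normal_density 0 (sqrt (t - s)))"
  using brownian assms by (auto simp: brownian_motion_def)

lemma dB_measurable:
  assumes "0 \<le> s" "s \<le> t" "t \<le> 1"
  shows "(\<lambda>\<omega>. B t \<omega> - B s \<omega>) \<in> borel_measurable (F t)"
  using B_adapted[of t] meas_mono[OF B_adapted[of s], of t] assms by auto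

lemma dB_meas_W:
  assumes "0 \<le> s" "s \<le> t" "t \<le> 1"
  shows "(\<lambda>\<omega>. B t \<omega> - B s \<omega>) \<in> borel_measurable W"
  using meas_W[OF dB_measurable[OF assms]] assms by auto

lemma dB_indep:
  assumes st: "0 \<le> s" "s < t" "t \<le> 1" and Y: "Y \<in> borel_measurable (F s)"
  shows "indep_var borel (Y :: 'a \<Rightarrow> real) borel (\<lambda>\<omega>. B t \<omega> - B s \<omega>)"
proof -
  let ?X = "\<lambda>\<omega>. B t \<omega> - B s \<omega>"
  have ind: "indep_set (sets (F s)) {?X -` A \<inter> space W | A. A \<in> sets borel}"
    using brownian st by (auto simp: brownian_motion_def)
  have Xm: "?X \<in> borel_measurable W" using dB_meas_W[of s t] st by auto
  \<comment> \<open>The preimages under \<open>?X\<close> already form a sigma-algebra, so the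
    generated one required by \<open>indep_var_eq\<close> is the family in the definition of
    Brownian motion.\<close>
  have "{?X -` A \<inter> space W | A. A \<in> sigma_sets UNIV (sets borel)}
      = sigma_sets (space W) {?X -` A \<inter> space W | A. A \<in> sets borel}"
    by (rule sigma_sets_vimage_commute) auto
  moreover have "sigma_sets UNIV (sets borel) = sets (borel :: real measure)"
    using sets.sigma_sets_eq[of borel] by simp
  ultimately have X: "sigma_sets (space W) {?X -` A \<inter> space W | A. A \<in> sets borel}
      = {?X -` A \<inter> space W | A. A \<in> sets borel}" by simp
  have "sigma_sets (space (F s)) {Y -` A \<inter> space (F s) | A. A \<in> sets borel} \<subseteq> sets (F s)"
    using Y by (intro sets.sigma_sets_subset) (auto intro: measurable_sets)
  then have Ysub: "sigma_sets (space W) {Y -` A \<inter> space W | A. A \<in> sets borel} \<subseteq> sets (F s)"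
    using space_F[of s] st by simp
  show ?thesis
    unfolding indep_var_eq
  proof (intro conjI)
    show "indep_set (sigma_sets (space W) {Y -` A \<inter> space W |A. A \<in> sets borel})
       (sigma_sets (space W) {?X -` A \<inter> space W |A. A \<in> sets borel})"
      unfolding X
    proof (rule indep_setI)
      show "sigma_sets (space W) {Y -` A \<inter> space W |A. A \<in> sets borel} \<subseteq> events"
        using Ysub sets_F[of s] st by auto
      show "{?X -` A \<inter> space W | A. A \<in> sets borel} \<subseteq> events" using Xm by auto
      show "prob (a \<inter> b) = prob a * prob b"
        if "a \<in> sigma_sets (space W) {Y -` A \<inter> space W |A. A \<in> sets borel}"
          "b \<in> {?X -` A \<inter> space W | A. A \<in> sets borel}" for a b
        using indep_setD[OF ind] that Ysub by blast
    qed
  qed (use Xm meas_W[OF Y] st in auto)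
qed

text \<open>Freezing: the increment is independent of the past, so it can be integrated out with
  \<open>Y\<close> held fixed. \<open>Y\<close> may take values in any measurable space because it
  will be the whole past of a chain.\<close>

lemma dB_freeze:
  assumes st: "0 \<le> s" "s < t" "t \<le> 1" and Y: "Y \<in> measurable (F s) S"
    and Psi [measurable]: "Psi \<in> borel_measurable (S \<Otimes>\<^sub>M borel)"
  shows "(\<integral>\<^sup>+\<omega>. Psi (Y \<omega>, B t \<omega> - B s \<omega>) \<partial>W)
    = (\<integral>\<^sup>+\<omega>. (\<integral>\<^sup>+z. ennreal (normal_density 0 (sqrt (t - s)) z) * Psi (Y \<omega>, z) \<partial>lborel) \<partial>W)"
proof -
  let ?X = "\<lambda>\<omega>. B t \<omega> - B s \<omega>"
  have [measurable]: "?X \<in> borel_measurable W" using dB_meas_W[of s t] st by auto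
  have [measurable]: "Y \<in> measurable W S" using meas_W[OF Y] st by auto
  interpret X: prob_space "distr W borel ?X" by (rule prob_space_distr) simp
  have D: "distr W borel ?X = density lborel (normal_density 0 (sqrt (t - s)))"
    using distributed_distr_eq_density[OF dB_distributed[OF st]]
    by (simp add: distr_cong[OF refl sets_lborel[symmetric] refl])
  interpret Y: prob_space "distr W S Y" by (rule prob_space_distr) simp
  have ind: "indep_set (sets (F s)) {?X -` A \<inter> space W | A. A \<in> sets borel}"
    using brownian st by (auto simp: brownian_motion_def)
  have joint: "distr W S Y \<Otimes>\<^sub>M distr W borel ?X = distr W (S \<Otimes>\<^sub>M borel) (\<lambda>\<omega>. (Y \<omega>, ?X \<omega>))"
  proof (rule pair_measure_eqI)
    fix A C assume AC: "A \<in> sets (distr W S Y)" "C \<in> sets (distr W borel ?X)"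
    have "Y -` A \<inter> space W \<in> sets (F s)"
      using measurable_sets[OF Y, of A] AC space_F[of s] st by auto
    then have "prob ((Y -` A \<inter> space W) \<inter> (?X -` C \<inter> space W))
        = prob (Y -` A \<inter> space W) * prob (?X -` C \<inter> space W)"
      using AC by (intro indep_setD[OF ind]) auto
    moreover have "(\<lambda>\<omega>. (Y \<omega>, ?X \<omega>)) -` (A \<times> C) \<inter> space W
        = (Y -` A \<inter> space W) \<inter> (?X -` C \<inter> space W)" by auto
    ultimately show "emeasure (distr W S Y) A * emeasure (distr W borel ?X) C
        = emeasure (distr W (S \<Otimes>\<^sub>M borel) (\<lambda>\<omega>. (Y \<omega>, ?X \<omega>))) (A \<times> C)"
      using AC by (simp add: emeasure_distr emeasure_eq_measure ennreal_mult)
  qed (auto intro: X.sigma_finite_measure_axioms Y.sigma_finite_measure_axioms)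
  have "(\<integral>\<^sup>+\<omega>. Psi (Y \<omega>, ?X \<omega>) \<partial>W) = (\<integral>\<^sup>+p. Psi p \<partial>distr W (S \<Otimes>\<^sub>M borel) (\<lambda>\<omega>. (Y \<omega>, ?X \<omega>)))"
    by (subst nn_integral_distr) auto
  also have "\<dots> = (\<integral>\<^sup>+p. Psi p \<partial>(distr W S Y \<Otimes>\<^sub>M distr W borel ?X))"
    unfolding joint ..
  also have "\<dots> = (\<integral>\<^sup>+y. \<integral>\<^sup>+z. Psi (y, z) \<partial>distr W borel ?X \<partial>distr W S Y)"
    by (subst X.nn_integral_fst) (auto simp: measurable_cong_sets[OF sets_pair_measure_cong[OF sets_distr sets_distr] refl])
  also have "\<dots> = (\<integral>\<^sup>+\<omega>. \<integral>\<^sup>+z. Psi (Y \<omega>, z) \<partial>distr W borel ?X \<partial>W)"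
  proof (subst nn_integral_distr)
    have "(\<lambda>y. \<integral>\<^sup>+z. Psi (y, z) \<partial>distr W borel ?X) \<in> borel_measurable S"
      using X.borel_measurable_nn_integral_fst[of Psi S]
      by (simp add: measurable_cong_sets[OF sets_pair_measure_cong[OF refl sets_distr] refl])
    then show "(\<lambda>y. \<integral>\<^sup>+z. Psi (y, z) \<partial>distr W borel ?X) \<in> borel_measurable (distr W S Y)" by simp
  qed auto
  also have "\<dots> = (\<integral>\<^sup>+\<omega>. (\<integral>\<^sup>+z. ennreal (normal_density 0 (sqrt (t - s)) z) * Psi (Y \<omega>, z) \<partial>lborel) \<partial>W)"
    unfolding D by (intro nn_integral_cong nn_integral_density) auto
  finally show ?thesis .
qed

lemma dB_moments:
  assumes st: "0 \<le> s" "s < t" "t \<le> 1"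
  shows "integrable W (\<lambda>\<omega>. B t \<omega> - B s \<omega>)" "(\<integral>\<omega>. B t \<omega> - B s \<omega> \<partial>W) = 0"
    "integrable W (\<lambda>\<omega>. (B t \<omega> - B s \<omega>)\<^sup>2)" "(\<integral>\<omega>. (B t \<omega> - B s \<omega>)\<^sup>2 \<partial>W) = t - s"
    "integrable W (\<lambda>\<omega>. (B t \<omega> - B s \<omega>) ^ 4)" "(\<integral>\<omega>. (B t \<omega> - B s \<omega>) ^ 4 \<partial>W) = 3 * (t - s)\<^sup>2"
proof -
  let ?X = "\<lambda>\<omega>. B t \<omega> - B s \<omega>"
  note D = dB_distributed[OF st]
  have m: "integrable W (\<lambda>\<omega>. ?X \<omega> ^ n)" "(\<integral>\<omega>. ?X \<omega> ^ n \<partial>W) = v"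
    if "has_bochner_integral lborel (\<lambda>x. normal_density 0 (sqrt (t - s)) x * x ^ n) v" for n v
    using that distributed_integrable[OF D, of "\<lambda>x. x ^ n"] distributed_integral[OF D, of "\<lambda>x. x ^ n"]
    by (auto simp: has_bochner_integral_iff normal_density_nonneg)
  show "integrable W ?X" "(\<integral>\<omega>. ?X \<omega> \<partial>W) = 0"
    using m[of 1 0] normal_moment_odd[of "sqrt (t - s)" 0 0] st by simp_all
  show "integrable W (\<lambda>\<omega>. ?X \<omega> ^ 2)" "(\<integral>\<omega>. ?X \<omega> ^ 2 \<partial>W) = t - s"
    using m[of 2 "t - s"] normal_moment_even[of "sqrt (t - s)" 0 1] st
    by (auto simp: diff_divide_distrib)
  have "fact 4 / ((2 / (sqrt (t - s))\<^sup>2)\<^sup>2 * fact 2) = 3 * (t - s)\<^sup>2"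
    using st by (simp add: fact_numeral power_divide)
  then show "integrable W (\<lambda>\<omega>. ?X \<omega> ^ 4)" "(\<integral>\<omega>. ?X \<omega> ^ 4 \<partial>W) = 3 * (t - s)\<^sup>2"
    using m[of 4 "3 * (t - s)\<^sup>2"] normal_moment_even[of "sqrt (t - s)" 0 2] st by auto
qed

lemma indep_mult:
  assumes st: "0 \<le> s" "s < t" "t \<le> 1" and Z: "Z \<in> borel_measurable (F s)" "integrable W Z"
    and f: "f \<in> borel_measurable borel" "integrable W (\<lambda>\<omega>. f (B t \<omega> - B s \<omega>) :: real)"
  shows "integrable W (\<lambda>\<omega>. Z \<omega> * f (B t \<omega> - B s \<omega>))"
    "(\<integral>\<omega>. Z \<omega> * f (B t \<omega> - B s \<omega>) \<partial>W) = (\<integral>\<omega>. Z \<omega> \<partial>W) * (\<integral>\<omega>. f (B t \<omega> - B s \<omega>) \<partial>W)"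
proof -
  have "indep_var borel (id \<circ> Z) borel (f \<circ> (\<lambda>\<omega>. B t \<omega> - B s \<omega>))"
    by (rule indep_var_compose[OF dB_indep[OF st Z(1)]]) (use f in auto)
  then have "indep_var borel Z borel (\<lambda>\<omega>. f (B t \<omega> - B s \<omega>))" by (simp add: comp_def)
  from indep_var_integrable[OF this Z(2) f(2)] indep_var_lebesgue_integral[OF this Z(2) f(2)]
  show "integrable W (\<lambda>\<omega>. Z \<omega> * f (B t \<omega> - B s \<omega>))"
    "(\<integral>\<omega>. Z \<omega> * f (B t \<omega> - B s \<omega>) \<partial>W) = (\<integral>\<omega>. Z \<omega> \<partial>W) * (\<integral>\<omega>. f (B t \<omega> - B s \<omega>) \<partial>W)" .
qed

lemma mult_dB:
  assumes st: "0 \<le> s" "s \<le> t" "t \<le> 1" and Z: "Z \<in> borel_measurable (F s)" "sq_int W Z"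
  shows "sq_int W (\<lambda>\<omega>. Z \<omega> * (B t \<omega> - B s \<omega>))"
    "(\<integral>\<omega>. Z \<omega> * (B t \<omega> - B s \<omega>) \<partial>W) = 0"
    "(\<integral>\<omega>. (Z \<omega> * (B t \<omega> - B s \<omega>))\<^sup>2 \<partial>W) = (\<integral>\<omega>. (Z \<omega>)\<^sup>2 \<partial>W) * (t - s)"
proof -
  have "sq_int W (\<lambda>\<omega>. Z \<omega> * (B t \<omega> - B s \<omega>)) \<and> (\<integral>\<omega>. Z \<omega> * (B t \<omega> - B s \<omega>) \<partial>W) = 0 \<and>
    (\<integral>\<omega>. (Z \<omega> * (B t \<omega> - B s \<omega>))\<^sup>2 \<partial>W) = (\<integral>\<omega>. (Z \<omega>)\<^sup>2 \<partial>W) * (t - s)"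
  \<comment> \<open>Clamped partitions contain degenerate cells, on which the definition of Brownian
    motion says nothing.\<close>
  proof (cases "s = t")
    case True
    then show ?thesis by (simp add: sq_int_zero)
  next
    case False
    then have st': "0 \<le> s" "s < t" "t \<le> 1" using st by auto
    note m = dB_moments[OF st']
    have Xm: "(\<lambda>\<omega>. B t \<omega> - B s \<omega>) \<in> borel_measurable W" using dB_meas_W[of s t] st by auto
    have 1: "(\<integral>\<omega>. Z \<omega> * (B t \<omega> - B s \<omega>) \<partial>W) = 0"
      using indep_mult(2)[OF st' Z(1) sq_int_imp_integrable[OF Z(2)], of "\<lambda>x. x"] m by simp
    have Z2: "(\<lambda>\<omega>. (Z \<omega>)\<^sup>2) \<in> borel_measurable (F s)" using Z by simp
    have 2: "integrable W (\<lambda>\<omega>. (Z \<omega>)\<^sup>2 * (B t \<omega> - B s \<omega>)\<^sup>2)"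
      "(\<integral>\<omega>. (Z \<omega>)\<^sup>2 * (B t \<omega> - B s \<omega>)\<^sup>2 \<partial>W) = (\<integral>\<omega>. (Z \<omega>)\<^sup>2 \<partial>W) * (t - s)"
      using indep_mult[OF st' Z2 sq_int_integrable[OF Z(2)], of "\<lambda>x. x\<^sup>2"] m by auto
    show ?thesis using 1 2 Xm Z by (auto simp: sq_int_def power_mult_distrib)
  qed
  then show "sq_int W (\<lambda>\<omega>. Z \<omega> * (B t \<omega> - B s \<omega>))"
    "(\<integral>\<omega>. Z \<omega> * (B t \<omega> - B s \<omega>) \<partial>W) = 0"
    "(\<integral>\<omega>. (Z \<omega> * (B t \<omega> - B s \<omega>))\<^sup>2 \<partial>W) = (\<integral>\<omega>. (Z \<omega>)\<^sup>2 \<partial>W) * (t - s)" by auto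
qed

text \<open>Pythagoras for martingale differences: the partial sum up to \<open>p n\<close> is
  measurable with respect to \<open>F (p n)\<close>, hence an admissible \<open>Z\<close> against
  the next difference.\<close>

lemma orthogonal_sum:
  assumes p: "0 \<le> p 0" "\<And>i. i < N \<Longrightarrow> p i \<le> p (Suc i)" "p N \<le> 1"
    and D: "\<And>i. i < N \<Longrightarrow> D i \<in> borel_measurable (F (p (Suc i)))" "\<And>i. i < N \<Longrightarrow> sq_int W (D i)"
    and orth: "\<And>i Z. i < N \<Longrightarrow> Z \<in> borel_measurable (F (p i)) \<Longrightarrow> sq_int W Z \<Longrightarrow> (\<integral>\<omega>. Z \<omega> * D i \<omega> \<partial>W) = 0"
  shows "(\<integral>\<omega>. (\<Sum>i<N. D i \<omega>)\<^sup>2 \<partial>W) = (\<Sum>i<N. \<integral>\<omega>. (D i \<omega>)\<^sup>2 \<partial>W)"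
    "sq_int W (\<lambda>\<omega>. \<Sum>i<N. D i \<omega>)"
proof -
  have p_mono: "p i \<le> p j" if "i \<le> j" "j \<le> N" for i j
    using that
  proof (induction j rule: nat_induct_at_least)
    case (Suc n)
    then show ?case using p(2)[of n] by linarith
  qed simp
  have "(\<lambda>\<omega>. \<Sum>i<n. D i \<omega>) \<in> borel_measurable (F (p n)) \<and>
    (\<integral>\<omega>. (\<Sum>i<n. D i \<omega>)\<^sup>2 \<partial>W) = (\<Sum>i<n. \<integral>\<omega>. (D i \<omega>)\<^sup>2 \<partial>W)" if "n \<le> N" for n
    using that
  proof (induction n)
    case (Suc n)
    let ?S = "\<lambda>\<omega>. \<Sum>i<n. D i \<omega>"
    have n: "0 \<le> p n" "p n \<le> p (Suc n)" "p (Suc n) \<le> 1"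
      using p_mono[of 0 n] p_mono[of n "Suc n"] p_mono[of "Suc n" N] p Suc.prems by auto
    have S: "?S \<in> borel_measurable (F (p n))" "sq_int W ?S" "sq_int W (D n)"
      using Suc D by (auto intro!: sq_int_sum)
    have "?S \<in> borel_measurable (F (p (Suc n)))" using meas_mono[OF S(1) n] .
    then have 1: "(\<lambda>\<omega>. ?S \<omega> + D n \<omega>) \<in> borel_measurable (F (p (Suc n)))"
      using D(1)[of n] Suc.prems by auto
    have "(\<integral>\<omega>. (?S \<omega> + D n \<omega>)\<^sup>2 \<partial>W) = (\<integral>\<omega>. (?S \<omega>)\<^sup>2 + (D n \<omega>)\<^sup>2 + 2 * (?S \<omega> * D n \<omega>) \<partial>W)"
      by (simp add: power2_sum mult.assoc)
    also have "\<dots> = (\<integral>\<omega>. (?S \<omega>)\<^sup>2 \<partial>W) + (\<integral>\<omega>. (D n \<omega>)\<^sup>2 \<partial>W) + 2 * (\<integral>\<omega>. ?S \<omega> * D n \<omega> \<partial>W)"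
      using sq_int_mult_integrable[OF S(2,3)] S by (simp add: sq_int_def)
    also have "(\<integral>\<omega>. ?S \<omega> * D n \<omega> \<partial>W) = 0" using orth[OF _ S(1,2)] Suc.prems by simp
    finally show ?case using 1 Suc by simp
  qed simp
  then show "(\<integral>\<omega>. (\<Sum>i<N. D i \<omega>)\<^sup>2 \<partial>W) = (\<Sum>i<N. \<integral>\<omega>. (D i \<omega>)\<^sup>2 \<partial>W)" by blast
  show "sq_int W (\<lambda>\<omega>. \<Sum>i<N. D i \<omega>)" using D by (auto intro!: sq_int_sum)
qed

end

section \<open>Second moments of Ito integrals\<close>

text \<open>For s <= t this is the projection onto [s, t]. It serves twice: to cut the times of a
  simple integrand down to a window, and to extend a process from [0, 1] to the whole line.\<close>

definition clamp_time :: "real \<Rightarrow> real \<Rightarrow> real \<Rightarrow> real" where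
  "clamp_time s t a = max s (min a t)"

lemma clamp_time_bounds: "s \<le> t \<Longrightarrow> s \<le> clamp_time s t a \<and> clamp_time s t a \<le> t"
  and clamp_time_mono: "a \<le> b \<Longrightarrow> clamp_time s t a \<le> clamp_time s t b"
  by (auto simp: clamp_time_def)

lemma clamp_time_lessD: "clamp_time s t a < r \<Longrightarrow> r \<le> t \<Longrightarrow> a < r"
  and clamp_time_geD: "r \<le> clamp_time s t a \<Longrightarrow> s < r \<Longrightarrow> r \<le> a"
  and clamp_time_ge: "a \<le> t \<Longrightarrow> a \<le> clamp_time s t a"
  by (auto simp: clamp_time_def min_def max_def split: if_splits)

lemma simple_integrand_times:
  assumes "simple_integrand W F n \<tau> \<xi>"
  shows "\<And>i j. i \<le> j \<Longrightarrow> j \<le> n \<Longrightarrow> \<tau> i \<le> \<tau> j" "\<And>i. i \<le> n \<Longrightarrow> \<tau> i \<in> {0..1}"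
proof -
  show mono: "\<tau> i \<le> \<tau> j" if "i \<le> j" "j \<le> n" for i j
    using that
  proof (induction j rule: nat_induct_at_least)
    case (Suc m)
    then have "\<tau> m \<le> \<tau> (Suc m)" "\<tau> i \<le> \<tau> m" using assms by (auto simp: simple_integrand_def)
    then show ?case by simp
  qed simp
  show "\<tau> i \<in> {0..1}" if "i \<le> n" for i
    using mono[of 0 i] mono[of i n] that assms by (auto simp: simple_integrand_def)
qed

section \<open>Second moments and orthogonality for simple integrals\<close>

context brownian_setup
begin

lemma simple_integral_increment:
  assumes "s \<le> t"
  shows "simple_integral B n \<tau> \<xi> t \<omega> - simple_integral B n \<tau> \<xi> s \<omega>
    = (\<Sum>i<n. \<xi> i \<omega> * (B (clamp_time s t (\<tau> (Suc i))) \<omega> - B (clamp_time s t (\<tau> i)) \<omega>))"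
proof -
  have *: "B (min a t) \<omega> - B (min a s) \<omega> = B (clamp_time s t a) \<omega> - B s \<omega>" for a
    using assms by (auto simp: clamp_time_def min_def max_def)
  have "simple_integral B n \<tau> \<xi> t \<omega> - simple_integral B n \<tau> \<xi> s \<omega>
    = (\<Sum>i<n. \<xi> i \<omega> * ((B (min (\<tau> (Suc i)) t) \<omega> - B (min (\<tau> (Suc i)) s) \<omega>)
        - (B (min (\<tau> i) t) \<omega> - B (min (\<tau> i) s) \<omega>)))"
    unfolding simple_integral_def sum_subtractf[symmetric] by (intro sum.cong) (auto simp: algebra_simps)
  then show ?thesis unfolding * by (simp add: algebra_simps)
qed

lemma simple_integral_measurable:
  assumes "simple_integrand W F n \<tau> \<xi>" "t \<in> {0..1}"
  shows "simple_integral B n \<tau> \<xi> t \<in> borel_measurable W"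
proof -
  note \<tau>_mono = simple_integrand_times(1)[OF assms(1)] and \<tau> = simple_integrand_times(2)[OF assms(1)]
  have "\<xi> i \<in> borel_measurable W" if "i < n" for i
    using assms \<tau>[of i] that by (auto simp: simple_integrand_def intro!: meas_W[of _ "\<tau> i"])
  moreover have "B (min (\<tau> i) t) \<in> borel_measurable W" if "i \<le> n" for i
    using \<tau>[OF that] assms(2) by (intro meas_W[OF B_adapted]) (auto simp: min_def)
  ultimately show ?thesis unfolding simple_integral_def
    by (intro borel_measurable_sum borel_measurable_times borel_measurable_diff) auto
qed

text \<open>
  The partition \<open>p\<close> of \<open>[s,t]\<close> consists of \<open>s\<close>, the clamped times \<open>\<tau>\<close> and \<open>t\<close>; on its
  first and last cell the simple process vanishes. Coefficients at times \<open>\<tau> i \<ge> t\<close>, which are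
  not \<open>F t\<close>-measurable, are multiplied by a zero increment and may be replaced by \<open>0\<close>.
\<close>

lemma simple_integral_estimates:
  assumes si: "simple_integrand W F n \<tau> \<xi>" and st: "0 \<le> s" "s \<le> t" "t \<le> 1"
    and \<zeta>: "\<zeta> \<in> borel_measurable (F s)" "\<And>\<omega>. \<omega> \<in> space W \<Longrightarrow> \<bar>\<zeta> \<omega>\<bar> \<le> c"
  defines "R \<equiv> \<lambda>\<omega>. simple_integral B n \<tau> \<xi> t \<omega> - simple_integral B n \<tau> \<xi> s \<omega> - \<zeta> \<omega> * (B t \<omega> - B s \<omega>)"
  shows "sq_int W R"
    "(\<integral>\<^sup>+\<omega>. ennreal ((R \<omega>)\<^sup>2) \<partial>W)
      \<le> (\<integral>\<^sup>+\<omega>. (\<integral>\<^sup>+r\<in>{s..t}. ennreal ((simple_process n \<tau> \<xi> r \<omega> - \<zeta> \<omega>)\<^sup>2) \<partial>lborel) \<partial>W)"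
    "\<And>Z. Z \<in> borel_measurable (F s) \<Longrightarrow> sq_int W Z \<Longrightarrow> (\<integral>\<omega>. Z \<omega> * R \<omega> \<partial>W) = 0"
proof -
  \<comment> \<open>Indices are shifted by one: for 0 < i < n + 1, cell i from \<open>p i\<close> to
    \<open>p (Suc i)\<close> is the clamped cell i - 1 of \<tau>; cells 0 and n + 1 fill the gaps at
    both ends.\<close>
  define p where "p i = (if i = 0 then s else if i = n + 2 then t else clamp_time s t (\<tau> (i - 1)))" for i
  \<comment> \<open>The coefficient on cell i after subtraction of the constant integrand \<zeta>,
    so that \<open>R\<close> is the simple integral of \<eta>. Comparison with a frozen integrand is
    what the Euler error of the diffusion requires.\<close>
  define \<eta> where "\<eta> i \<omega> = (if 0 < i \<and> i < n + 1 \<and> \<tau> (i - 1) < t then \<xi> (i - 1) \<omega> else 0) - \<zeta> \<omega>" for i \<omega>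
  note \<tau>_mono = simple_integrand_times(1)[OF si] and \<tau> = simple_integrand_times(2)[OF si]
  have p_0: "p 0 = s" and p_last: "p (n + 2) = t" by (simp_all add: p_def)
  have p_mid: "p i = clamp_time s t (\<tau> (i - 1))" if "0 < i" "i < n + 2" for i using that by (simp add: p_def)
  have p_in: "s \<le> p i" "p i \<le> t" for i
    using clamp_time_bounds[OF st(2), of "\<tau> (i - 1)"] st(2) unfolding p_def by auto
  have p_mono: "p i \<le> p (Suc i)" if "i < n + 2" for i
  proof -
    consider "i = 0" | "i = n + 1" | "0 < i" "i < n + 1" using \<open>i < n + 2\<close> by linarith
    then show ?thesis
    proof cases
      case 1
      then show ?thesis using p_in(1)[of "Suc i"] p_0 by simp
    next
      case 2
      then show ?thesis using p_in(2)[of i] p_last by simp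
    next
      case 3
      then show ?thesis
        using clamp_time_mono[OF \<tau>_mono[of "i - 1" i], of s t] by (simp add: p_mid)
    qed
  qed
  have p01: "p i \<in> {0..1}" for i using p_in[of i] st by auto
  have \<eta>_meas: "\<eta> i \<in> borel_measurable (F (p i))" if "i < n + 2" for i
  proof -
    have \<zeta>m: "\<zeta> \<in> borel_measurable (F (p i))" using meas_mono[OF \<zeta>(1), of "p i"] p_in[of i] st by auto
    have "\<xi> (i - 1) \<in> borel_measurable (F (p i))" if *: "0 < i" "i < n + 1" "\<tau> (i - 1) < t"
    proof -
      have "\<xi> (i - 1) \<in> borel_measurable (F (\<tau> (i - 1)))" using si * by (auto simp: simple_integrand_def)
      moreover have "\<tau> (i - 1) \<le> p i" using * clamp_time_ge[of "\<tau> (i - 1)" t s] by (simp add: p_mid)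
      ultimately show ?thesis using \<tau>[of "i - 1"] p01[of i] *
        by - (rule meas_mono[where s = "\<tau> (i - 1)"], auto)
    qed
    then show ?thesis using \<zeta>m unfolding \<eta>_def by (cases "0 < i \<and> i < n + 1 \<and> \<tau> (i - 1) < t") auto
  qed
  have \<eta>_bd: "\<exists>C. \<forall>\<omega>\<in>space W. \<bar>\<eta> i \<omega>\<bar> \<le> C" if "i < n + 2" for i
  proof (cases "0 < i \<and> i < n + 1 \<and> \<tau> (i - 1) < t")
    case True
    then have "i - 1 < n" by linarith
    then obtain C where "\<forall>\<omega>\<in>space W. \<bar>\<xi> (i - 1) \<omega>\<bar> \<le> C" using si unfolding simple_integrand_def by blast
    then have "\<forall>\<omega>\<in>space W. \<bar>\<eta> i \<omega>\<bar> \<le> C + c" using True \<zeta>(2) by (fastforce simp: \<eta>_def)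
    then show ?thesis by blast
  next
    case False
    then have "\<forall>\<omega>\<in>space W. \<bar>\<eta> i \<omega>\<bar> \<le> c" using \<zeta>(2) unfolding \<eta>_def by auto
    then show ?thesis by blast
  qed
  define D where "D i \<omega> = \<eta> i \<omega> * (B (p (Suc i)) \<omega> - B (p i) \<omega>)" for i \<omega>
  have R_eq: "R = (\<lambda>\<omega>. \<Sum>i<n+2. D i \<omega>)"
  proof
    fix \<omega>
    have tel: "(\<Sum>i<n+2. B (p (Suc i)) \<omega> - B (p i) \<omega>) = B t \<omega> - B s \<omega>"
      by (subst sum_lessThan_telescope) (simp add: p_def)
    have "(\<Sum>i<n+2. D i \<omega>) = (\<Sum>i<n+2. (if 0 < i \<and> i < n + 1 \<and> \<tau> (i - 1) < t then \<xi> (i - 1) \<omega> else 0) * (B (p (Suc i)) \<omega> - B (p i) \<omega>))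
        - \<zeta> \<omega> * (\<Sum>i<n+2. B (p (Suc i)) \<omega> - B (p i) \<omega>)"
      unfolding D_def \<eta>_def left_diff_distrib[of _ "\<zeta> \<omega>"] sum_subtractf[of "\<lambda>i. _ i * _ i"] sum_distrib_left[of "\<zeta> \<omega>"] ..
    also have "(\<Sum>i<n+2. (if 0 < i \<and> i < n + 1 \<and> \<tau> (i - 1) < t then \<xi> (i - 1) \<omega> else 0) * (B (p (Suc i)) \<omega> - B (p i) \<omega>))
      = (\<Sum>i<n. (if \<tau> i < t then \<xi> i \<omega> else 0) * (B (p (Suc (Suc i))) \<omega> - B (p (Suc i)) \<omega>))"
      unfolding add_2_eq_Suc' sum.lessThan_Suc_shift[of _ "Suc n"] by (simp add: sum.lessThan_Suc cong: if_cong)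
    also have "\<dots> = (\<Sum>i<n. \<xi> i \<omega> * (B (clamp_time s t (\<tau> (Suc i))) \<omega> - B (clamp_time s t (\<tau> i)) \<omega>))"
    proof (intro sum.cong refl)
      fix i assume "i \<in> {..<n}"
      then have "i < n" by simp
      have "clamp_time s t (\<tau> (Suc i)) = clamp_time s t (\<tau> i)" if "\<not> \<tau> i < t"
        using \<tau>_mono[of i "Suc i"] \<open>i < n\<close> that by (simp add: clamp_time_def)
      then show "(if \<tau> i < t then \<xi> i \<omega> else 0) * (B (p (Suc (Suc i))) \<omega> - B (p (Suc i)) \<omega>)
        = \<xi> i \<omega> * (B (clamp_time s t (\<tau> (Suc i))) \<omega> - B (clamp_time s t (\<tau> i)) \<omega>)"
        using \<open>i < n\<close> by (simp add: p_mid)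
    qed
    also have "\<dots> = simple_integral B n \<tau> \<xi> t \<omega> - simple_integral B n \<tau> \<xi> s \<omega>"
      by (rule simple_integral_increment[OF st(2), symmetric])
    finally show "R \<omega> = (\<Sum>i<n+2. D i \<omega>)" unfolding tel R_def by simp
  qed
  have \<eta>_sq: "sq_int W (\<eta> i)" if "i < n + 2" for i
    using \<eta>_bd[OF that] sq_int_bounded[of "\<eta> i"] meas_W[OF \<eta>_meas[OF that] p01] by blast
  have mono: "0 \<le> p i" "p i \<le> p (Suc i)" "p (Suc i) \<le> 1" if "i < n + 2" for i
    using p_mono[OF that] p01[of i] p01[of "Suc i"] by auto
  have D_meas: "D i \<in> borel_measurable (F (p (Suc i)))" if "i < n + 2" for i
    using meas_mono[OF \<eta>_meas[OF that] mono[OF that]] dB_measurable[OF mono[OF that]]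
    unfolding D_def by auto
  have D_sq: "sq_int W (D i)" and D_var: "(\<integral>\<omega>. (D i \<omega>)\<^sup>2 \<partial>W) = (\<integral>\<omega>. (\<eta> i \<omega>)\<^sup>2 \<partial>W) * (p (Suc i) - p i)"
    if "i < n + 2" for i
    using mult_dB[OF mono[OF that] \<eta>_meas[OF that] \<eta>_sq[OF that]] unfolding D_def by auto
  have D_orth: "(\<integral>\<omega>. Z \<omega> * D i \<omega> \<partial>W) = 0"
    if "i < n + 2" "Z \<in> borel_measurable (F (p i))" "sq_int W Z" for i Z
  proof -
    obtain C where C: "\<forall>\<omega>\<in>space W. \<bar>\<eta> i \<omega>\<bar> \<le> C" using \<eta>_bd[OF \<open>i < n + 2\<close>] by blast
    have "sq_int W (\<lambda>\<omega>. \<eta> i \<omega> * Z \<omega>)"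
      using C meas_W[OF \<eta>_meas[OF that(1)] p01] by (intro sq_int_bounded_mult[OF that(3)]) auto
    moreover have "(\<lambda>\<omega>. \<eta> i \<omega> * Z \<omega>) \<in> borel_measurable (F (p i))" using \<eta>_meas that by auto
    ultimately have "(\<integral>\<omega>. (\<eta> i \<omega> * Z \<omega>) * (B (p (Suc i)) \<omega> - B (p i) \<omega>) \<partial>W) = 0"
      using mult_dB(2)[OF mono[OF that(1)]] by blast
    then show ?thesis by (simp add: D_def mult_ac)
  qed
  show sqR: "sq_int W R" unfolding R_eq by (rule sq_int_sum) (use D_sq in blast)
  show "(\<integral>\<omega>. Z \<omega> * R \<omega> \<partial>W) = 0" if Z: "Z \<in> borel_measurable (F s)" "sq_int W Z" for Z
  proof -
    have "(\<integral>\<omega>. Z \<omega> * R \<omega> \<partial>W) = (\<Sum>i<n+2. \<integral>\<omega>. Z \<omega> * D i \<omega> \<partial>W)"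
      unfolding R_eq sum_distrib_left using D_sq Z
      by (intro Bochner_Integration.integral_sum sq_int_mult_integrable) auto
    also have "\<dots> = 0"
      using Z meas_mono[OF Z(1) st(1) p_in(1)] p01 by (intro sum.neutral ballI D_orth) auto
    finally show ?thesis .
  qed
  have "(\<integral>\<^sup>+\<omega>. ennreal ((R \<omega>)\<^sup>2) \<partial>W) = ennreal (\<integral>\<omega>. (R \<omega>)\<^sup>2 \<partial>W)"
    using sqR by (intro nn_integral_eq_integral) (auto simp: sq_int_def)
  also have "(\<integral>\<omega>. (R \<omega>)\<^sup>2 \<partial>W) = (\<Sum>i<n+2. (\<integral>\<omega>. (\<eta> i \<omega>)\<^sup>2 \<partial>W) * (p (Suc i) - p i))"
  proof -
    have "(\<integral>\<omega>. (R \<omega>)\<^sup>2 \<partial>W) = (\<Sum>i<n+2. \<integral>\<omega>. (D i \<omega>)\<^sup>2 \<partial>W)"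
      unfolding R_eq
    proof (rule orthogonal_sum(1)[of p])
      show "0 \<le> p 0" "p (n + 2) \<le> 1" using p01 atLeastAtMost_iff by blast+
    qed (fact p_mono D_meas D_sq D_orth)+
    also have "\<dots> = (\<Sum>i<n+2. (\<integral>\<omega>. (\<eta> i \<omega>)\<^sup>2 \<partial>W) * (p (Suc i) - p i))"
      by (intro sum.cong D_var) auto
    finally show ?thesis .
  qed
  also have "\<dots> = (\<integral>\<omega>. (\<Sum>i<n+2. (\<eta> i \<omega>)\<^sup>2 * (p (Suc i) - p i)) \<partial>W)"
    using \<eta>_sq by (subst Bochner_Integration.integral_sum) (auto simp: sq_int_def)
  also have "ennreal \<dots> = (\<integral>\<^sup>+\<omega>. ennreal (\<Sum>i<n+2. (\<eta> i \<omega>)\<^sup>2 * (p (Suc i) - p i)) \<partial>W)"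
  proof (rule nn_integral_eq_integral[symmetric])
    show "integrable W (\<lambda>\<omega>. \<Sum>i<n+2. (\<eta> i \<omega>)\<^sup>2 * (p (Suc i) - p i))"
      by (rule Bochner_Integration.integrable_sum) (use \<eta>_sq in \<open>auto simp: sq_int_def\<close>)
    show "AE \<omega> in W. 0 \<le> (\<Sum>i<n+2. (\<eta> i \<omega>)\<^sup>2 * (p (Suc i) - p i))"
      by (intro AE_I2 sum_nonneg mult_nonneg_nonneg) (use p_mono in auto)
  qed
  also have "\<dots> \<le> (\<integral>\<^sup>+\<omega>. (\<integral>\<^sup>+r\<in>{s..t}. ennreal ((simple_process n \<tau> \<xi> r \<omega> - \<zeta> \<omega>)\<^sup>2) \<partial>lborel) \<partial>W)"
  proof (intro nn_integral_mono)
    fix \<omega>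
    let ?f = "\<lambda>r. ennreal ((simple_process n \<tau> \<xi> r \<omega> - \<zeta> \<omega>)\<^sup>2)"
    have [measurable]: "(\<lambda>r. simple_process n \<tau> \<xi> r \<omega>) \<in> borel_measurable borel"
      unfolding simple_process_def by measurable
    \<comment> \<open>Inside cell i only the summand i - 1 of the simple process can be nonzero:
      monotone times separate r from every other half-open interval.\<close>
    have sp: "simple_process n \<tau> \<xi> r \<omega> - \<zeta> \<omega> = \<eta> i \<omega>" if i: "i < n + 2" and r: "p i < r" "r \<le> p (Suc i)" for i r
    proof -
      have zero: "\<xi> j \<omega> * indicator {\<tau> j<..\<tau> (Suc j)} r = 0" if "j < n" and ji: "j \<noteq> i - 1 \<or> i = 0" for j
      proof -
        consider "i = 0" | "0 < i" "j < i - 1" | "0 < i" "i - 1 < j" using ji by linarith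
        then have "r \<le> \<tau> j \<or> \<tau> (Suc j) < r"
        proof cases
          case 1
          then have "r \<le> \<tau> 0" using r p_0 clamp_time_geD[of r s t "\<tau> 0"] by (simp add: p_mid)
          then show ?thesis using \<tau>_mono[of 0 j] that by auto
        next
          case 2
          then have "\<tau> (i - 1) < r" using r p_in(2)[of "Suc i"] i clamp_time_lessD[of s t "\<tau> (i - 1)" r] by (simp add: p_mid)
          moreover have "\<tau> (Suc j) \<le> \<tau> (i - 1)" using 2 i by (intro \<tau>_mono) linarith+
          ultimately show ?thesis by linarith
        next
          case 3
          then have "r \<le> \<tau> i" using r p_in(1)[of i] that clamp_time_geD[of r s t "\<tau> i"] by (simp add: p_mid)
          moreover have "\<tau> i \<le> \<tau> j" using 3 \<open>j < n\<close> by (intro \<tau>_mono) linarith+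
          ultimately show ?thesis by linarith
        qed
        then show ?thesis by auto
      qed
      show ?thesis
      proof (cases "0 < i \<and> i < n + 1")
        case True
        have "(\<Sum>j<n. \<xi> j \<omega> * indicator {\<tau> j<..\<tau> (Suc j)} r) = (\<Sum>j\<in>{i - 1}. \<xi> j \<omega> * indicator {\<tau> j<..\<tau> (Suc j)} r)"
          using zero True by (intro sum.mono_neutral_right) auto
        also have "r \<in> {\<tau> (i - 1)<..\<tau> (Suc (i - 1))}" "\<tau> (i - 1) < t"
          using True r p_in(1)[of i] p_in(2)[of "Suc i"] clamp_time_geD[of r s t "\<tau> i"]
            clamp_time_lessD[of s t "\<tau> (i - 1)" r] by (simp_all add: p_mid)
        then have "(\<Sum>j\<in>{i - 1}. \<xi> j \<omega> * indicator {\<tau> j<..\<tau> (Suc j)} r) = \<xi> (i - 1) \<omega>" by simp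
        finally show ?thesis using True \<open>\<tau> (i - 1) < t\<close> by (simp add: simple_process_def \<eta>_def)
      next
        case False
        then have "(\<Sum>j<n. \<xi> j \<omega> * indicator {\<tau> j<..\<tau> (Suc j)} r) = 0"
          proof (intro sum.neutral ballI zero)
            fix j assume "j \<in> {..<n}"
            then show "j < n" "j \<noteq> i - 1 \<or> i = 0" using False i by auto
          qed
        then show ?thesis using False unfolding simple_process_def \<eta>_def by auto
      qed
    qed
    have "ennreal (\<Sum>i<m. (\<eta> i \<omega>)\<^sup>2 * (p (Suc i) - p i)) = (\<integral>\<^sup>+r\<in>{s<..p m}. ?f r \<partial>lborel)" if "m \<le> n + 2" for m
      using that
    proof (induction m)
      case 0
      then show ?case by (simp add: p_def)
    next
      case (Suc m)
      have m: "p m \<le> p (Suc m)" "s \<le> p m" using p_mono[of m] p_in[of m] Suc.prems by auto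
      have "(\<integral>\<^sup>+r\<in>{p m<..p (Suc m)}. ?f r \<partial>lborel) = (\<integral>\<^sup>+r. ennreal ((\<eta> m \<omega>)\<^sup>2) * indicator {p m<..p (Suc m)} r \<partial>lborel)"
        using sp[of m] Suc.prems by (intro nn_integral_cong) (auto simp: indicator_def)
      also have "\<dots> = ennreal ((\<eta> m \<omega>)\<^sup>2 * (p (Suc m) - p m))"
        using m by (simp add: nn_integral_cmult_indicator ennreal_mult)
      finally have 1: "(\<integral>\<^sup>+r\<in>{p m<..p (Suc m)}. ?f r \<partial>lborel) = ennreal ((\<eta> m \<omega>)\<^sup>2 * (p (Suc m) - p m))" .
      have "(\<integral>\<^sup>+r\<in>{s<..p (Suc m)}. ?f r \<partial>lborel)
          = (\<integral>\<^sup>+r\<in>{s<..p m} \<union> {p m<..p (Suc m)}. ?f r \<partial>lborel)"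
        using m by (intro nn_integral_cong arg_cong2[where f = "(*)"] arg_cong2[where f = indicator]) auto
      also have "\<dots> = (\<integral>\<^sup>+r\<in>{s<..p m}. ?f r \<partial>lborel) + (\<integral>\<^sup>+r\<in>{p m<..p (Suc m)}. ?f r \<partial>lborel)"
        by (intro nn_integral_disjoint_pair) auto
      also have "\<dots> = ennreal (\<Sum>i<m. (\<eta> i \<omega>)\<^sup>2 * (p (Suc i) - p i)) + ennreal ((\<eta> m \<omega>)\<^sup>2 * (p (Suc m) - p m))"
        using Suc 1 by simp
      also have "\<dots> = ennreal (\<Sum>i<Suc m. (\<eta> i \<omega>)\<^sup>2 * (p (Suc i) - p i))"
        using m p_mono Suc.prems by (subst ennreal_plus[symmetric]) (auto intro!: sum_nonneg mult_nonneg_nonneg)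
      finally show ?case by simp
    qed
    from this[of "n + 2"] have "ennreal (\<Sum>i<n+2. (\<eta> i \<omega>)\<^sup>2 * (p (Suc i) - p i)) = (\<integral>\<^sup>+r\<in>{s<..t}. ?f r \<partial>lborel)"
      by (simp add: p_def)
    \<comment> \<open>Only the point s is added, a null set, so nothing is lost.\<close>
    also have "\<dots> \<le> (\<integral>\<^sup>+r\<in>{s..t}. ?f r \<partial>lborel)"
      by (intro nn_integral_mono mult_left_mono) (auto simp: indicator_def)
    finally show "ennreal (\<Sum>i<n+2. (\<eta> i \<omega>)\<^sup>2 * (p (Suc i) - p i)) \<le> (\<integral>\<^sup>+r\<in>{s..t}. ?f r \<partial>lborel)" .
  qed
  finally show "(\<integral>\<^sup>+\<omega>. ennreal ((R \<omega>)\<^sup>2) \<partial>W)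
      \<le> (\<integral>\<^sup>+\<omega>. (\<integral>\<^sup>+r\<in>{s..t}. ennreal ((simple_process n \<tau> \<xi> r \<omega> - \<zeta> \<omega>)\<^sup>2) \<partial>lborel) \<partial>W)" .
qed

lemma simple_process_measurable:
  assumes "simple_integrand W F n \<tau> \<xi>"
  shows "(\<lambda>(s, \<omega>). simple_process n \<tau> \<xi> s \<omega>) \<in> borel_measurable (borel \<Otimes>\<^sub>M W)"
proof -
  note \<tau>_mono = simple_integrand_times(1)[OF assms] and \<tau> = simple_integrand_times(2)[OF assms]
  have \<xi>: "\<xi> i \<in> borel_measurable W" if "i < n" for i
  proof (rule meas_W)
    show "\<xi> i \<in> borel_measurable (F (\<tau> i))" using assms that by (auto simp: simple_integrand_def)
    show "\<tau> i \<in> {0..1}" using \<tau>[of i] that by simp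
  qed
  have "(\<lambda>p. \<Sum>i<n. \<xi> i (snd p) * indicator {\<tau> i<..\<tau> (Suc i)} (fst p)) \<in> borel_measurable (borel \<Otimes>\<^sub>M W)"
    using \<xi> by (intro borel_measurable_sum borel_measurable_times) auto
  then show ?thesis by (simp add: simple_process_def split_beta')
qed

end

section \<open>Passage from simple integrals to the Ito integral\<close>

locale ito = brownian_setup +
  fixes H I :: "real \<Rightarrow> 'a \<Rightarrow> real"
  assumes ito: "ito_integral W F B H I"
begin

lemma I_measurable: "t \<in> {0..1} \<Longrightarrow> I t \<in> borel_measurable W"
  using ito by (auto simp: ito_integral_def)

lemma H_measurable: "(\<lambda>(s, \<omega>). H s \<omega>) \<in> borel_measurable (restrict_space borel {0..1} \<Otimes>\<^sub>M W)"
proof -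
  have 1: "(\<lambda>(s, \<omega>). H s \<omega>) \<in> borel_measurable (restrict_space borel {0..1} \<Otimes>\<^sub>M F 1)"
    using ito unfolding ito_integral_def progressively_measurable_def by auto
  have "(\<lambda>x. x) \<in> measurable W (F 1)"
    by (rule measurableI) (use sets_F[of 1] space_F[of 1] in auto)
  then have "(\<lambda>p. (fst p, snd p)) \<in> measurable (restrict_space borel {0..1} \<Otimes>\<^sub>M W) (restrict_space borel {0..1} \<Otimes>\<^sub>M F 1)"
    by (intro measurable_Pair measurable_compose[OF measurable_snd]) auto
  from measurable_compose[OF this 1] show ?thesis by simp
qed

text \<open>Progressive measurability says nothing outside [0, 1]. Clamping the time gives a process
  on the whole line that agrees with \<open>H\<close> on [0, 1] and to which Fubini over
  \<open>lborel\<close> applies.\<close>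

lemma H_clamp_measurable: "(\<lambda>p. H (clamp_time 0 1 (snd p)) (fst p)) \<in> borel_measurable (W \<Otimes>\<^sub>M lborel)"
proof -
  have "(\<lambda>p. (clamp_time 0 1 (snd p), fst p)) \<in> measurable (W \<Otimes>\<^sub>M lborel) (restrict_space borel {0..1} \<Otimes>\<^sub>M W)"
    unfolding clamp_time_def by (intro measurable_Pair measurable_restrict_space2) auto
  from measurable_compose[OF this H_measurable] show ?thesis by simp
qed

text \<open>The limit of \<open>simple_integral_estimates\<close>. The isometry would give the
  constant 1; here 6 = 3 * 2 comes from splitting \<open>R\<close> into three terms and the
  integrand into two before squaring. Only the order in t - s matters later.\<close>

lemma ito_estimates:
  assumes st: "0 \<le> s" "s \<le> t" "t \<le> 1"
    and \<zeta>: "\<zeta> \<in> borel_measurable (F s)" "\<And>\<omega>. \<omega> \<in> space W \<Longrightarrow> \<bar>\<zeta> \<omega>\<bar> \<le> c"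
  defines "R \<equiv> \<lambda>\<omega>. I t \<omega> - I s \<omega> - \<zeta> \<omega> * (B t \<omega> - B s \<omega>)"
  shows "(\<integral>\<^sup>+\<omega>. ennreal ((R \<omega>)\<^sup>2) \<partial>W)
      \<le> 6 * (\<integral>\<^sup>+\<omega>. (\<integral>\<^sup>+r\<in>{s..t}. ennreal ((H r \<omega> - \<zeta> \<omega>)\<^sup>2) \<partial>lborel) \<partial>W)" (is "?L \<le> 6 * ?X")
    and "\<And>Z. Z \<in> borel_measurable (F s) \<Longrightarrow> sq_int W Z \<Longrightarrow> sq_int W R \<Longrightarrow> (\<integral>\<omega>. Z \<omega> * R \<omega> \<partial>W) = 0"
proof -
  obtain n \<tau> \<xi> where si: "\<And>k. simple_integrand W F (n k) (\<tau> k) (\<xi> k)"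
    and Hlim: "(\<lambda>k. \<integral>\<^sup>+\<omega>. (\<integral>\<^sup>+s\<in>{0..1}. ennreal ((simple_process (n k) (\<tau> k) (\<xi> k) s \<omega> - H s \<omega>)\<^sup>2) \<partial>lborel) \<partial>W) \<longlonglongrightarrow> 0"
    and Ilim: "\<And>t. t \<in> {0..1} \<Longrightarrow> (\<lambda>k. \<integral>\<^sup>+\<omega>. ennreal ((simple_integral B (n k) (\<tau> k) (\<xi> k) t \<omega> - I t \<omega>)\<^sup>2) \<partial>W) \<longlonglongrightarrow> 0"
    using ito unfolding ito_integral_def by (elim conjE exE) (rule that, erule spec, assumption, erule (1) bspec)
  let ?J = "\<lambda>k. simple_integral B (n k) (\<tau> k) (\<xi> k)"
  let ?E = "\<lambda>k t. \<integral>\<^sup>+\<omega>. ennreal ((?J k t \<omega> - I t \<omega>)\<^sup>2) \<partial>W"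
  let ?H = "\<lambda>k. simple_process (n k) (\<tau> k) (\<xi> k)"
  let ?G = "\<lambda>k. \<integral>\<^sup>+\<omega>. (\<integral>\<^sup>+s\<in>{0..1}. ennreal ((?H k s \<omega> - H s \<omega>)\<^sup>2) \<partial>lborel) \<partial>W"
  let ?Rk = "\<lambda>k \<omega>. ?J k t \<omega> - ?J k s \<omega> - \<zeta> \<omega> * (B t \<omega> - B s \<omega>)"
  have st01: "s \<in> {0..1}" "t \<in> {0..1}" using st by auto
  have [measurable]: "?J k s \<in> borel_measurable W" "?J k t \<in> borel_measurable W" for k
    using simple_integral_measurable[OF si] st01 by auto
  have [measurable]: "I s \<in> borel_measurable W" "I t \<in> borel_measurable W" using I_measurable st01 by auto
  have \<zeta>W [measurable]: "\<zeta> \<in> borel_measurable W" using meas_W[OF \<zeta>(1) st01(1)] .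
  have dBW [measurable]: "(\<lambda>\<omega>. B t \<omega> - B s \<omega>) \<in> borel_measurable W" using dB_meas_W[OF st] .
  note est = simple_integral_estimates[OF si st \<zeta>]
  have Rkm [measurable]: "?Rk k \<in> borel_measurable W" for k by measurable
  have Rm [measurable]: "R \<in> borel_measurable W" unfolding R_def by measurable
  have Hm: "(\<lambda>p. indicator {s..t} (snd p) * ennreal ((H (snd p) (fst p) - \<zeta> (fst p))\<^sup>2)) \<in> borel_measurable (W \<Otimes>\<^sub>M lborel)"
    and Hkm: "(\<lambda>p. indicator {0..1} (snd p) * ennreal ((?H k (snd p) (fst p) - H (snd p) (fst p))\<^sup>2)) \<in> borel_measurable (W \<Otimes>\<^sub>M lborel)" for k
  proof -
    define Hx where "Hx p = H (clamp_time 0 1 (snd p)) (fst p)" for p :: "'a \<times> real"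
    have Hx [measurable]: "Hx \<in> borel_measurable (W \<Otimes>\<^sub>M lborel)"
      using H_clamp_measurable by (simp add: Hx_def[abs_def])
    have Hx_eq: "Hx p = H (snd p) (fst p)" if "0 \<le> snd p" "snd p \<le> 1" for p
      using that by (simp add: Hx_def clamp_time_def)
    have Hk: "(\<lambda>p. ?H k (snd p) (fst p)) \<in> borel_measurable (W \<Otimes>\<^sub>M lborel)"
    proof -
      have "(\<lambda>(s, \<omega>). ?H k s \<omega>) \<circ> (\<lambda>p. (snd p, fst p)) \<in> borel_measurable (W \<Otimes>\<^sub>M lborel)"
        using simple_process_measurable[OF si] by (intro measurable_comp[where N = "borel \<Otimes>\<^sub>M W"]) auto
      then show ?thesis by (simp add: comp_def)
    qed
    have "(\<lambda>p. indicator {s..t} (snd p) * ennreal ((Hx p - \<zeta> (fst p))\<^sup>2)) \<in> borel_measurable (W \<Otimes>\<^sub>M lborel)"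
      by measurable
    then show "(\<lambda>p. indicator {s..t} (snd p) * ennreal ((H (snd p) (fst p) - \<zeta> (fst p))\<^sup>2)) \<in> borel_measurable (W \<Otimes>\<^sub>M lborel)"
      by (rule measurable_cong[THEN iffD1, rotated]) (use st in \<open>auto simp: Hx_eq indicator_def\<close>)
    have "(\<lambda>p. indicator {0..1} (snd p) * ennreal ((?H k (snd p) (fst p) - Hx p)\<^sup>2)) \<in> borel_measurable (W \<Otimes>\<^sub>M lborel)"
      using Hk by measurable
    then show "(\<lambda>p. indicator {0..1} (snd p) * ennreal ((?H k (snd p) (fst p) - H (snd p) (fst p))\<^sup>2)) \<in> borel_measurable (W \<Otimes>\<^sub>M lborel)"
      by (rule measurable_cong[THEN iffD1, rotated]) (auto simp: Hx_eq indicator_def)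
  qed
  have inner: "(\<integral>\<^sup>+\<omega>. (\<integral>\<^sup>+r\<in>{s..t}. ennreal ((?H k r \<omega> - \<zeta> \<omega>)\<^sup>2) \<partial>lborel) \<partial>W) \<le> 2 * ?G k + 2 * ?X" for k
  proof -
    have i1: "(\<lambda>\<omega>. \<integral>\<^sup>+r\<in>{s..t}. ennreal ((H r \<omega> - \<zeta> \<omega>)\<^sup>2) \<partial>lborel) \<in> borel_measurable W"
      using lborel.borel_measurable_nn_integral_fst[OF Hm] by (simp add: mult.commute)
    have i2: "(\<lambda>\<omega>. \<integral>\<^sup>+r\<in>{0..1}. ennreal ((?H k r \<omega> - H r \<omega>)\<^sup>2) \<partial>lborel) \<in> borel_measurable W"
      using lborel.borel_measurable_nn_integral_fst[OF Hkm] by (simp add: mult.commute)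
    have "(\<integral>\<^sup>+r\<in>{s..t}. ennreal ((?H k r \<omega> - \<zeta> \<omega>)\<^sup>2) \<partial>lborel)
      \<le> 2 * (\<integral>\<^sup>+r\<in>{0..1}. ennreal ((?H k r \<omega> - H r \<omega>)\<^sup>2) \<partial>lborel) + 2 * (\<integral>\<^sup>+r\<in>{s..t}. ennreal ((H r \<omega> - \<zeta> \<omega>)\<^sup>2) \<partial>lborel)"
      if \<omega>: "\<omega> \<in> space W" for \<omega>
    proof -
      have m1: "(\<lambda>r. ennreal ((H r \<omega> - \<zeta> \<omega>)\<^sup>2) * indicator {s..t} r) \<in> borel_measurable lborel"
        using measurable_compose[OF measurable_Pair1'[OF \<omega>] Hm] by (simp add: mult.commute)
      have m2: "(\<lambda>r. ennreal ((?H k r \<omega> - H r \<omega>)\<^sup>2) * indicator {0..1} r) \<in> borel_measurable lborel"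
        using measurable_compose[OF measurable_Pair1'[OF \<omega>] Hkm] by (simp add: mult.commute)
      have "(\<integral>\<^sup>+r\<in>{s..t}. ennreal ((?H k r \<omega> - \<zeta> \<omega>)\<^sup>2) \<partial>lborel)
        \<le> (\<integral>\<^sup>+r. 2 * (ennreal ((?H k r \<omega> - H r \<omega>)\<^sup>2) * indicator {0..1} r) + 2 * (ennreal ((H r \<omega> - \<zeta> \<omega>)\<^sup>2) * indicator {s..t} r) \<partial>lborel)"
      proof (rule nn_integral_mono)
        fix r
        have "(?H k r \<omega> - \<zeta> \<omega>)\<^sup>2 \<le> 2 * (?H k r \<omega> - H r \<omega>)\<^sup>2 + 2 * (H r \<omega> - \<zeta> \<omega>)\<^sup>2"
          using square_add_le[of "?H k r \<omega> - H r \<omega>" "H r \<omega> - \<zeta> \<omega>"] by simp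
        then have "ennreal ((?H k r \<omega> - \<zeta> \<omega>)\<^sup>2) \<le> ennreal (2 * (?H k r \<omega> - H r \<omega>)\<^sup>2 + 2 * (H r \<omega> - \<zeta> \<omega>)\<^sup>2)"
          by (rule ennreal_leI)
        then have "ennreal ((?H k r \<omega> - \<zeta> \<omega>)\<^sup>2) \<le> 2 * ennreal ((?H k r \<omega> - H r \<omega>)\<^sup>2) + 2 * ennreal ((H r \<omega> - \<zeta> \<omega>)\<^sup>2)"
          by (simp add: ennreal_mult')
        then show "ennreal ((?H k r \<omega> - \<zeta> \<omega>)\<^sup>2) * indicator {s..t} r
          \<le> 2 * (ennreal ((?H k r \<omega> - H r \<omega>)\<^sup>2) * indicator {0..1} r) + 2 * (ennreal ((H r \<omega> - \<zeta> \<omega>)\<^sup>2) * indicator {s..t} r)"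
          using st by (auto simp: indicator_def)
      qed
      also have "\<dots> = 2 * (\<integral>\<^sup>+r\<in>{0..1}. ennreal ((?H k r \<omega> - H r \<omega>)\<^sup>2) \<partial>lborel) + 2 * (\<integral>\<^sup>+r\<in>{s..t}. ennreal ((H r \<omega> - \<zeta> \<omega>)\<^sup>2) \<partial>lborel)"
        using m1 m2 by (simp add: nn_integral_add nn_integral_cmult)
      finally show ?thesis .
    qed
    then have "(\<integral>\<^sup>+\<omega>. (\<integral>\<^sup>+r\<in>{s..t}. ennreal ((?H k r \<omega> - \<zeta> \<omega>)\<^sup>2) \<partial>lborel) \<partial>W)
      \<le> (\<integral>\<^sup>+\<omega>. 2 * (\<integral>\<^sup>+r\<in>{0..1}. ennreal ((?H k r \<omega> - H r \<omega>)\<^sup>2) \<partial>lborel) + 2 * (\<integral>\<^sup>+r\<in>{s..t}. ennreal ((H r \<omega> - \<zeta> \<omega>)\<^sup>2) \<partial>lborel) \<partial>W)"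
      by (rule nn_integral_mono)
    also have "\<dots> = 2 * ?G k + 2 * ?X"
      using i1 i2 by (simp add: nn_integral_add nn_integral_cmult)
    finally show ?thesis .
  qed
  have split: "?L \<le> 3 * ?E k t + 3 * ?E k s + 3 * (\<integral>\<^sup>+\<omega>. ennreal ((?Rk k \<omega>)\<^sup>2) \<partial>W)" for k
  proof -
    have "ennreal ((R \<omega>)\<^sup>2) \<le> 3 * ennreal ((?J k t \<omega> - I t \<omega>)\<^sup>2) + 3 * ennreal ((?J k s \<omega> - I s \<omega>)\<^sup>2) + 3 * ennreal ((?Rk k \<omega>)\<^sup>2)" for \<omega>
    proof -
      have "(R \<omega>)\<^sup>2 \<le> 3 * (?J k t \<omega> - I t \<omega>)\<^sup>2 + 3 * (?J k s \<omega> - I s \<omega>)\<^sup>2 + 3 * (?Rk k \<omega>)\<^sup>2"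
      proof -
        have "R \<omega> = - (?J k t \<omega> - I t \<omega>) + (?J k s \<omega> - I s \<omega>) + ?Rk k \<omega>" by (simp add: R_def)
        then show ?thesis
          using square_add3_le[of "- (?J k t \<omega> - I t \<omega>)" "?J k s \<omega> - I s \<omega>" "?Rk k \<omega>"]
          by (simp only: power2_minus)
      qed
      then have "ennreal ((R \<omega>)\<^sup>2) \<le> ennreal (3 * (?J k t \<omega> - I t \<omega>)\<^sup>2 + 3 * (?J k s \<omega> - I s \<omega>)\<^sup>2 + 3 * (?Rk k \<omega>)\<^sup>2)"
        by (rule ennreal_leI)
      then show ?thesis by (simp add: ennreal_mult')
    qed
    then have "?L \<le> (\<integral>\<^sup>+\<omega>. 3 * ennreal ((?J k t \<omega> - I t \<omega>)\<^sup>2) + 3 * ennreal ((?J k s \<omega> - I s \<omega>)\<^sup>2) + 3 * ennreal ((?Rk k \<omega>)\<^sup>2) \<partial>W)"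
      by (rule nn_integral_mono)
    also have "\<dots> = 3 * ?E k t + 3 * ?E k s + 3 * (\<integral>\<^sup>+\<omega>. ennreal ((?Rk k \<omega>)\<^sup>2) \<partial>W)"
      by (simp add: nn_integral_add nn_integral_cmult)
    finally show ?thesis .
  qed
  have "?L \<le> 3 * ?E k t + 3 * ?E k s + 3 * (2 * ?G k + 2 * ?X)" for k
    using order_trans[OF split add_mono[OF order_refl mult_left_mono[OF order_trans[OF est(2) inner]]]] by simp
  then have "?L \<le> 3 * 0 + 3 * 0 + 3 * (2 * 0 + 2 * ?X)"
    by (intro LIMSEQ_le_const[of "\<lambda>k. 3 * ?E k t + 3 * ?E k s + 3 * (2 * ?G k + 2 * ?X)"] tendsto_add
      ennreal_tendsto_cmult Ilim st01 Hlim tendsto_const) auto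
  also have "\<dots> = 6 * ?X" by (simp add: mult.assoc[symmetric])
  finally show "?L \<le> 6 * ?X" .
  show "(\<integral>\<omega>. Z \<omega> * R \<omega> \<partial>W) = 0" if Z: "Z \<in> borel_measurable (F s)" "sq_int W Z" and R: "sq_int W R" for Z
  proof -
    \<comment> \<open>\<open>R\<close> and its approximation differ only by the errors of the values
      at s and t, which tend to 0 in L2, while each approximation is orthogonal to
      \<open>Z\<close>.\<close>
    have sq: "sq_int W (\<lambda>\<omega>. R \<omega> - ?Rk k \<omega>)" for k using sq_int_diff[OF R est(1)] .
    have ub: "(\<integral>\<^sup>+\<omega>. ennreal ((R \<omega> - ?Rk k \<omega>)\<^sup>2) \<partial>W) \<le> 2 * ?E k t + 2 * ?E k s" for k
    proof -
      have "ennreal ((R \<omega> - ?Rk k \<omega>)\<^sup>2) \<le> 2 * ennreal ((?J k t \<omega> - I t \<omega>)\<^sup>2) + 2 * ennreal ((?J k s \<omega> - I s \<omega>)\<^sup>2)" for \<omega>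
      proof -
        have "(R \<omega> - ?Rk k \<omega>)\<^sup>2 \<le> 2 * (?J k t \<omega> - I t \<omega>)\<^sup>2 + 2 * (?J k s \<omega> - I s \<omega>)\<^sup>2"
        proof -
          have "R \<omega> - ?Rk k \<omega> = - (?J k t \<omega> - I t \<omega>) + (?J k s \<omega> - I s \<omega>)" by (simp add: R_def)
          then show ?thesis
            using square_add_le[of "- (?J k t \<omega> - I t \<omega>)" "?J k s \<omega> - I s \<omega>"]
            by (simp only: power2_minus)
        qed
        then have "ennreal ((R \<omega> - ?Rk k \<omega>)\<^sup>2) \<le> ennreal (2 * (?J k t \<omega> - I t \<omega>)\<^sup>2 + 2 * (?J k s \<omega> - I s \<omega>)\<^sup>2)"
          by (rule ennreal_leI)
        then show ?thesis by (simp add: ennreal_mult')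
      qed
      then have "(\<integral>\<^sup>+\<omega>. ennreal ((R \<omega> - ?Rk k \<omega>)\<^sup>2) \<partial>W) \<le> (\<integral>\<^sup>+\<omega>. 2 * ennreal ((?J k t \<omega> - I t \<omega>)\<^sup>2) + 2 * ennreal ((?J k s \<omega> - I s \<omega>)\<^sup>2) \<partial>W)"
        by (rule nn_integral_mono)
      also have "\<dots> = 2 * ?E k t + 2 * ?E k s"
        by (simp add: nn_integral_add nn_integral_cmult)
      finally show ?thesis .
    qed
    have "(\<lambda>k. \<integral>\<^sup>+\<omega>. ennreal ((R \<omega> - ?Rk k \<omega>)\<^sup>2) \<partial>W) \<longlonglongrightarrow> 0"
    proof (rule tendsto_sandwich[OF _ _ tendsto_const])
      have "(\<lambda>k. 2 * ?E k t + 2 * ?E k s) \<longlonglongrightarrow> 2 * 0 + 2 * 0"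
        by (intro tendsto_add ennreal_tendsto_cmult Ilim st01) auto
      then show "(\<lambda>k. 2 * ?E k t + 2 * ?E k s) \<longlonglongrightarrow> 0" by simp
    qed (use ub in auto)
    moreover have "(\<integral>\<^sup>+\<omega>. ennreal ((R \<omega> - ?Rk k \<omega>)\<^sup>2) \<partial>W) = ennreal (\<integral>\<omega>. (R \<omega> - ?Rk k \<omega>)\<^sup>2 \<partial>W)" for k
      using sq[of k] by (intro nn_integral_eq_integral) (auto simp: sq_int_def)
    ultimately have "(\<lambda>k. ennreal (\<integral>\<omega>. (R \<omega> - ?Rk k \<omega>)\<^sup>2 \<partial>W)) \<longlonglongrightarrow> ennreal 0" by simp
    then have "(\<lambda>k. \<integral>\<omega>. (R \<omega> - ?Rk k \<omega>)\<^sup>2 \<partial>W) \<longlonglongrightarrow> 0"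
      by (subst (asm) tendsto_ennreal_iff) auto
    from integral_mult_L2_tendsto_zero[OF Z(2) sq this]
    have "(\<lambda>k. \<integral>\<omega>. Z \<omega> * (R \<omega> - ?Rk k \<omega>) \<partial>W) \<longlonglongrightarrow> 0" .
    moreover have "(\<integral>\<omega>. Z \<omega> * (R \<omega> - ?Rk k \<omega>) \<partial>W) = (\<integral>\<omega>. Z \<omega> * R \<omega> \<partial>W)" for k
    proof -
      have "(\<integral>\<omega>. Z \<omega> * (R \<omega> - ?Rk k \<omega>) \<partial>W) = (\<integral>\<omega>. Z \<omega> * R \<omega> - Z \<omega> * ?Rk k \<omega> \<partial>W)"
        by (simp add: right_diff_distrib)
      also have "\<dots> = (\<integral>\<omega>. Z \<omega> * R \<omega> \<partial>W) - (\<integral>\<omega>. Z \<omega> * ?Rk k \<omega> \<partial>W)"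
        by (intro Bochner_Integration.integral_diff sq_int_mult_integrable Z R est(1))
      finally show ?thesis using est(3)[OF _ Z] by simp
    qed
    ultimately show ?thesis by (simp add: LIMSEQ_const_iff)
  qed
qed

end

section \<open>Diffusions along dyadic grids\<close>

text \<open>One factor of the cube is bounded by the modulus of continuity at mesh size, the other
  two by the bounded quadratic variation.\<close>

lemma cubic_variation_tendsto_zero:
  fixes m :: "real \<Rightarrow> real"
  assumes m: "continuous_on {0..1} m" and N: "\<And>k. N k \<le> 2 ^ k"
    and bd: "Bseq (\<lambda>k. \<Sum>l<N k. (m (real (Suc l) / 2 ^ k) - m (real l / 2 ^ k))\<^sup>2)"
  shows "(\<lambda>k. \<Sum>l<N k. \<bar>m (real (Suc l) / 2 ^ k) - m (real l / 2 ^ k)\<bar> ^ 3) \<longlonglongrightarrow> 0"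
proof (rule LIMSEQ_I)
  fix r :: real assume "0 < r"
  let ?d = "\<lambda>k l. m (real (Suc l) / 2 ^ k) - m (real l / 2 ^ k)"
  obtain K where K: "0 < K" "\<And>k. norm (\<Sum>l<N k. (?d k l)\<^sup>2) \<le> K" using bd by (auto elim: BseqE)
  have "0 < r / (2 * K)" using \<open>0 < r\<close> K by simp
  from uniform_grid_modulus[OF m this] obtain k0 where k0: "\<And>k s t. k \<ge> k0 \<Longrightarrow> s \<in> {0..1} \<Longrightarrow> t \<in> {0..1} \<Longrightarrow> \<bar>s - t\<bar> \<le> 1 / 2 ^ k
      \<Longrightarrow> \<bar>m s - m t\<bar> < r / (2 * K)" by blast
  have "norm ((\<Sum>l<N k. \<bar>?d k l\<bar> ^ 3) - 0) < r" if "k \<ge> k0" for k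
  proof -
    have "(\<Sum>l<N k. \<bar>?d k l\<bar> ^ 3) \<le> (\<Sum>l<N k. r / (2 * K) * (?d k l)\<^sup>2)"
    proof (rule sum_mono)
      fix l assume "l \<in> {..<N k}"
      then have l: "Suc l \<le> 2 ^ k" "l \<le> 2 ^ k" using N[of k] by auto
      have "\<bar>real (Suc l) / 2 ^ k - real l / 2 ^ k\<bar> \<le> 1 / 2 ^ k" by (simp add: diff_divide_distrib[symmetric])
      then have "\<bar>?d k l\<bar> < r / (2 * K)"
        using k0[OF that, of "real (Suc l) / 2 ^ k" "real l / 2 ^ k"] grid_in_unit[OF l(1)] grid_in_unit[OF l(2)] by simp
      then have "\<bar>?d k l\<bar> * (?d k l)\<^sup>2 \<le> r / (2 * K) * (?d k l)\<^sup>2" by (intro mult_right_mono) auto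
      then show "\<bar>?d k l\<bar> ^ 3 \<le> r / (2 * K) * (?d k l)\<^sup>2" by (simp add: power3_eq_cube power2_eq_square mult.assoc)
    qed
    also have "\<dots> = r / (2 * K) * (\<Sum>l<N k. (?d k l)\<^sup>2)" by (simp add: sum_distrib_left)
    also have "\<dots> \<le> r / (2 * K) * K"
      using K(2)[of k] \<open>0 < r\<close> K(1) by (intro mult_left_mono) auto
    also have "\<dots> < r" using K \<open>0 < r\<close> by simp
    finally show ?thesis by (simp add: sum_nonneg)
  qed
  then show "\<exists>no. \<forall>k\<ge>no. norm ((\<Sum>l<N k. \<bar>?d k l\<bar> ^ 3) - 0) < r" by blast
qed

text \<open>Only a bound and a Lipschitz constant are asked of \<sigma>, so the locale also covers
  the constant coefficient 1 of the equation for \<open>N\<close>, with L = 0 and c = 1.\<close>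

locale diffusion = brownian_setup +
  fixes \<sigma> :: "real \<Rightarrow> real" and x L c :: real and M :: "real \<Rightarrow> 'a \<Rightarrow> real"
  assumes sde: "sde_solution W F B \<sigma> x M"
    and \<sigma>_bound: "\<And>y. \<bar>\<sigma> y\<bar> \<le> c"
    and \<sigma>_lipschitz: "\<And>y z. \<bar>\<sigma> y - \<sigma> z\<bar> \<le> L * \<bar>y - z\<bar>"
begin

lemma M_adapted: "t \<in> {0..1} \<Longrightarrow> M t \<in> borel_measurable (F t)"
  using sde by (auto simp: sde_solution_def continuous_adapted_def)

lemma M_continuous: "\<omega> \<in> space W \<Longrightarrow> continuous_on {0..1} (\<lambda>t. M t \<omega>)"
  using sde by (auto simp: sde_solution_def continuous_adapted_def)

lemma M_0: "AE \<omega> in W. M 0 \<omega> = x"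
  using sde by (auto simp: sde_solution_def)

lemma c_nonneg: "0 \<le> c" using \<sigma>_bound[of 0] by simp

lemma L_nonneg: "0 \<le> L" using \<sigma>_lipschitz[of 1 0] by simp

lemma \<sigma>_continuous: "continuous_on UNIV \<sigma>"
  using \<sigma>_lipschitz L_nonneg
  by (intro lipschitz_on_continuous_on lipschitz_onI) (auto simp: dist_real_def)

lemma \<sigma>_measurable [measurable]: "\<sigma> \<in> borel_measurable borel"
  using \<sigma>_continuous by (rule borel_measurable_continuous_onI)

lemma M_mono: "0 \<le> s \<Longrightarrow> s \<le> t \<Longrightarrow> t \<le> 1 \<Longrightarrow> M s \<in> borel_measurable (F t)"
  using meas_mono[OF M_adapted[of s], of t] by auto

lemma M_meas_W: "s \<in> {0..1} \<Longrightarrow> M s \<in> borel_measurable W"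
  using meas_W[OF M_adapted] by auto

text \<open>Error of the one-step Euler approximation of \<open>M\<close>. Its second moment has
  order (t - s)^2, against t - s for the increment itself, and it is orthogonal to the past.\<close>

definition \<rho> :: "real \<Rightarrow> real \<Rightarrow> 'a \<Rightarrow> real" where
  "\<rho> s t \<omega> = M t \<omega> - M s \<omega> - \<sigma> (M s \<omega>) * (B t \<omega> - B s \<omega>)"

lemma \<rho>_measurable:
  assumes "0 \<le> s" "s \<le> t" "t \<le> 1"
  shows "\<rho> s t \<in> borel_measurable (F t)"
proof -
  have [measurable]: "M s \<in> borel_measurable (F t)" "M t \<in> borel_measurable (F t)"
    "(\<lambda>\<omega>. B t \<omega> - B s \<omega>) \<in> borel_measurable (F t)"
    using M_mono[of s t] M_adapted[of t] dB_measurable[of s t] assms by auto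
  show ?thesis unfolding \<rho>_def[abs_def] by measurable
qed

text \<open>\<open>ito_estimates\<close> is used twice. With \<zeta> = 0 it bounds the second moment
  of M r - M s by 6 c^2 (r - s); the Lipschitz property then bounds that of \<sigma> (M r) -
  \<sigma> (M s) by 6 L^2 c^2 (t - s), and the use with \<zeta> = \<sigma> (M s) yields 36 = 6 * 6
  and a second factor t - s from integration in time.\<close>

lemma
  assumes st: "0 \<le> s" "s \<le> t" "t \<le> 1"
  shows \<rho>_nn_bound: "(\<integral>\<^sup>+\<omega>. ennreal ((\<rho> s t \<omega>)\<^sup>2) \<partial>W) \<le> ennreal (36 * L\<^sup>2 * c\<^sup>2 * (t - s)\<^sup>2)"
    and \<rho>_orthogonal: "\<And>Z. Z \<in> borel_measurable (F s) \<Longrightarrow> sq_int W Z \<Longrightarrow> (\<integral>\<omega>. Z \<omega> * \<rho> s t \<omega> \<partial>W) = 0"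
proof -
  obtain I where I: "ito_integral W F B (\<lambda>s \<omega>. \<sigma> (M s \<omega>)) I" "AE \<omega> in W. \<forall>t\<in>{0..1}. M t \<omega> = x + I t \<omega>"
    using sde by (auto simp: sde_solution_def)
  interpret ito W F B "\<lambda>s \<omega>. \<sigma> (M s \<omega>)" I by standard (rule I(1))
  have inc: "AE \<omega> in W. M b \<omega> - M a \<omega> = I b \<omega> - I a \<omega>" if "a \<in> {0..1}" "b \<in> {0..1}" for a b
    using I(2) by eventually_elim (use that in auto)
  have bound: "(\<integral>\<^sup>+\<omega>. ennreal ((M t \<omega> - M s \<omega>)\<^sup>2) \<partial>W) \<le> ennreal (6 * c\<^sup>2 * (t - s))"
    if st: "0 \<le> s" "s \<le> t" "t \<le> 1" for s t
  proof -
    have "(\<integral>\<^sup>+\<omega>. ennreal ((M t \<omega> - M s \<omega>)\<^sup>2) \<partial>W) = (\<integral>\<^sup>+\<omega>. ennreal ((I t \<omega> - I s \<omega>)\<^sup>2) \<partial>W)"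
      using inc[of s t] st by (intro nn_integral_cong_AE) auto
    also have "\<dots> \<le> 6 * (\<integral>\<^sup>+\<omega>. (\<integral>\<^sup>+r\<in>{s..t}. ennreal ((\<sigma> (M r \<omega>))\<^sup>2) \<partial>lborel) \<partial>W)"
      using ito_estimates(1)[OF st, of "\<lambda>_. 0" 0] by simp
    also have "\<dots> \<le> 6 * (\<integral>\<^sup>+\<omega>. (\<integral>\<^sup>+r\<in>{s..t}. ennreal (c\<^sup>2) \<partial>lborel) \<partial>W)"
      using \<sigma>_bound c_nonneg by (intro mult_left_mono nn_integral_mono mult_right_mono ennreal_leI)
        (auto simp: abs_le_square_iff[symmetric])
    also have "\<dots> = ennreal (6 * c\<^sup>2 * (t - s))"
      using st by (simp add: nn_integral_cmult_indicator emeasure_space_1 ennreal_mult' ennreal_mult'' mult.assoc)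
    finally show ?thesis .
  qed
  have [measurable]: "M s \<in> borel_measurable W" using M_meas_W st by auto
  have \<zeta>: "(\<lambda>\<omega>. \<sigma> (M s \<omega>)) \<in> borel_measurable (F s)"
    using M_adapted[of s] st by auto
  let ?R = "\<lambda>\<omega>. I t \<omega> - I s \<omega> - \<sigma> (M s \<omega>) * (B t \<omega> - B s \<omega>)"
  have R: "AE \<omega> in W. \<rho> s t \<omega> = ?R \<omega>"
    using inc[of s t] st by (auto simp: \<rho>_def)
  have meas: "(\<lambda>p. ennreal ((\<sigma> (M (clamp_time 0 1 (snd p)) (fst p)) - \<sigma> (M s (fst p)))\<^sup>2) * indicator {s..t} (snd p))
      \<in> borel_measurable (W \<Otimes>\<^sub>M lborel)"
    using H_clamp_measurable by measurable
  have clamp: "clamp_time 0 1 r = r" if "r \<in> {s..t}" for r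
    using that st by (auto simp: clamp_time_def)
  have "(\<integral>\<^sup>+\<omega>. (\<integral>\<^sup>+r\<in>{s..t}. ennreal ((\<sigma> (M r \<omega>) - \<sigma> (M s \<omega>))\<^sup>2) \<partial>lborel) \<partial>W)
    = (\<integral>\<^sup>+\<omega>. (\<integral>\<^sup>+r\<in>{s..t}. ennreal ((\<sigma> (M (clamp_time 0 1 r) \<omega>) - \<sigma> (M s \<omega>))\<^sup>2) \<partial>lborel) \<partial>W)"
    by (intro nn_integral_cong) (auto simp: clamp indicator_def)
  also have "\<dots> = (\<integral>\<^sup>+r. (\<integral>\<^sup>+\<omega>. ennreal ((\<sigma> (M (clamp_time 0 1 r) \<omega>) - \<sigma> (M s \<omega>))\<^sup>2) * indicator {s..t} r \<partial>W) \<partial>lborel)"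
  proof -
    interpret pair_sigma_finite W lborel by standard
    show ?thesis using Fubini[OF meas] by simp
  qed
  also have "\<dots> \<le> (\<integral>\<^sup>+r. ennreal (6 * L\<^sup>2 * c\<^sup>2 * (t - s)) * indicator {s..t} r \<partial>lborel)"
  proof (rule nn_integral_mono)
    fix r
    show "(\<integral>\<^sup>+\<omega>. ennreal ((\<sigma> (M (clamp_time 0 1 r) \<omega>) - \<sigma> (M s \<omega>))\<^sup>2) * indicator {s..t} r \<partial>W)
      \<le> ennreal (6 * L\<^sup>2 * c\<^sup>2 * (t - s)) * indicator {s..t} r"
    proof (cases "r \<in> {s..t}")
      case True
      then have r: "0 \<le> r" "r \<le> 1" "s \<le> r" using st by auto
      have [measurable]: "M r \<in> borel_measurable W" using M_meas_W r by auto
      have "(\<integral>\<^sup>+\<omega>. ennreal ((\<sigma> (M r \<omega>) - \<sigma> (M s \<omega>))\<^sup>2) \<partial>W) \<le> (\<integral>\<^sup>+\<omega>. ennreal (L\<^sup>2) * ennreal ((M r \<omega> - M s \<omega>)\<^sup>2) \<partial>W)"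
      proof (rule nn_integral_mono)
        fix \<omega>
        have "\<bar>\<sigma> (M r \<omega>) - \<sigma> (M s \<omega>)\<bar>\<^sup>2 \<le> (L * \<bar>M r \<omega> - M s \<omega>\<bar>)\<^sup>2"
          using \<sigma>_lipschitz by (intro power_mono) auto
        then show "ennreal ((\<sigma> (M r \<omega>) - \<sigma> (M s \<omega>))\<^sup>2) \<le> ennreal (L\<^sup>2) * ennreal ((M r \<omega> - M s \<omega>)\<^sup>2)"
          by (simp add: power_mult_distrib ennreal_mult'[symmetric] ennreal_leI)
      qed
      also have "\<dots> = ennreal (L\<^sup>2) * (\<integral>\<^sup>+\<omega>. ennreal ((M r \<omega> - M s \<omega>)\<^sup>2) \<partial>W)"
        by (rule nn_integral_cmult) measurable
      also have "\<dots> \<le> ennreal (L\<^sup>2) * ennreal (6 * c\<^sup>2 * (r - s))"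
        using bound[of s r] st r by (intro mult_left_mono) auto
      also have "\<dots> \<le> ennreal (L\<^sup>2) * ennreal (6 * c\<^sup>2 * (t - s))"
        using True by (intro mult_left_mono ennreal_leI) auto
      also have "\<dots> = ennreal (6 * L\<^sup>2 * c\<^sup>2 * (t - s))"
        using st by (simp add: ennreal_mult'[symmetric] mult_ac)
      finally show ?thesis using True by (simp add: clamp)
    qed simp
  qed
  also have "\<dots> = ennreal (6 * L\<^sup>2 * c\<^sup>2 * (t - s)\<^sup>2)"
    using st by (subst nn_integral_cmult_indicator) (auto simp: ennreal_mult'[symmetric] power2_eq_square mult_ac)
  finally have X: "(\<integral>\<^sup>+\<omega>. (\<integral>\<^sup>+r\<in>{s..t}. ennreal ((\<sigma> (M r \<omega>) - \<sigma> (M s \<omega>))\<^sup>2) \<partial>lborel) \<partial>W)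
    \<le> ennreal (6 * L\<^sup>2 * c\<^sup>2 * (t - s)\<^sup>2)" .
  have "(\<integral>\<^sup>+\<omega>. ennreal ((\<rho> s t \<omega>)\<^sup>2) \<partial>W) = (\<integral>\<^sup>+\<omega>. ennreal ((?R \<omega>)\<^sup>2) \<partial>W)"
    using R by (intro nn_integral_cong_AE) auto
  also have "\<dots> \<le> 6 * (\<integral>\<^sup>+\<omega>. (\<integral>\<^sup>+r\<in>{s..t}. ennreal ((\<sigma> (M r \<omega>) - \<sigma> (M s \<omega>))\<^sup>2) \<partial>lborel) \<partial>W)"
    using ito_estimates(1)[OF st \<zeta>] \<sigma>_bound by blast
  also have "\<dots> \<le> 6 * ennreal (6 * L\<^sup>2 * c\<^sup>2 * (t - s)\<^sup>2)" using X by (rule mult_left_mono) simp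
  also have "\<dots> = ennreal (36 * L\<^sup>2 * c\<^sup>2 * (t - s)\<^sup>2)"
    by (simp add: ennreal_mult'[symmetric] mult.assoc[symmetric] flip: ennreal_numeral)
  finally show nn: "(\<integral>\<^sup>+\<omega>. ennreal ((\<rho> s t \<omega>)\<^sup>2) \<partial>W) \<le> ennreal (36 * L\<^sup>2 * c\<^sup>2 * (t - s)\<^sup>2)" .
  show "(\<integral>\<omega>. Z \<omega> * \<rho> s t \<omega> \<partial>W) = 0" if Z: "Z \<in> borel_measurable (F s)" "sq_int W Z" for Z
  proof -
    have [measurable]: "I s \<in> borel_measurable W" "I t \<in> borel_measurable W" "(\<lambda>\<omega>. B t \<omega> - B s \<omega>) \<in> borel_measurable W"
      using I_measurable st dB_meas_W[OF st] by auto
    have [measurable]: "\<rho> s t \<in> borel_measurable W" "Z \<in> borel_measurable W"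
      using meas_W[OF \<rho>_measurable[OF st]] Z st by (auto simp: sq_int_def)
    have "sq_int W ?R"
    proof (rule sq_int_nn)
      have "(\<integral>\<^sup>+\<omega>. ennreal ((?R \<omega>)\<^sup>2) \<partial>W) = (\<integral>\<^sup>+\<omega>. ennreal ((\<rho> s t \<omega>)\<^sup>2) \<partial>W)"
        using R by (intro nn_integral_cong_AE) auto
      then show "(\<integral>\<^sup>+\<omega>. ennreal ((?R \<omega>)\<^sup>2) \<partial>W) \<le> ennreal (36 * L\<^sup>2 * c\<^sup>2 * (t - s)\<^sup>2)" using nn by simp
    qed auto
    then have "(\<integral>\<omega>. Z \<omega> * ?R \<omega> \<partial>W) = 0"
      using ito_estimates(2)[OF st \<zeta> _ Z] \<sigma>_bound by blast
    moreover have "(\<integral>\<omega>. Z \<omega> * \<rho> s t \<omega> \<partial>W) = (\<integral>\<omega>. Z \<omega> * ?R \<omega> \<partial>W)"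
      using R by (intro integral_cong_AE) auto
    ultimately show ?thesis by simp
  qed
qed

end

lemma dyadic_step:
  assumes "l < (2::nat) ^ k"
  shows "0 \<le> real l / 2 ^ k" "real l / 2 ^ k < real (Suc l) / 2 ^ k" "real l / 2 ^ k \<le> real (Suc l) / 2 ^ k"
    "real (Suc l) / 2 ^ k \<le> 1" "real (Suc l) / 2 ^ k - real l / 2 ^ k = (1 / 2) ^ k"
    "real l / 2 ^ k \<in> {0..1}" "real (Suc l) / 2 ^ k \<in> {0..1}"
  using grid_in_unit[of "Suc l" "2 ^ k"] grid_in_unit[of l "2 ^ k"] assms
  by (auto simp: divide_strict_right_mono divide_right_mono diff_divide_distrib[symmetric] power_one_over)

lemma count_times_step:
  assumes "N \<le> (2::nat) ^ k"
  shows "real N * (1 / 2) ^ k \<le> 1"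
proof -
  have "real N \<le> 2 ^ k" using assms by (metis of_nat_le_iff of_nat_numeral of_nat_power)
  then show ?thesis by (simp add: power_one_over)
qed

section \<open>Almost sure limits of weighted sums along dyadic grids\<close>

context diffusion
begin

lemma \<rho>_sq_int:
  assumes "l < 2 ^ k"
  shows "sq_int W (\<rho> (real l / 2 ^ k) (real (Suc l) / 2 ^ k))"
    "(\<integral>\<omega>. (\<rho> (real l / 2 ^ k) (real (Suc l) / 2 ^ k) \<omega>)\<^sup>2 \<partial>W) \<le> 36 * L\<^sup>2 * c\<^sup>2 * ((1 / 2) ^ k)\<^sup>2"
proof -
  note st = dyadic_step[OF assms]
  note sq = sq_int_nn[OF meas_W[OF \<rho>_measurable[OF st(1,3,4)] st(7)] \<rho>_nn_bound[OF st(1,3,4)]]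
  show "sq_int W (\<rho> (real l / 2 ^ k) (real (Suc l) / 2 ^ k))"
    "(\<integral>\<omega>. (\<rho> (real l / 2 ^ k) (real (Suc l) / 2 ^ k) \<omega>)\<^sup>2 \<partial>W) \<le> 36 * L\<^sup>2 * c\<^sup>2 * ((1 / 2) ^ k)\<^sup>2"
    using sq unfolding st(5) by auto
qed

lemma function_of_M:
  assumes "s \<in> {0..1}" "g \<in> borel_measurable borel"
  shows "(\<lambda>\<omega>. g (M s \<omega>)) \<in> borel_measurable (F s)" "(\<lambda>\<omega>. g (M s \<omega>)) \<in> borel_measurable W"
  using measurable_compose[OF M_adapted[OF assms(1)] assms(2)]
    measurable_compose[OF M_meas_W[OF assms(1)] assms(2)] by auto

text \<open>Weights taken at left endpoints are measurable with respect to the past, so the summands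
  stay orthogonal; at most 2^k of them, each with second moment at most G^2 V / 4^k, give the order
  2^-k.\<close>

lemma martingale_sum_bound:
  assumes g: "g \<in> borel_measurable borel" "\<And>y. \<bar>g y\<bar> \<le> G" and N: "N \<le> 2 ^ k"
    and X: "\<And>l. l < 2 ^ k \<Longrightarrow> X l \<in> borel_measurable (F (real (Suc l) / 2 ^ k))"
      "\<And>l. l < 2 ^ k \<Longrightarrow> sq_int W (X l)"
      "\<And>l. l < 2 ^ k \<Longrightarrow> (\<integral>\<omega>. (X l \<omega>)\<^sup>2 \<partial>W) \<le> V * ((1 / 2) ^ k)\<^sup>2"
    and orth: "\<And>l Z. l < 2 ^ k \<Longrightarrow> Z \<in> borel_measurable (F (real l / 2 ^ k)) \<Longrightarrow> sq_int W Z
      \<Longrightarrow> (\<integral>\<omega>. Z \<omega> * X l \<omega> \<partial>W) = 0"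
    and "0 \<le> V"
  shows "sq_int W (\<lambda>\<omega>. \<Sum>l<N. g (M (real l / 2 ^ k) \<omega>) * X l \<omega>)" (is "sq_int W ?S")
    "(\<integral>\<omega>. (\<Sum>l<N. g (M (real l / 2 ^ k) \<omega>) * X l \<omega>)\<^sup>2 \<partial>W) \<le> (G\<^sup>2 * V) * (1 / 2) ^ k"
proof -
  define D where "D l \<omega> = g (M (real l / 2 ^ k) \<omega>) * X l \<omega>" for l \<omega>
  have l2: "l < 2 ^ k" if "l < N" for l using that N by simp
  have D1: "D l \<in> borel_measurable (F (real (Suc l) / 2 ^ k))" if "l < N" for l
  proof -
    note st = dyadic_step[OF l2[OF that]]
    have "(\<lambda>\<omega>. g (M (real l / 2 ^ k) \<omega>)) \<in> borel_measurable (F (real (Suc l) / 2 ^ k))"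
      using meas_mono[OF function_of_M(1)[OF st(6) g(1)] st(1,3,4)] .
    then show ?thesis using X(1)[OF l2[OF that]] unfolding D_def by auto
  qed
  have D2: "sq_int W (D l)" if "l < N" for l
    unfolding D_def using g(2) dyadic_step[OF l2[OF that]]
    by (intro sq_int_bounded_mult X l2 that function_of_M g) auto
  have orthD: "(\<integral>\<omega>. Z \<omega> * D l \<omega> \<partial>W) = 0"
    if "l < N" "Z \<in> borel_measurable (F (real l / 2 ^ k))" "sq_int W Z" for l Z
  proof -
    note st = dyadic_step[OF l2[OF that(1)]]
    have "sq_int W (\<lambda>\<omega>. g (M (real l / 2 ^ k) \<omega>) * Z \<omega>)"
      using g(2) by (intro sq_int_bounded_mult that function_of_M g st)
    moreover have "(\<lambda>\<omega>. g (M (real l / 2 ^ k) \<omega>) * Z \<omega>) \<in> borel_measurable (F (real l / 2 ^ k))"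
      using function_of_M(1)[OF st(6) g(1)] that(2) by auto
    ultimately have "(\<integral>\<omega>. (g (M (real l / 2 ^ k) \<omega>) * Z \<omega>) * X l \<omega> \<partial>W) = 0"
      using orth[OF l2[OF that(1)]] by blast
    then show ?thesis by (simp add: D_def mult_ac)
  qed
  have eq: "(\<integral>\<omega>. (\<Sum>l<N. D l \<omega>)\<^sup>2 \<partial>W) = (\<Sum>l<N. \<integral>\<omega>. (D l \<omega>)\<^sup>2 \<partial>W)"
  proof (rule orthogonal_sum(1)[where p = "\<lambda>l. real l / 2 ^ k"])
    show "real N / 2 ^ k \<le> 1" using grid_in_unit[OF N] by simp
    show "real l / 2 ^ k \<le> real (Suc l) / 2 ^ k" if "l < N" for l using dyadic_step(3)[OF l2[OF that]] .
  qed (use D1 D2 orthD in auto)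
  show "sq_int W ?S" using D2 unfolding D_def by (intro sq_int_sum) auto
  have "(\<integral>\<omega>. (D l \<omega>)\<^sup>2 \<partial>W) \<le> G\<^sup>2 * (V * ((1 / 2) ^ k)\<^sup>2)" if "l < N" for l
  proof -
    have "(\<integral>\<omega>. (D l \<omega>)\<^sup>2 \<partial>W) \<le> (\<integral>\<omega>. G\<^sup>2 * (X l \<omega>)\<^sup>2 \<partial>W)"
    proof (rule integral_mono)
      fix \<omega>
      have "\<bar>g (M (real l / 2 ^ k) \<omega>)\<bar>\<^sup>2 \<le> G\<^sup>2" using g(2) by (intro power_mono) auto
      then show "(D l \<omega>)\<^sup>2 \<le> G\<^sup>2 * (X l \<omega>)\<^sup>2"
        by (simp add: D_def power_mult_distrib mult_right_mono)
    qed (use D2 X(2) that l2 in \<open>auto simp: sq_int_def\<close>)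
    also have "\<dots> \<le> G\<^sup>2 * (V * ((1 / 2) ^ k)\<^sup>2)" using X(3)[OF l2[OF that]] by (simp add: mult_left_mono)
    finally show ?thesis .
  qed
  then have "(\<integral>\<omega>. (\<Sum>l<N. D l \<omega>)\<^sup>2 \<partial>W) \<le> (\<Sum>l<N. G\<^sup>2 * (V * ((1 / 2) ^ k)\<^sup>2))"
    unfolding eq by (intro sum_mono) auto
  also have "\<dots> = (G\<^sup>2 * V) * (1 / 2) ^ k * (real N * (1 / 2) ^ k)" by (simp add: power2_eq_square)
  also have "\<dots> \<le> (G\<^sup>2 * V) * (1 / 2) ^ k * 1"
    using count_times_step[OF N] \<open>0 \<le> V\<close> by (intro mult_left_mono) auto
  finally show "(\<integral>\<omega>. (\<Sum>l<N. g (M (real l / 2 ^ k) \<omega>) * X l \<omega>)\<^sup>2 \<partial>W) \<le> (G\<^sup>2 * V) * (1 / 2) ^ k"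
    by (simp add: D_def)
qed

lemma AE_sum_\<rho>:
  assumes g: "g \<in> borel_measurable borel" "\<And>y. \<bar>g y\<bar> \<le> G" and N: "\<And>k. N k \<le> 2 ^ k"
  shows "AE \<omega> in W. (\<lambda>k. \<Sum>l<N k. g (M (real l / 2 ^ k) \<omega>) * \<rho> (real l / 2 ^ k) (real (Suc l) / 2 ^ k) \<omega>) \<longlonglongrightarrow> 0"
proof (rule AE_tendsto_zero_geometric_sq[where C = "G\<^sup>2 * (36 * L\<^sup>2 * c\<^sup>2)" and q = "1 / 2"])
  fix k
  have 1: "\<rho> (real l / 2 ^ k) (real (Suc l) / 2 ^ k) \<in> borel_measurable (F (real (Suc l) / 2 ^ k))" if "l < 2 ^ k" for l
    using \<rho>_measurable dyadic_step[OF that] by blast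
  have 2: "(\<integral>\<omega>. Z \<omega> * \<rho> (real l / 2 ^ k) (real (Suc l) / 2 ^ k) \<omega> \<partial>W) = 0"
    if "l < 2 ^ k" "Z \<in> borel_measurable (F (real l / 2 ^ k))" "sq_int W Z" for l Z
    using \<rho>_orthogonal dyadic_step[OF that(1)] that by blast
  show "sq_int W (\<lambda>\<omega>. \<Sum>l<N k. g (M (real l / 2 ^ k) \<omega>) * \<rho> (real l / 2 ^ k) (real (Suc l) / 2 ^ k) \<omega>)"
    by (rule martingale_sum_bound(1)[OF g N 1 \<rho>_sq_int(1) \<rho>_sq_int(2) 2]) auto
  show "(\<integral>\<omega>. (\<Sum>l<N k. g (M (real l / 2 ^ k) \<omega>) * \<rho> (real l / 2 ^ k) (real (Suc l) / 2 ^ k) \<omega>)\<^sup>2 \<partial>W)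
      \<le> G\<^sup>2 * (36 * L\<^sup>2 * c\<^sup>2) * (1 / 2) ^ k"
    by (rule martingale_sum_bound(2)[OF g N 1 \<rho>_sq_int(1) \<rho>_sq_int(2) 2]) auto
qed auto

text \<open>With b the Brownian increment over a cell of length h, b^2 - h is centred and
  independent of the past, so \<open>martingale_sum_bound\<close> applies.\<close>

lemma AE_sum_dB_square:
  assumes g: "g \<in> borel_measurable borel" "\<And>y. \<bar>g y\<bar> \<le> G" and N: "\<And>k. N k \<le> 2 ^ k"
  shows "AE \<omega> in W. (\<lambda>k. \<Sum>l<N k. g (M (real l / 2 ^ k) \<omega>) *
    ((B (real (Suc l) / 2 ^ k) \<omega> - B (real l / 2 ^ k) \<omega>)\<^sup>2 - (1 / 2) ^ k)) \<longlonglongrightarrow> 0"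
proof (rule AE_tendsto_zero_geometric_sq[where C = "G\<^sup>2 * 2" and q = "1 / 2"])
  fix k :: nat
  define X where "X l \<omega> = (B (real (Suc l) / 2 ^ k) \<omega> - B (real l / 2 ^ k) \<omega>)\<^sup>2 - (1 / 2) ^ k" for l \<omega>
  have X1: "X l \<in> borel_measurable (F (real (Suc l) / 2 ^ k))" if "l < 2 ^ k" for l
    using dB_measurable[OF dyadic_step(1,3,4)[OF that]] unfolding X_def[abs_def] by measurable
  have X2: "sq_int W (X l)" and X3: "(\<integral>\<omega>. (X l \<omega>)\<^sup>2 \<partial>W) \<le> 2 * ((1 / 2) ^ k)\<^sup>2"
    and X4: "integrable W (X l)" "(\<integral>\<omega>. X l \<omega> \<partial>W) = 0" if "l < 2 ^ k" for l
  proof -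
    let ?b = "\<lambda>\<omega>. B (real (Suc l) / 2 ^ k) \<omega> - B (real l / 2 ^ k) \<omega>"
    let ?h = "(1 / 2 :: real) ^ k"
    note st = dyadic_step[OF that]
    note m = dB_moments[OF st(1,2,4), unfolded st(5)]
    \<comment> \<open>With fourth moment 3 h^2 and second moment h, the variance is 3 h^2 - 2 h^2 +
      h^2 = 2 h^2; hence the constant 2.\<close>
    have eq: "(X l \<omega>)\<^sup>2 = ?b \<omega> ^ 4 - 2 * ?h * (?b \<omega>)\<^sup>2 + ?h\<^sup>2" for \<omega>
      by (simp add: X_def power2_eq_square eval_nat_numeral algebra_simps)
    have int: "integrable W (\<lambda>\<omega>. (X l \<omega>)\<^sup>2)" unfolding eq using m by auto
    then show "sq_int W (X l)" using meas_W[OF X1[OF that] st(7)] by (auto simp: sq_int_def)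
    have "(\<integral>\<omega>. (X l \<omega>)\<^sup>2 \<partial>W) = 3 * ?h\<^sup>2 - 2 * ?h * ?h + ?h\<^sup>2"
      unfolding eq using m by (simp add: prob_space)
    then show "(\<integral>\<omega>. (X l \<omega>)\<^sup>2 \<partial>W) \<le> 2 * ?h\<^sup>2" by (simp add: power2_eq_square)
    show "integrable W (X l)" "(\<integral>\<omega>. X l \<omega> \<partial>W) = 0"
      unfolding X_def[abs_def] using m by (auto simp: prob_space)
  qed
  have X5: "(\<integral>\<omega>. Z \<omega> * X l \<omega> \<partial>W) = 0"
    if "l < 2 ^ k" "Z \<in> borel_measurable (F (real l / 2 ^ k))" "sq_int W Z" for l Z
    using indep_mult(2)[OF dyadic_step(1,2,4)[OF that(1)] that(2) sq_int_imp_integrable[OF that(3)], of "\<lambda>z. z\<^sup>2 - (1 / 2) ^ k"]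
      X4[OF that(1)] by (auto simp: X_def[abs_def])
  show "sq_int W (\<lambda>\<omega>. \<Sum>l<N k. g (M (real l / 2 ^ k) \<omega>) *
      ((B (real (Suc l) / 2 ^ k) \<omega> - B (real l / 2 ^ k) \<omega>)\<^sup>2 - (1 / 2) ^ k))"
    unfolding X_def[symmetric] by (rule martingale_sum_bound(1)[OF g N X1 X2 X3 X5]) auto
  show "(\<integral>\<omega>. (\<Sum>l<N k. g (M (real l / 2 ^ k) \<omega>) *
      ((B (real (Suc l) / 2 ^ k) \<omega> - B (real l / 2 ^ k) \<omega>)\<^sup>2 - (1 / 2) ^ k))\<^sup>2 \<partial>W) \<le> G\<^sup>2 * 2 * (1 / 2) ^ k"
    unfolding X_def[symmetric] by (rule martingale_sum_bound(2)[OF g N X1 X2 X3 X5]) auto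
qed auto

text \<open>This is the part of the squared increment (\<sigma> b + \<rho>)^2 that involves \<rho>.
  Since b has order h^(1/2) and \<rho> has order h, the first moments of at most 1 / h terms already
  add up to order h^(1/2), that is (1 / sqrt 2)^k.\<close>

lemma AE_sum_\<rho>_cross:
  assumes g: "g \<in> borel_measurable borel" "\<And>y. \<bar>g y\<bar> \<le> G" and N: "\<And>k. N k \<le> 2 ^ k"
  shows "AE \<omega> in W. (\<lambda>k. \<Sum>l<N k. g (M (real l / 2 ^ k) \<omega>) *
    (2 * \<sigma> (M (real l / 2 ^ k) \<omega>) * (B (real (Suc l) / 2 ^ k) \<omega> - B (real l / 2 ^ k) \<omega>) * \<rho> (real l / 2 ^ k) (real (Suc l) / 2 ^ k) \<omega>
      + (\<rho> (real l / 2 ^ k) (real (Suc l) / 2 ^ k) \<omega>)\<^sup>2)) \<longlonglongrightarrow> 0"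
proof (rule AE_tendsto_zero_geometric[where C = "G * (c * (1 + 36 * L\<^sup>2 * c\<^sup>2) + 36 * L\<^sup>2 * c\<^sup>2)" and q = "1 / sqrt 2"])
  define K where "K = 36 * L\<^sup>2 * c\<^sup>2"
  have "0 \<le> K" by (simp add: K_def)
  have "0 \<le> G" using g(2)[of 0] by simp
  then show "0 \<le> G * (c * (1 + 36 * L\<^sup>2 * c\<^sup>2) + 36 * L\<^sup>2 * c\<^sup>2)" using c_nonneg by simp
  fix k :: nat
  \<comment> \<open>The square root of the mesh. As weight in Young's inequality it gives s b^2 and
    \<rho>^2 / s the same order s^3.\<close>
  define s where "s = (1 / sqrt 2) ^ k"
  have s: "0 < s" "s \<le> 1" "(1 / 2) ^ k = s\<^sup>2"
    by (auto simp: s_def power_le_one power2_eq_square power_mult_distrib[symmetric])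
  let ?b = "\<lambda>l \<omega>. B (real (Suc l) / 2 ^ k) \<omega> - B (real l / 2 ^ k) \<omega>"
  let ?r = "\<lambda>l \<omega>. \<rho> (real l / 2 ^ k) (real (Suc l) / 2 ^ k) \<omega>"
  define D where "D l \<omega> = g (M (real l / 2 ^ k) \<omega>) * (2 * \<sigma> (M (real l / 2 ^ k) \<omega>) * ?b l \<omega> * ?r l \<omega> + (?r l \<omega>)\<^sup>2)" for l \<omega>
  have l2: "l < 2 ^ k" if "l < N k" for l using that N[of k] by simp
  have D_meas: "D l \<in> borel_measurable W" if "l < N k" for l
  proof -
    note st = dyadic_step[OF l2[OF that]]
    have [measurable]: "M (real l / 2 ^ k) \<in> borel_measurable W" "?b l \<in> borel_measurable W" "?r l \<in> borel_measurable W"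
      using M_meas_W[OF st(6)] dB_meas_W[OF st(1,3,4)] meas_W[OF \<rho>_measurable[OF st(1,3,4)] st(7)] by auto
    note g(1)[measurable]
    show ?thesis unfolding D_def[abs_def] by measurable
  qed
  then show "(\<lambda>\<omega>. \<Sum>l<N k. g (M (real l / 2 ^ k) \<omega>) * (2 * \<sigma> (M (real l / 2 ^ k) \<omega>) * ?b l \<omega> * ?r l \<omega> + (?r l \<omega>)\<^sup>2)) \<in> borel_measurable W"
    unfolding D_def[symmetric] by (intro borel_measurable_sum) auto
  have bd: "(\<integral>\<^sup>+\<omega>. ennreal \<bar>D l \<omega>\<bar> \<partial>W) \<le> ennreal (G * (c * (1 + K) + K) * s ^ 3)" if "l < N k" for l
  proof -
    note st = dyadic_step[OF l2[OF that]]
    note m = dB_moments(3,4)[OF st(1,2,4), unfolded st(5)]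
    note r = \<rho>_sq_int[OF l2[OF that]]
    let ?U = "\<lambda>\<omega>. G * (c * (s * (?b l \<omega>)\<^sup>2 + (?r l \<omega>)\<^sup>2 / s) + (?r l \<omega>)\<^sup>2)"
    have U: "\<bar>D l \<omega>\<bar> \<le> ?U \<omega>" for \<omega>
    proof -
      note 1 = weighted_young[OF s(1), of "?b l \<omega>" "?r l \<omega>"]
      have "\<bar>2 * \<sigma> (M (real l / 2 ^ k) \<omega>) * ?b l \<omega> * ?r l \<omega>\<bar> = \<bar>\<sigma> (M (real l / 2 ^ k) \<omega>)\<bar> * (2 * \<bar>?b l \<omega> * ?r l \<omega>\<bar>)"
        by (simp add: abs_mult)
      also have "\<dots> \<le> c * (s * (?b l \<omega>)\<^sup>2 + (?r l \<omega>)\<^sup>2 / s)"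
        using 1 \<sigma>_bound c_nonneg by (intro mult_mono) auto
      finally have "\<bar>2 * \<sigma> (M (real l / 2 ^ k) \<omega>) * ?b l \<omega> * ?r l \<omega> + (?r l \<omega>)\<^sup>2\<bar>
          \<le> c * (s * (?b l \<omega>)\<^sup>2 + (?r l \<omega>)\<^sup>2 / s) + (?r l \<omega>)\<^sup>2"
        by (intro order_trans[OF abs_triangle_ineq] add_mono) auto
      then show ?thesis unfolding D_def abs_mult[of "g _"] using g(2) \<open>0 \<le> G\<close> by (intro mult_mono) auto
    qed
    have int: "integrable W ?U" using m r by (auto simp: sq_int_def)
    have "(\<integral>\<^sup>+\<omega>. ennreal \<bar>D l \<omega>\<bar> \<partial>W) \<le> (\<integral>\<^sup>+\<omega>. ennreal (?U \<omega>) \<partial>W)"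
      using U by (intro nn_integral_mono ennreal_leI) auto
    also have "\<dots> = ennreal (\<integral>\<omega>. ?U \<omega> \<partial>W)"
      using int U order_trans[OF abs_ge_zero U] by (intro nn_integral_eq_integral) auto
    also have "(\<integral>\<omega>. ?U \<omega> \<partial>W) = G * (c * (s * s\<^sup>2 + (\<integral>\<omega>. (?r l \<omega>)\<^sup>2 \<partial>W) / s) + (\<integral>\<omega>. (?r l \<omega>)\<^sup>2 \<partial>W))"
      using m r by (simp add: sq_int_def s)
    also have "\<dots> \<le> G * (c * (s * s\<^sup>2 + (K * (s\<^sup>2)\<^sup>2) / s) + K * (s\<^sup>2)\<^sup>2)"
      using r(2) s(1) c_nonneg \<open>0 \<le> G\<close> unfolding s(3) K_def[symmetric]
      by (intro mult_left_mono add_mono divide_right_mono) auto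
    also have "\<dots> = G * (c * (1 + K) + K * s) * s ^ 3"
      using s(1) by (simp add: field_simps eval_nat_numeral)
    also have "\<dots> \<le> G * (c * (1 + K) + K) * s ^ 3"
      using s \<open>0 \<le> G\<close> \<open>0 \<le> K\<close> by (intro mult_right_mono mult_left_mono add_left_mono) (auto simp: mult_left_le)
    finally show ?thesis by (auto intro: ennreal_leI)
  qed
  have "(\<integral>\<^sup>+\<omega>. ennreal \<bar>\<Sum>l<N k. D l \<omega>\<bar> \<partial>W) \<le> (\<integral>\<^sup>+\<omega>. (\<Sum>l<N k. ennreal \<bar>D l \<omega>\<bar>) \<partial>W)"
    by (intro nn_integral_mono) (subst sum_ennreal, auto intro!: ennreal_leI)
  also have "\<dots> = (\<Sum>l<N k. \<integral>\<^sup>+\<omega>. ennreal \<bar>D l \<omega>\<bar> \<partial>W)"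
    using D_meas by (intro nn_integral_sum) auto
  also have "\<dots> \<le> (\<Sum>l<N k. ennreal (G * (c * (1 + K) + K) * s ^ 3))"
    using bd by (intro sum_mono) auto
  also have "\<dots> = ennreal (real (N k) * (G * (c * (1 + K) + K) * s ^ 3))"
    by (simp add: ennreal_of_nat_eq_real_of_nat ennreal_mult')
  also have "\<dots> \<le> ennreal (G * (c * (1 + K) + K) * s)"
  proof (rule ennreal_leI)
    have "real (N k) * s\<^sup>2 \<le> 1" using count_times_step[OF N[of k]] s(3) by simp
    then have "(G * (c * (1 + K) + K) * s) * (real (N k) * s\<^sup>2) \<le> (G * (c * (1 + K) + K) * s) * 1"
      using \<open>0 \<le> G\<close> \<open>0 \<le> K\<close> c_nonneg s by (intro mult_left_mono) auto
    then show "real (N k) * (G * (c * (1 + K) + K) * s ^ 3) \<le> G * (c * (1 + K) + K) * s"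
      by (simp add: eval_nat_numeral mult_ac)
  qed
  finally show "(\<integral>\<^sup>+\<omega>. ennreal \<bar>\<Sum>l<N k. g (M (real l / 2 ^ k) \<omega>) * (2 * \<sigma> (M (real l / 2 ^ k) \<omega>) * ?b l \<omega> * ?r l \<omega> + (?r l \<omega>)\<^sup>2)\<bar> \<partial>W)
    \<le> ennreal (G * (c * (1 + 36 * L\<^sup>2 * c\<^sup>2) + 36 * L\<^sup>2 * c\<^sup>2) * (1 / sqrt 2) ^ k)"
    by (simp add: D_def K_def s_def)
qed auto

text \<open>The squared increment of \<open>M\<close> is \<sigma>^2 h + \<sigma>^2 (b^2 - h) + (2
  \<sigma> b \<rho> + \<rho>^2): the first part gives a Riemann sum, the other two give vanishing
  sums.\<close>

lemma AE_quadratic_variation: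
  assumes g: "continuous_on UNIV g" "\<And>y. \<bar>g y\<bar> \<le> G" and T: "T \<in> {0..1}"
  shows "AE \<omega> in W. (\<lambda>k. \<Sum>l<nat \<lfloor>T * 2 ^ k\<rfloor>. g (M (real l / 2 ^ k) \<omega>) *
      (M (real (Suc l) / 2 ^ k) \<omega> - M (real l / 2 ^ k) \<omega>)\<^sup>2)
    \<longlonglongrightarrow> integral {0..T} (\<lambda>s. g (M s \<omega>) * (\<sigma> (M s \<omega>))\<^sup>2)"
proof -
  have gm: "g \<in> borel_measurable borel" using g(1) by (rule borel_measurable_continuous_onI)
  have g2: "\<bar>g y * (\<sigma> y)\<^sup>2\<bar> \<le> G * c\<^sup>2" for y
  proof -
    have "\<bar>\<sigma> y\<bar>\<^sup>2 \<le> c\<^sup>2" using \<sigma>_bound by (intro power_mono) auto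
    then show ?thesis unfolding abs_mult using g(2)[of y] by (intro mult_mono) auto
  qed
  have "AE \<omega> in W. \<omega> \<in> space W" by simp
  with AE_sum_\<rho>_cross[OF gm g(2) floor_grid(1)[OF T]]
    AE_sum_dB_square[OF _ g2 floor_grid(1)[OF T], OF borel_measurable_times[OF gm borel_measurable_power[OF \<sigma>_measurable]]]
  show ?thesis
  proof eventually_elim
    case (elim \<omega>)
    have cont: "continuous_on {0..1} (\<lambda>s. g (M s \<omega>) * (\<sigma> (M s \<omega>))\<^sup>2)"
      using M_continuous[OF elim(3)]
      by (intro continuous_intros continuous_on_compose2[OF g(1)] continuous_on_compose2[OF \<sigma>_continuous]) auto
    have "(\<lambda>k. \<Sum>l<nat \<lfloor>T * 2 ^ k\<rfloor>. g (M (real l / 2 ^ k) \<omega>) * (\<sigma> (M (real l / 2 ^ k) \<omega>))\<^sup>2 * (1 / 2 ^ k))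
      \<longlonglongrightarrow> integral {0..T} (\<lambda>s. g (M s \<omega>) * (\<sigma> (M s \<omega>))\<^sup>2)"
      using riemann_sum_tendsto[OF cont T, of 0] by simp
    from tendsto_add[OF tendsto_add[OF elim(1,2)] this]
    have lim: "(\<lambda>k. (\<Sum>l<nat \<lfloor>T * 2 ^ k\<rfloor>. g (M (real l / 2 ^ k) \<omega>) *
           (2 * \<sigma> (M (real l / 2 ^ k) \<omega>) * (B (real (Suc l) / 2 ^ k) \<omega> - B (real l / 2 ^ k) \<omega>) * \<rho> (real l / 2 ^ k) (real (Suc l) / 2 ^ k) \<omega>
            + (\<rho> (real l / 2 ^ k) (real (Suc l) / 2 ^ k) \<omega>)\<^sup>2)) +
          (\<Sum>l<nat \<lfloor>T * 2 ^ k\<rfloor>. g (M (real l / 2 ^ k) \<omega>) * (\<sigma> (M (real l / 2 ^ k) \<omega>))\<^sup>2 *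
            ((B (real (Suc l) / 2 ^ k) \<omega> - B (real l / 2 ^ k) \<omega>)\<^sup>2 - (1 / 2) ^ k)) +
          (\<Sum>l<nat \<lfloor>T * 2 ^ k\<rfloor>. g (M (real l / 2 ^ k) \<omega>) * (\<sigma> (M (real l / 2 ^ k) \<omega>))\<^sup>2 * (1 / 2 ^ k))) \<longlonglongrightarrow> integral {0..T} (\<lambda>s. g (M s \<omega>) * (\<sigma> (M s \<omega>))\<^sup>2)"
      by (simp only: add_0_left)
    have "(\<Sum>l<nat \<lfloor>T * 2 ^ k\<rfloor>. g (M (real l / 2 ^ k) \<omega>) *
           (2 * \<sigma> (M (real l / 2 ^ k) \<omega>) * (B (real (Suc l) / 2 ^ k) \<omega> - B (real l / 2 ^ k) \<omega>) * \<rho> (real l / 2 ^ k) (real (Suc l) / 2 ^ k) \<omega>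
            + (\<rho> (real l / 2 ^ k) (real (Suc l) / 2 ^ k) \<omega>)\<^sup>2)) +
          (\<Sum>l<nat \<lfloor>T * 2 ^ k\<rfloor>. g (M (real l / 2 ^ k) \<omega>) * (\<sigma> (M (real l / 2 ^ k) \<omega>))\<^sup>2 *
            ((B (real (Suc l) / 2 ^ k) \<omega> - B (real l / 2 ^ k) \<omega>)\<^sup>2 - (1 / 2) ^ k)) +
          (\<Sum>l<nat \<lfloor>T * 2 ^ k\<rfloor>. g (M (real l / 2 ^ k) \<omega>) * (\<sigma> (M (real l / 2 ^ k) \<omega>))\<^sup>2 * (1 / 2 ^ k)) =
          (\<Sum>l<nat \<lfloor>T * 2 ^ k\<rfloor>. g (M (real l / 2 ^ k) \<omega>) * (M (real (Suc l) / 2 ^ k) \<omega> - M (real l / 2 ^ k) \<omega>)\<^sup>2)" for k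
    proof (unfold sum.distrib[symmetric], intro sum.cong refl)
      fix l
        define m0 m1 b0 b1 where "m0 = M (real l / 2 ^ k) \<omega>" and "m1 = M (real (Suc l) / 2 ^ k) \<omega>"
          and "b0 = B (real l / 2 ^ k) \<omega>" and "b1 = B (real (Suc l) / 2 ^ k) \<omega>"
        have "m1 - m0 = \<sigma> m0 * (b1 - b0) + \<rho> (real l / 2 ^ k) (real (Suc l) / 2 ^ k) \<omega>"
          by (simp add: \<rho>_def m0_def m1_def b0_def b1_def)
        then have sq: "(m1 - m0)\<^sup>2 = (\<sigma> m0 * (b1 - b0) + \<rho> (real l / 2 ^ k) (real (Suc l) / 2 ^ k) \<omega>)\<^sup>2" by simp
        show "g (M (real l / 2 ^ k) \<omega>) *
           (2 * \<sigma> (M (real l / 2 ^ k) \<omega>) * (B (real (Suc l) / 2 ^ k) \<omega> - B (real l / 2 ^ k) \<omega>) * \<rho> (real l / 2 ^ k) (real (Suc l) / 2 ^ k) \<omega>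
            + (\<rho> (real l / 2 ^ k) (real (Suc l) / 2 ^ k) \<omega>)\<^sup>2) +
           g (M (real l / 2 ^ k) \<omega>) * (\<sigma> (M (real l / 2 ^ k) \<omega>))\<^sup>2 *
            ((B (real (Suc l) / 2 ^ k) \<omega> - B (real l / 2 ^ k) \<omega>)\<^sup>2 - (1 / 2) ^ k) +
           g (M (real l / 2 ^ k) \<omega>) * (\<sigma> (M (real l / 2 ^ k) \<omega>))\<^sup>2 * (1 / 2 ^ k) =
           g (M (real l / 2 ^ k) \<omega>) * (M (real (Suc l) / 2 ^ k) \<omega> - M (real l / 2 ^ k) \<omega>)\<^sup>2"
          unfolding m0_def[symmetric] m1_def[symmetric] b0_def[symmetric] b1_def[symmetric] sq
          by (simp add: power2_eq_square algebra_simps power_one_over)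
    qed
    with lim show ?case by (simp only:)
  qed
qed

end

section \<open>The Lamperti transform and Ito's formula\<close>

text \<open>\<Lambda> is fixed only through its derivative: a constant added to it cancels in G
  (\<Lambda> x + B) and in all differences.\<close>

locale lamperti = diffusion +
  fixes \<sigma>' \<sigma>'' \<Lambda> :: "real \<Rightarrow> real" and \<delta> :: real
  assumes \<delta>_pos: "0 < \<delta>" and \<sigma>_ge: "\<And>y. \<delta> \<le> \<sigma> y"
    and \<sigma>_deriv: "\<And>y. (\<sigma> has_real_derivative \<sigma>' y) (at y)"
    and \<sigma>'_deriv: "\<And>y. (\<sigma>' has_real_derivative \<sigma>'' y) (at y)"
    and \<sigma>'_bound: "\<And>y. \<bar>\<sigma>' y\<bar> \<le> L" and \<sigma>''_bound: "\<And>y. \<bar>\<sigma>'' y\<bar> \<le> L"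
    and \<Lambda>_deriv: "\<And>y. (\<Lambda> has_real_derivative 1 / \<sigma> y) (at y)"
begin

lemma \<sigma>_pos: "0 < \<sigma> y" using \<sigma>_ge[of y] \<delta>_pos by linarith

lemma \<sigma>_nz: "\<sigma> y \<noteq> 0" using \<sigma>_pos[of y] by simp

lemma inverse_\<sigma>_bound: "\<bar>1 / \<sigma> y\<bar> \<le> 1 / \<delta>"
  using \<sigma>_pos[of y] \<sigma>_ge[of y] \<delta>_pos by (simp add: frac_le)

lemma inverse_\<sigma>_deriv: "((\<lambda>y. 1 / \<sigma> y) has_real_derivative - \<sigma>' y / (\<sigma> y)\<^sup>2) (at y)"
  using \<sigma>_deriv[of y] \<sigma>_nz[of y] by (auto intro!: derivative_eq_intros simp: power2_eq_square)

text \<open>The third derivative of \<Lambda>, for the expansion behind Ito's formula; it is bounded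
  because \<sigma>' and \<sigma>'' are bounded and \<sigma> stays above \<delta>.\<close>

lemma \<Lambda>2_deriv: "((\<lambda>y. - \<sigma>' y / (\<sigma> y)\<^sup>2) has_real_derivative - \<sigma>'' y / (\<sigma> y)\<^sup>2 + 2 * (\<sigma>' y)\<^sup>2 / (\<sigma> y) ^ 3) (at y)"
  using \<sigma>_deriv[of y] \<sigma>'_deriv[of y] \<sigma>_nz[of y]
  by (auto intro!: derivative_eq_intros simp: field_simps eval_nat_numeral)

lemma \<Lambda>2_bound: "\<bar>- \<sigma>' y / (\<sigma> y)\<^sup>2\<bar> \<le> L / \<delta>\<^sup>2"
proof -
  have "\<delta>\<^sup>2 \<le> (\<sigma> y)\<^sup>2" using \<sigma>_ge \<delta>_pos by (intro power_mono) auto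
  then have "\<bar>\<sigma>' y\<bar> / (\<sigma> y)\<^sup>2 \<le> L / \<delta>\<^sup>2"
    using \<sigma>'_bound \<delta>_pos L_nonneg by (intro frac_le) auto
  then show ?thesis by simp
qed

lemma \<Lambda>3_bound: "\<bar>- \<sigma>'' y / (\<sigma> y)\<^sup>2 + 2 * (\<sigma>' y)\<^sup>2 / (\<sigma> y) ^ 3\<bar> \<le> L / \<delta>\<^sup>2 + 2 * L\<^sup>2 / \<delta> ^ 3"
proof -
  have "\<delta>\<^sup>2 \<le> (\<sigma> y)\<^sup>2" "\<delta> ^ 3 \<le> (\<sigma> y) ^ 3" using \<sigma>_ge \<delta>_pos by (auto intro!: power_mono)
  moreover have "(\<sigma>' y)\<^sup>2 \<le> L\<^sup>2" using power_mono[OF \<sigma>'_bound[of y], of 2] by simp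
  ultimately have "\<bar>\<sigma>'' y\<bar> / (\<sigma> y)\<^sup>2 \<le> L / \<delta>\<^sup>2" "2 * (\<sigma>' y)\<^sup>2 / (\<sigma> y) ^ 3 \<le> 2 * L\<^sup>2 / \<delta> ^ 3"
    using \<sigma>''_bound \<delta>_pos L_nonneg by (auto intro!: frac_le)
  moreover have "\<bar>- \<sigma>'' y / (\<sigma> y)\<^sup>2 + 2 * (\<sigma>' y)\<^sup>2 / (\<sigma> y) ^ 3\<bar> \<le> \<bar>\<sigma>'' y\<bar> / (\<sigma> y)\<^sup>2 + 2 * (\<sigma>' y)\<^sup>2 / (\<sigma> y) ^ 3"
    using \<sigma>_pos[of y] by (intro order_trans[OF abs_triangle_ineq]) auto
  ultimately show ?thesis by linarith
qed

lemma \<Lambda>_continuous: "continuous_on A \<Lambda>"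
  using \<Lambda>_deriv by (rule continuous_on_of_deriv)

lemma \<sigma>'_continuous: "continuous_on A \<sigma>'"
  using \<sigma>'_deriv by (rule continuous_on_of_deriv)

lemma AE_sum_square_tendsto:
  assumes "T \<in> {0..1}"
  shows "AE \<omega> in W. (\<lambda>k. \<Sum>l<nat \<lfloor>T * 2 ^ k\<rfloor>. (M (real (Suc l) / 2 ^ k) \<omega> - M (real l / 2 ^ k) \<omega>)\<^sup>2)
    \<longlonglongrightarrow> integral {0..T} (\<lambda>s. (\<sigma> (M s \<omega>))\<^sup>2)"
  using AE_quadratic_variation[of "\<lambda>_. 1" 1 T] assms by simp

lemma AE_cubic_tendsto_zero:
  assumes T: "T \<in> {0..1::real}"
  shows "AE \<omega> in W. (\<lambda>k. \<Sum>l<nat \<lfloor>T * 2 ^ k\<rfloor>. \<bar>M (real (Suc l) / 2 ^ k) \<omega> - M (real l / 2 ^ k) \<omega>\<bar> ^ 3) \<longlonglongrightarrow> 0"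
proof -
  have "AE \<omega> in W. \<omega> \<in> space W" by simp
  with AE_sum_square_tendsto[OF T] show ?thesis
  proof eventually_elim
    case (elim \<omega>)
    show ?case
      by (rule cubic_variation_tendsto_zero[where m = "\<lambda>t. M t \<omega>", OF M_continuous[OF elim(2)] floor_grid(1)[OF T]])
         (rule convergent_imp_Bseq, rule convergentI, rule elim(1))
  qed
qed

text \<open>Taylor expansion of \<Lambda> on each cell. The linear term, the increment of
  \<open>M\<close> divided by \<sigma>, is the Brownian increment plus \<rho> / \<sigma>; the
  quadratic terms tend to half the integral of (- \<sigma>' / \<sigma>^2) \<sigma>^2 = - \<sigma>';
  the cubic remainder vanishes.\<close>

lemma ito_formula_at:
  assumes T: "T \<in> {0..1}"
  shows "AE \<omega> in W. \<Lambda> (M T \<omega>) = \<Lambda> x + B T \<omega> + integral {0..T} (\<lambda>s. - \<sigma>' (M s \<omega>) / 2)"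
proof -
  let ?N = "\<lambda>k. nat \<lfloor>T * 2 ^ k\<rfloor>"
  have 1: "AE \<omega> in W. (\<lambda>k. \<Sum>l<?N k. 1 / \<sigma> (M (real l / 2 ^ k) \<omega>) * \<rho> (real l / 2 ^ k) (real (Suc l) / 2 ^ k) \<omega>) \<longlonglongrightarrow> 0"
    using inverse_\<sigma>_bound floor_grid(1)[OF T] by (intro AE_sum_\<rho>) auto
  have 2: "AE \<omega> in W. (\<lambda>k. \<Sum>l<?N k. - \<sigma>' (M (real l / 2 ^ k) \<omega>) / (\<sigma> (M (real l / 2 ^ k) \<omega>))\<^sup>2 * (M (real (Suc l) / 2 ^ k) \<omega> - M (real l / 2 ^ k) \<omega>)\<^sup>2)
    \<longlonglongrightarrow> integral {0..T} (\<lambda>s. - \<sigma>' (M s \<omega>) / (\<sigma> (M s \<omega>))\<^sup>2 * (\<sigma> (M s \<omega>))\<^sup>2)"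
    using \<Lambda>2_bound T \<sigma>_nz
    by (intro AE_quadratic_variation continuous_intros \<sigma>'_continuous \<sigma>_continuous) auto
  have "AE \<omega> in W. \<omega> \<in> space W" by simp
  with 1 2 AE_cubic_tendsto_zero[OF T] B_0 M_0 show ?thesis
  proof eventually_elim
    case (elim \<omega>)
    let ?t = "\<lambda>k. real (?N k) / 2 ^ k"
    let ?C = "L / \<delta>\<^sup>2 + 2 * L\<^sup>2 / \<delta> ^ 3"
    define m where "m k l = M (real l / 2 ^ k) \<omega>" for k l
    define b where "b k l = B (real l / 2 ^ k) \<omega>" for k l
    define r where "r k l = \<rho> (real l / 2 ^ k) (real (Suc l) / 2 ^ k) \<omega>" for k l
    have r_eq: "m k (Suc l) - m k l = \<sigma> (m k l) * (b k (Suc l) - b k l) + r k l" for k l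
      by (simp add: m_def b_def r_def \<rho>_def)
    define S1 where "S1 k = (\<Sum>l<?N k. 1 / \<sigma> (m k l) * r k l)" for k
    define S2 where "S2 k = (\<Sum>l<?N k. - \<sigma>' (m k l) / (\<sigma> (m k l))\<^sup>2 * (m k (Suc l) - m k l)\<^sup>2)" for k
    define S3 where "S3 k = (\<Sum>l<?N k. \<bar>m k (Suc l) - m k l\<bar> ^ 3)" for k
    define J where "J = integral {0..T} (\<lambda>s. - \<sigma>' (M s \<omega>))"
    have lim1: "S1 \<longlonglongrightarrow> 0" using elim(1) by (simp add: S1_def[abs_def] m_def r_def)
    have lim2: "S2 \<longlonglongrightarrow> J" using elim(2) \<sigma>_nz by (simp add: S2_def[abs_def] m_def J_def)
    have lim3: "S3 \<longlonglongrightarrow> 0" using elim(3) by (simp add: S3_def[abs_def] m_def)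
    have bound: "\<bar>\<Lambda> (m k (?N k)) - \<Lambda> (m k 0) - (b k (?N k) - b k 0) - S1 k - S2 k / 2\<bar> \<le> ?C * S3 k" for k
    proof -
      have "\<bar>\<Lambda> (m k (Suc l)) - \<Lambda> (m k l) - (b k (Suc l) - b k l) - 1 / \<sigma> (m k l) * r k l
          - (- \<sigma>' (m k l) / (\<sigma> (m k l))\<^sup>2 * (m k (Suc l) - m k l)\<^sup>2) / 2\<bar> \<le> ?C * \<bar>m k (Suc l) - m k l\<bar> ^ 3" for l
      proof -
        have "(b k (Suc l) - b k l) + 1 / \<sigma> (m k l) * r k l = 1 / \<sigma> (m k l) * (m k (Suc l) - m k l)"
          using \<sigma>_nz[of "m k l"] unfolding r_eq by (simp add: field_simps)
        with taylor3_bound[OF \<Lambda>_deriv inverse_\<sigma>_deriv \<Lambda>2_deriv \<Lambda>3_bound, of "m k l" "m k (Suc l) - m k l"]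
        show ?thesis by (simp add: diff_diff_eq)
      qed
      then have "\<bar>\<Sum>l<?N k. \<Lambda> (m k (Suc l)) - \<Lambda> (m k l) - (b k (Suc l) - b k l) - 1 / \<sigma> (m k l) * r k l
          - (- \<sigma>' (m k l) / (\<sigma> (m k l))\<^sup>2 * (m k (Suc l) - m k l)\<^sup>2) / 2\<bar> \<le> (\<Sum>l<?N k. ?C * \<bar>m k (Suc l) - m k l\<bar> ^ 3)"
        by (intro order_trans[OF sum_abs] sum_mono) blast
      moreover have "(\<Sum>l<?N k. \<Lambda> (m k (Suc l)) - \<Lambda> (m k l) - (b k (Suc l) - b k l) - 1 / \<sigma> (m k l) * r k l
          - (- \<sigma>' (m k l) / (\<sigma> (m k l))\<^sup>2 * (m k (Suc l) - m k l)\<^sup>2) / 2)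
        = (\<Sum>l<?N k. \<Lambda> (m k (Suc l)) - \<Lambda> (m k l)) - (\<Sum>l<?N k. b k (Suc l) - b k l) - S1 k - S2 k / 2"
        unfolding S1_def S2_def sum_divide_distrib sum_subtractf[symmetric] ..
      ultimately show ?thesis
        unfolding sum_lessThan_telescope[of "\<lambda>l. \<Lambda> (m k l)"] sum_lessThan_telescope S3_def sum_distrib_left by simp
    qed
    have lim0: "(\<lambda>k. \<Lambda> (m k (?N k)) - \<Lambda> (m k 0) - (b k (?N k) - b k 0) - S1 k - S2 k / 2) \<longlonglongrightarrow> 0"
    proof (rule Lim_null_comparison)
      show "(\<lambda>k. ?C * S3 k) \<longlonglongrightarrow> 0" using tendsto_mult_right_zero[OF lim3] .
    qed (use bound in \<open>auto intro: always_eventually\<close>)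
    \<comment> \<open>The sums stop at the last grid point not after T; continuity of the paths and
      of \<Lambda> closes the gap.\<close>
    have tT: "\<forall>\<^sub>F k in sequentially. ?t k \<in> {0..1}"
      using grid_in_unit[OF floor_grid(1)[OF T]] by (auto intro!: always_eventually)
    have "(\<lambda>k. \<Lambda> (M (?t k) \<omega>)) \<longlonglongrightarrow> \<Lambda> (M T \<omega>)"
      using continuous_on_compose2[OF \<Lambda>_continuous[of UNIV] M_continuous[OF elim(6)]]
        continuous_on_tendsto_compose[OF _ floor_grid_tendsto[OF T] T tT] by blast
    moreover have "(\<lambda>k. B (?t k) \<omega>) \<longlonglongrightarrow> B T \<omega>"
      using continuous_on_tendsto_compose[OF B_continuous[OF elim(6)] floor_grid_tendsto[OF T] T tT] .
    ultimately have "(\<lambda>k. \<Lambda> (m k (?N k)) - \<Lambda> (m k 0) - (b k (?N k) - b k 0) - S1 k - S2 k / 2)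
        \<longlonglongrightarrow> \<Lambda> (M T \<omega>) - \<Lambda> (M 0 \<omega>) - (B T \<omega> - B 0 \<omega>) - 0 - J / 2"
      unfolding m_def[symmetric] b_def[symmetric]
      by (intro tendsto_diff tendsto_divide lim1 lim2 tendsto_const) (auto simp: m_def b_def)
    from LIMSEQ_unique[OF this lim0] show ?case
      using elim(4,5) by (simp add: J_def)
  qed
qed

text \<open>The null set of \<open>ito_formula_at\<close> depends on T. Rational times contribute
  only countably many, and both sides are continuous along the dyadic, hence rational, times that
  approximate T.\<close>

lemma ito_formula:
  "AE \<omega> in W. \<forall>T\<in>{0..1}. \<Lambda> (M T \<omega>) = \<Lambda> x + B T \<omega> + integral {0..T} (\<lambda>s. - \<sigma>' (M s \<omega>) / 2)"
proof -
  have "AE \<omega> in W. \<forall>T\<in>\<rat> \<inter> {0..1}. \<Lambda> (M T \<omega>) = \<Lambda> x + B T \<omega> + integral {0..T} (\<lambda>s. - \<sigma>' (M s \<omega>) / 2)"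
    using ito_formula_at countable_rat by (subst AE_ball_countable) auto
  moreover have "AE \<omega> in W. \<omega> \<in> space W" by simp
  ultimately show ?thesis
  proof eventually_elim
    case (elim \<omega>)
    show ?case
    proof
      fix T :: real assume T: "T \<in> {0..1}"
      let ?t = "\<lambda>k. real (nat \<lfloor>T * 2 ^ k\<rfloor>) / 2 ^ k"
      let ?f = "\<lambda>T. \<Lambda> x + B T \<omega> + integral {0..T} (\<lambda>s. - \<sigma>' (M s \<omega>) / 2)"
      have tT: "?t k \<in> {0..1}" for k using grid_in_unit[OF floor_grid(1)[OF T, of k]] by simp
      note comp = continuous_on_tendsto_compose[OF _ floor_grid_tendsto[OF T] T always_eventually[OF allI[OF tT]]]
      have "continuous_on {0..1} (\<lambda>T. integral {0..T} (\<lambda>s. - \<sigma>' (M s \<omega>) / 2))"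
        using continuous_on_compose2[OF \<sigma>'_continuous[of UNIV] M_continuous[OF elim(2)]]
        by (intro indefinite_integral_continuous_1 integrable_continuous_real continuous_intros) auto
      then have "(\<lambda>k. ?f (?t k)) \<longlonglongrightarrow> ?f T"
        by (intro comp continuous_on_add continuous_on_const B_continuous elim)
      moreover have "(\<lambda>k. \<Lambda> (M (?t k) \<omega>)) \<longlonglongrightarrow> \<Lambda> (M T \<omega>)"
        using continuous_on_compose2[OF \<Lambda>_continuous[of UNIV] M_continuous[OF elim(2)]] by (intro comp) auto
      moreover have "\<Lambda> (M (?t k) \<omega>) = ?f (?t k)" for k
        using elim(1) tT[of k] by auto
      ultimately show "\<Lambda> (M T \<omega>) = ?f T" using LIMSEQ_unique by auto
    qed
  qed
qed

text \<open>The comparison is with the quadratic variation of \<open>M\<close> under the weight 1 /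
  \<sigma>^2, whose limit is the integral of 1. The error on a cell is u^2 - v^2 = (u - v) (u + v),
  with u - v quadratic and u + v linear in the increment of \<open>M\<close>, so the cubic variation
  controls it.\<close>

lemma AE_transformed_quadratic_variation:
  "AE \<omega> in W. (\<lambda>k. \<Sum>l<2 ^ k. (\<Lambda> (M (real (Suc l) / 2 ^ k) \<omega>) - \<Lambda> (M (real l / 2 ^ k) \<omega>))\<^sup>2) \<longlonglongrightarrow> 1"
proof -
  have one: "(1::real) \<in> {0..1}" by simp
  have fl: "nat \<lfloor>(1::real) * 2 ^ k\<rfloor> = 2 ^ k" for k
    by (metis floor_of_nat mult_1 nat_int of_nat_numeral of_nat_power)
  have inv_sq: "\<bar>1 / (\<sigma> y)\<^sup>2\<bar> \<le> (1 / \<delta>)\<^sup>2" for y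
    using power_mono[OF inverse_\<sigma>_bound[of y], of 2] by (simp add: power_divide)
  have "AE \<omega> in W. (\<lambda>k. \<Sum>l<nat \<lfloor>(1::real) * 2 ^ k\<rfloor>. 1 / (\<sigma> (M (real l / 2 ^ k) \<omega>))\<^sup>2 * (M (real (Suc l) / 2 ^ k) \<omega> - M (real l / 2 ^ k) \<omega>)\<^sup>2)
    \<longlonglongrightarrow> integral {0..1} (\<lambda>s. 1 / (\<sigma> (M s \<omega>))\<^sup>2 * (\<sigma> (M s \<omega>))\<^sup>2)"
    using \<sigma>_nz inv_sq by (intro AE_quadratic_variation[OF _ _ one] continuous_intros \<sigma>_continuous) auto
  with AE_cubic_tendsto_zero[OF one] show ?thesis
  proof eventually_elim
    case (elim \<omega>)
    define m where "m k l = M (real l / 2 ^ k) \<omega>" for k l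
    let ?C = "L / \<delta>\<^sup>2 * (2 / \<delta>)"
    have lip: "\<bar>\<Lambda> y - \<Lambda> z\<bar> \<le> 1 / \<delta> * \<bar>y - z\<bar>" for y z
      using lipschitz_of_deriv_bound[OF \<Lambda>_deriv inverse_\<sigma>_bound] .
    have b: "\<bar>(\<Lambda> (m k (Suc l)) - \<Lambda> (m k l))\<^sup>2 - 1 / (\<sigma> (m k l))\<^sup>2 * (m k (Suc l) - m k l)\<^sup>2\<bar> \<le> ?C * \<bar>m k (Suc l) - m k l\<bar> ^ 3" for k l
    proof -
      let ?u = "\<Lambda> (m k (Suc l)) - \<Lambda> (m k l)" and ?v = "1 / \<sigma> (m k l) * (m k (Suc l) - m k l)"
      have "\<bar>?v\<bar> \<le> 1 / \<delta> * \<bar>m k (Suc l) - m k l\<bar>"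
        unfolding abs_mult using inverse_\<sigma>_bound by (intro mult_right_mono) auto
      then have "\<bar>?u + ?v\<bar> \<le> 2 / \<delta> * \<bar>m k (Suc l) - m k l\<bar>"
        using lip[of "m k (Suc l)" "m k l"] abs_triangle_ineq[of ?u ?v] by simp
      moreover have "\<bar>?u - ?v\<bar> \<le> L / \<delta>\<^sup>2 * (m k (Suc l) - m k l)\<^sup>2"
        using taylor2_bound[OF \<Lambda>_deriv inverse_\<sigma>_deriv \<Lambda>2_bound, of "m k l" "m k (Suc l) - m k l"] by simp
      ultimately have "\<bar>?u - ?v\<bar> * \<bar>?u + ?v\<bar> \<le> (L / \<delta>\<^sup>2 * (m k (Suc l) - m k l)\<^sup>2) * (2 / \<delta> * \<bar>m k (Suc l) - m k l\<bar>)"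
        using L_nonneg by (intro mult_mono) auto
      moreover have "?u\<^sup>2 - 1 / (\<sigma> (m k l))\<^sup>2 * (m k (Suc l) - m k l)\<^sup>2 = (?u - ?v) * (?u + ?v)"
        by (simp add: power2_eq_square algebra_simps)
      moreover have "(m k (Suc l) - m k l)\<^sup>2 * \<bar>m k (Suc l) - m k l\<bar> = \<bar>m k (Suc l) - m k l\<bar> ^ 3"
        by (simp add: power2_eq_square power3_eq_cube abs_mult_self_eq)
      ultimately show ?thesis by (simp add: abs_mult mult_ac)
    qed
    have "(\<lambda>k. (\<Sum>l<2 ^ k. (\<Lambda> (m k (Suc l)) - \<Lambda> (m k l))\<^sup>2) - (\<Sum>l<2 ^ k. 1 / (\<sigma> (m k l))\<^sup>2 * (m k (Suc l) - m k l)\<^sup>2)) \<longlonglongrightarrow> 0"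
    proof (rule Lim_null_comparison)
      show "(\<lambda>k. ?C * (\<Sum>l<2 ^ k. \<bar>m k (Suc l) - m k l\<bar> ^ 3)) \<longlonglongrightarrow> 0"
        using tendsto_mult_right_zero[OF elim(1)] unfolding m_def fl .
      show "\<forall>\<^sub>F k in sequentially. norm ((\<Sum>l<2 ^ k. (\<Lambda> (m k (Suc l)) - \<Lambda> (m k l))\<^sup>2) - (\<Sum>l<2 ^ k. 1 / (\<sigma> (m k l))\<^sup>2 * (m k (Suc l) - m k l)\<^sup>2))
          \<le> ?C * (\<Sum>l<2 ^ k. \<bar>m k (Suc l) - m k l\<bar> ^ 3)"
        unfolding sum_subtractf[symmetric] sum_distrib_left real_norm_def
        by (intro always_eventually allI order_trans[OF sum_abs] sum_mono b)
    qed
    moreover have "(\<lambda>k. \<Sum>l<2 ^ k. 1 / (\<sigma> (m k l))\<^sup>2 * (m k (Suc l) - m k l)\<^sup>2) \<longlonglongrightarrow> 1"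
      using elim(2) \<sigma>_nz unfolding fl m_def by simp
    ultimately have "(\<lambda>k. \<Sum>l<2 ^ k. (\<Lambda> (m k (Suc l)) - \<Lambda> (m k l))\<^sup>2) \<longlonglongrightarrow> 0 + 1"
      using tendsto_add by fastforce
    then show ?case by (simp add: m_def)
  qed
qed

end

section \<open>Comparison of Markov chains driven by Brownian increments\<close>

text \<open>The Euler scheme, the scaled random walk and the two chains behind the explicit
  likelihood are all instances, with Brownian increments as input \<open>d\<close>; one comparison
  result then serves them all.\<close>

primrec chain :: "('s \<Rightarrow> 'd \<Rightarrow> 's) \<Rightarrow> 's \<Rightarrow> (nat \<Rightarrow> 'd) \<Rightarrow> nat \<Rightarrow> 's" where
  "chain a s d 0 = s"
| "chain a s d (Suc l) = a (chain a s d l) (d l)"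

text \<open>For additive noise the convergence is pathwise: with \<open>w\<close> fixed the integral
  equation is deterministic, and \<open>discrete_gronwall\<close> controls the error.\<close>

lemma euler_scheme_converges:
  fixes u w b :: "real \<Rightarrow> real"
  assumes u: "continuous_on {0..1} u"
    and eq: "\<And>t. t \<in> {0..1} \<Longrightarrow> u t = u0 + w t + integral {0..t} (\<lambda>s. b (u s))"
    and w0: "w 0 = 0"
    and b: "\<And>y z. \<bar>b y - b z\<bar> \<le> C * \<bar>y - z\<bar>" "continuous_on UNIV b"
    and "0 < e"
  shows "\<exists>K. \<forall>k\<ge>K. \<forall>l\<le>2 ^ k. \<bar>u (real l / 2 ^ k)
    - chain (\<lambda>v z. v + z + b v * (1 / 2) ^ k) u0 (\<lambda>l. w (real (Suc l) / 2 ^ k) - w (real l / 2 ^ k)) l\<bar> \<le> e"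
proof -
  have C: "0 \<le> C" using b(1)[of 1 0] by simp
  \<comment> \<open>Cancels the Gronwall factor: (1 + C h)^l <= exp (C l h) <= exp C.\<close>
  define e' where "e' = e / exp C"
  have e': "0 < e'" using \<open>0 < e\<close> by (simp add: e'_def)
  from uniform_grid_modulus[OF u this] obtain K where K: "\<And>k s t. k \<ge> K \<Longrightarrow> s \<in> {0..1} \<Longrightarrow> t \<in> {0..1} \<Longrightarrow> \<bar>s - t\<bar> \<le> 1 / 2 ^ k
      \<Longrightarrow> \<bar>u s - u t\<bar> < e'" by blast
  have bu: "continuous_on {0..1} (\<lambda>s. b (u s))"
    using continuous_on_compose2[OF b(2) u] by simp
  show ?thesis
  proof (intro exI allI impI)
    fix k l assume k: "K \<le> k" and "l \<le> (2::nat) ^ k"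
    define h :: real where "h = (1 / 2) ^ k"
    define V where "V = chain (\<lambda>v z. v + z + b v * (1 / 2) ^ k) u0 (\<lambda>l. w (real (Suc l) / 2 ^ k) - w (real l / 2 ^ k))"
    define E where "E l = \<bar>u (real l / 2 ^ k) - V l\<bar>" for l
    have h: "0 < h" by (simp add: h_def)
    have "E l \<le> ((1 + C * h) ^ l - 1) * e'"
    proof (rule discrete_gronwall[where N = "2 ^ k"])
      show "E 0 = 0" using eq[of 0] w0 by (simp add: E_def V_def)
      fix l assume l: "l < (2::nat) ^ k"
      let ?s = "real l / 2 ^ k" and ?t = "real (Suc l) / 2 ^ k"
      have st: "0 \<le> ?s" "?s \<le> ?t" "?t \<le> 1" "?t - ?s = h"
        using grid_in_unit[of "Suc l" "2 ^ k"] l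
        by (auto simp: divide_right_mono diff_divide_distrib[symmetric] power_one_over h_def)
      have int: "(\<lambda>s. b (u s)) integrable_on {0..?t}"
        using st by (intro integrable_continuous_real continuous_on_subset[OF bu]) auto
      have "integral {0..?s} (\<lambda>s. b (u s)) + integral {?s..?t} (\<lambda>s. b (u s)) = integral {0..?t} (\<lambda>s. b (u s))"
        using st int by (intro Henstock_Kurzweil_Integration.integral_combine)
      then have inc: "u ?t - u ?s = w ?t - w ?s + integral {?s..?t} (\<lambda>s. b (u s))"
      proof -
        have "?s \<in> {0..1}" "?t \<in> {0..1}" using st unfolding atLeastAtMost_iff by linarith+
        then have "u ?s = u0 + w ?s + integral {0..?s} (\<lambda>s. b (u s))" "u ?t = u0 + w ?t + integral {0..?t} (\<lambda>s. b (u s))"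
          by (blast intro: eq)+
        with \<open>_ + _ = integral {0..?t} _\<close> show ?thesis by linarith
      qed
      \<comment> \<open>Within the cell \<open>u\<close> moves by less than \<open>e'\<close>, and
        at its left end it differs from the scheme by \<open>E l\<close>; this is the Gronwall step
        with factor C h and defect \<open>e'\<close>.\<close>
      have "\<bar>integral {?s..?t} (\<lambda>s. b (u s)) - b (V l) * (?t - ?s)\<bar> \<le> C * (e' + E l) * (?t - ?s)"
      proof (rule integral_minus_const_bound)
        show "continuous_on {?s..?t} (\<lambda>s. b (u s))" using st by (intro continuous_on_subset[OF bu]) auto
        fix r assume r: "r \<in> {?s..?t}"
        have "\<bar>r - ?s\<bar> \<le> 1 / 2 ^ k" using r st unfolding h_def by (auto simp: power_one_over)
        moreover have "r \<in> {0..1}" "?s \<in> {0..1}" using r st unfolding atLeastAtMost_iff by linarith+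
        ultimately have "\<bar>u r - u ?s\<bar> < e'" using K[OF k] by blast
        then have "\<bar>u r - V l\<bar> \<le> e' + E l" unfolding E_def by linarith
        then show "\<bar>b (u r) - b (V l)\<bar> \<le> C * (e' + E l)"
          using b(1)[of "u r" "V l"] C by (meson mult_left_mono order_trans)
      qed (use st in auto)
      then have *: "\<bar>integral {?s..?t} (\<lambda>s. b (u s)) - b (V l) * h\<bar> \<le> C * (e' + E l) * h" using st by simp
      have "E (Suc l) = \<bar>(u ?s - V l) + (integral {?s..?t} (\<lambda>s. b (u s)) - b (V l) * h)\<bar>"
        unfolding E_def V_def chain.simps V_def[symmetric] h_def[symmetric] using inc
        by (intro arg_cong[where f = abs]) linarith
      also have "\<dots> \<le> E l + C * (e' + E l) * h"
        using * unfolding E_def by linarith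
      also have "\<dots> = (1 + C * h) * E l + C * h * e'" by (simp add: algebra_simps)
      finally show "E (Suc l) \<le> (1 + C * h) * E l + C * h * e'" .
    qed (use C h \<open>l \<le> 2 ^ k\<close> in auto)
    also have "\<dots> \<le> exp C * e'"
    proof (rule mult_right_mono)
      have "(1 + C * h) ^ l \<le> exp (C * h) ^ l" using C h by (intro power_mono) auto
      also have "\<dots> = exp (C * (real l * h))" by (simp add: exp_of_nat_mult[symmetric] mult_ac)
      also have "real l * h \<le> 1"
        using \<open>l \<le> 2 ^ k\<close> grid_in_unit[of l "2 ^ k"] by (simp add: h_def power_one_over)
      then have "exp (C * (real l * h)) \<le> exp C" using C by (simp add: mult_left_le)
      finally show "(1 + C * h) ^ l - 1 \<le> exp C" by simp
    qed (use e' in simp)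
    also have "\<dots> = e" by (simp add: e'_def)
    finally show "\<bar>u (real l / 2 ^ k) - chain (\<lambda>v z. v + z + b v * (1 / 2) ^ k) u0 (\<lambda>l. w (real (Suc l) / 2 ^ k) - w (real l / 2 ^ k)) l\<bar> \<le> e"
      by (simp add: E_def V_def)
  qed
qed

text \<open>Substitution on bounded intervals, extended by exhausting the line. Both integrals are
  read as measures given by densities, so that the limit is continuity from below.\<close>

lemma nn_integral_whole_line_substitution:
  fixes f :: "real \<Rightarrow> ennreal" and \<Lambda> s :: "real \<Rightarrow> real"
  assumes [measurable]: "f \<in> borel_measurable borel"
    and deriv: "\<And>y. (\<Lambda> has_real_derivative s y) (at y)"
    and s: "continuous_on UNIV s" "\<And>y. 0 < s y"
    and surj: "\<And>z. \<exists>y. \<Lambda> y = z"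
  shows "(\<integral>\<^sup>+x. f x \<partial>lborel) = (\<integral>\<^sup>+y. f (\<Lambda> y) * ennreal (s y) \<partial>lborel)"
proof -
  have [measurable]: "s \<in> borel_measurable borel" using s(1) by (rule borel_measurable_continuous_onI)
  have "continuous_on UNIV \<Lambda>" using deriv by (rule continuous_on_of_deriv)
  then have [measurable]: "\<Lambda> \<in> borel_measurable borel" by (rule borel_measurable_continuous_onI)
  have mono: "\<Lambda> y \<le> \<Lambda> z" if "y \<le> z" for y z
  proof (rule DERIV_nonneg_imp_nondecreasing[OF that])
    fix v
    show "\<exists>d. (\<Lambda> has_real_derivative d) (at v) \<and> 0 \<le> d"
      using deriv[of v] s(2)[of v] by (intro exI[of _ "s v"]) auto
  qed
  \<comment> \<open>The shift by 1 keeps the interval for n = 0 nondegenerate.\<close>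
  let ?A = "\<lambda>n::nat. {\<Lambda> (- real n - 1)..\<Lambda> (real n + 1)}" and ?B = "\<lambda>n::nat. {- real n - 1..real n + 1}"
  have UA: "(\<Union>n. ?A n) = UNIV"
  proof (intro equalityI subsetI UNIV_I)
    fix z :: real
    obtain y where y: "\<Lambda> y = z" using surj by blast
    obtain n :: nat where "\<bar>y\<bar> \<le> real n" using real_arch_simple by blast
    then have "z \<in> ?A n" using mono[of "- real n - 1" y] mono[of y "real n + 1"] y by auto
    then show "z \<in> (\<Union>n. ?A n)" by blast
  qed
  have UB: "(\<Union>n. ?B n) = UNIV"
  proof (intro equalityI subsetI UNIV_I)
    fix y :: real
    obtain n :: nat where "\<bar>y\<bar> \<le> real n" using real_arch_simple by blast
    then have "y \<in> ?B n" by auto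
    then show "y \<in> (\<Union>n. ?B n)" by blast
  qed
  let ?M = "density lborel f" and ?N = "density lborel (\<lambda>y. f (\<Lambda> y) * ennreal (s y))"
  have "(\<integral>\<^sup>+x. f x \<partial>lborel) = emeasure ?M UNIV" by (simp add: emeasure_density)
  also have "\<dots> = (SUP n. emeasure ?M (?A n))"
    unfolding UA[symmetric]
  proof (rule SUP_emeasure_incseq[symmetric])
    show "incseq ?A" by (intro incseq_SucI) (auto intro: order_trans[OF mono] order_trans[OF _ mono])
  qed auto
  also have "\<dots> = (SUP n. emeasure ?N (?B n))"
  proof (intro SUP_cong refl)
    fix n :: nat
    have "(\<integral>\<^sup>+x. f x * indicator (?A n) x \<partial>lborel) = (\<integral>\<^sup>+x. f (\<Lambda> x) * ennreal (s x) * indicator (?B n) x \<partial>lborel)"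
      using s by (intro nn_integral_substitution_aux deriv continuous_on_subset[OF s(1)]) (auto intro: less_imp_le)
    then show "emeasure ?M (?A n) = emeasure ?N (?B n)" by (simp add: emeasure_density)
  qed
  also have "\<dots> = emeasure ?N (\<Union>n. ?B n)"
    by (intro SUP_emeasure_incseq) (auto intro!: incseq_SucI)
  also have "\<dots> = (\<integral>\<^sup>+y. f (\<Lambda> y) * ennreal (s y) \<partial>lborel)" unfolding UB by (simp add: emeasure_density)
  finally show ?thesis .
qed

section \<open>One-step comparison of Gaussian transitions\<close>

abbreviation gauss :: "real \<Rightarrow> real \<Rightarrow> real" where
  "gauss h \<equiv> normal_density 0 (sqrt h)"

text \<open>Expanding the square, the shift contributes b y - b^2 h / 2 to the exponent. The last
  term is dropped, and b y is at most d + C y^2 / 2, whose square turns y^2 / (2 h) into (1 - C h)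
  y^2 / (2 h), a Gaussian exponent of larger variance when C > 0.\<close>

lemma gauss_shift_le:
  assumes "0 < h" "C * h < 1" "b * y - C / 2 * y\<^sup>2 \<le> d"
  shows "gauss h (y - b * h) \<le> gauss h (y * sqrt (1 - C * h)) * exp d"
proof -
  have "- (y - b * h)\<^sup>2 / (2 * h) \<le> - (y * sqrt (1 - C * h))\<^sup>2 / (2 * h) + (b * y - C / 2 * y\<^sup>2)"
  proof -
    have "(y - b * h)\<^sup>2 / (2 * h) = y\<^sup>2 / (2 * h) - b * y + b\<^sup>2 * h / 2"
      using assms(1) by (simp add: power2_eq_square field_simps)
    moreover have "(y * sqrt (1 - C * h))\<^sup>2 / (2 * h) = y\<^sup>2 / (2 * h) - C / 2 * y\<^sup>2"
      using assms(1,2) by (simp add: power_mult_distrib power2_eq_square field_simps)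
    moreover have "0 \<le> b\<^sup>2 * h / 2" using assms(1) by simp
    ultimately show ?thesis unfolding minus_divide_left[symmetric] by linarith
  qed
  also have "\<dots> \<le> - (y * sqrt (1 - C * h))\<^sup>2 / (2 * h) + d" using assms(3) by simp
  finally show ?thesis using assms(1)
    by (simp add: normal_density_def exp_add[symmetric] divide_right_mono)
qed

text \<open>
  One Euler step against one Gaussian step of the slightly larger variance \<open>h / (1 - C h)\<close>. The
  Girsanov exponent \<open>b (v - u) - b^2 h / 2\<close> is at most \<open>\<beta> v - \<beta> u + C (v - u)^2 / 2\<close>, where the
  first difference telescopes along the chain and the square is absorbed by the variance.
\<close>

lemma euler_step_le:
  fixes \<beta> b b1 :: "real \<Rightarrow> real" and g :: "real \<Rightarrow> ennreal"
  assumes \<beta>: "\<And>y. (\<beta> has_real_derivative b y) (at y)"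
    and b1: "\<And>y. (b has_real_derivative b1 y) (at y)" "\<And>y. \<bar>b1 y\<bar> \<le> C / 2"
    and h: "0 < h" "C * h < 1" and [measurable]: "g \<in> borel_measurable borel"
  defines "r \<equiv> 1 / sqrt (1 - C * h)"
  shows "(\<integral>\<^sup>+z. ennreal (gauss h z) * g (u + z + b u * h) \<partial>lborel)
    \<le> (\<integral>\<^sup>+z. ennreal (gauss h z) * (g (u + r * z) * ennreal (r * exp (\<beta> (u + r * z) - \<beta> u))) \<partial>lborel)"
proof -
  have r: "0 < r" "1 / r = sqrt (1 - C * h)" using h by (auto simp: r_def)
  have [measurable]: "\<beta> \<in> borel_measurable borel"
    using continuous_on_of_deriv[OF \<beta>] by (rule borel_measurable_continuous_onI)
  have "(\<integral>\<^sup>+z. ennreal (gauss h z) * g (u + z + b u * h) \<partial>lborel)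
      = (\<integral>\<^sup>+y. ennreal (gauss h (y - b u * h)) * g (u + y) \<partial>lborel)"
    by (subst nn_integral_real_affine[where t = "- b u * h" and c = 1]) (auto simp: add.commute)
  also have "\<dots> \<le> (\<integral>\<^sup>+y. ennreal (gauss h (y / r) * exp (\<beta> (u + y) - \<beta> u)) * g (u + y) \<partial>lborel)"
  proof (intro nn_integral_mono mult_right_mono ennreal_leI)
    fix y
    \<comment> \<open>The derivative of b is bounded by C / 2 and \<open>taylor2_bound\<close> keeps
      the full constant, which gives exactly the quadratic term that \<open>gauss_shift_le\<close>
      absorbs.\<close>
    have "b u * y - C / 2 * y\<^sup>2 \<le> \<beta> (u + y) - \<beta> u"
      using taylor2_bound[OF \<beta> b1, of u y] by linarith
    then show "gauss h (y - b u * h) \<le> gauss h (y / r) * exp (\<beta> (u + y) - \<beta> u)"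
      using gauss_shift_le[OF h] r(2) by (metis mult.right_neutral times_divide_eq_right)
  qed auto
  \<comment> \<open>The rescaling y = r z restores the variance \<open>h\<close>; its Jacobian is
    the factor \<open>r\<close> that remains in every step.\<close>
  also have "\<dots> = ennreal r * (\<integral>\<^sup>+z. ennreal (gauss h z * exp (\<beta> (u + r * z) - \<beta> u)) * g (u + r * z) \<partial>lborel)"
    using r(1) by (subst nn_integral_real_affine[where t = 0 and c = r]) auto
  also have "\<dots> = (\<integral>\<^sup>+z. ennreal (gauss h z) * (g (u + r * z) * ennreal (r * exp (\<beta> (u + r * z) - \<beta> u))) \<partial>lborel)"
    using r(1) by (subst nn_integral_cmult[symmetric]) (auto simp: ennreal_mult mult_ac normal_density_nonneg)
  finally show ?thesis .
qed

text \<open>\<psi> y v is the ratio at v of the transition densities of G (\<Lambda> y + Z) and y +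
  Z, where Z is centred Gaussian with variance h. The second identity is the first one applied to g
  / \<psi>.\<close>

lemma gauss_change_of_variables:
  fixes \<Lambda> s G :: "real \<Rightarrow> real" and g :: "real \<Rightarrow> ennreal"
  assumes \<Lambda>: "\<And>y. (\<Lambda> has_real_derivative s y) (at y)" "continuous_on UNIV s" "\<And>y. 0 < s y"
    and G: "\<And>z. \<Lambda> (G z) = z" "\<And>y. G (\<Lambda> y) = y" and [measurable]: "G \<in> borel_measurable borel"
    and [measurable]: "g \<in> borel_measurable borel" and h: "0 < h"
  defines "\<psi> \<equiv> \<lambda>y v. gauss h (\<Lambda> v - \<Lambda> y) * s v / gauss h (v - y)"
  shows "(\<integral>\<^sup>+z. ennreal (gauss h z) * g (G (\<Lambda> y + z)) \<partial>lborel)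
      = (\<integral>\<^sup>+z. ennreal (gauss h z) * (g (y + z) * ennreal (\<psi> y (y + z))) \<partial>lborel)"
    "(\<integral>\<^sup>+z. ennreal (gauss h z) * g (y + z) \<partial>lborel)
      = (\<integral>\<^sup>+z. ennreal (gauss h z) * (g (G (\<Lambda> y + z)) * ennreal (1 / \<psi> y (G (\<Lambda> y + z)))) \<partial>lborel)"
proof -
  have [measurable]: "s \<in> borel_measurable borel" using \<Lambda>(2) by (rule borel_measurable_continuous_onI)
  have [measurable]: "\<Lambda> \<in> borel_measurable borel"
    using continuous_on_of_deriv[OF \<Lambda>(1)] by (rule borel_measurable_continuous_onI)
  have pos: "0 < gauss h z" for z using h by (simp add: normal_density_pos)
  have \<psi>_pos: "0 < \<psi> y v" for y v using pos \<Lambda>(3) by (simp add: \<psi>_def)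
  have eq1: "(\<integral>\<^sup>+z. ennreal (gauss h z) * g (G (\<Lambda> y + z)) \<partial>lborel)
      = (\<integral>\<^sup>+z. ennreal (gauss h z) * (g (y + z) * ennreal (\<psi> y (y + z))) \<partial>lborel)"
    if [measurable]: "g \<in> borel_measurable borel" for g :: "real \<Rightarrow> ennreal"
  proof -
    have "(\<integral>\<^sup>+z. ennreal (gauss h z) * g (G (\<Lambda> y + z)) \<partial>lborel)
        = (\<integral>\<^sup>+z. ennreal (gauss h (z - \<Lambda> y)) * g (G z) \<partial>lborel)"
      by (subst nn_integral_real_affine[where t = "- \<Lambda> y" and c = 1]) (auto simp: add.commute)
    also have "\<dots> = (\<integral>\<^sup>+v. ennreal (gauss h (\<Lambda> v - \<Lambda> y)) * g (G (\<Lambda> v)) * ennreal (s v) \<partial>lborel)"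
      using G(1) by (intro nn_integral_whole_line_substitution \<Lambda>) auto
    also have "\<dots> = (\<integral>\<^sup>+z. ennreal (gauss h (\<Lambda> (y + z) - \<Lambda> y)) * g (G (\<Lambda> (y + z))) * ennreal (s (y + z)) \<partial>lborel)"
      by (subst nn_integral_real_affine[where t = y and c = 1]) auto
    also have "\<dots> = (\<integral>\<^sup>+z. ennreal (gauss h z) * (g (y + z) * ennreal (\<psi> y (y + z))) \<partial>lborel)"
    proof (intro nn_integral_cong)
      fix z
      have "gauss h (\<Lambda> (y + z) - \<Lambda> y) * s (y + z) = gauss h z * \<psi> y (y + z)"
        using pos[of z] by (simp add: \<psi>_def)
      then have "ennreal (gauss h (\<Lambda> (y + z) - \<Lambda> y)) * ennreal (s (y + z)) = ennreal (gauss h z) * ennreal (\<psi> y (y + z))"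
        using pos \<Lambda>(3) \<psi>_pos by (simp add: ennreal_mult[symmetric] less_imp_le)
      then show "ennreal (gauss h (\<Lambda> (y + z) - \<Lambda> y)) * g (G (\<Lambda> (y + z))) * ennreal (s (y + z))
          = ennreal (gauss h z) * (g (y + z) * ennreal (\<psi> y (y + z)))"
        by (simp add: G(2) mult_ac)
    qed
    finally show ?thesis .
  qed
  then show "(\<integral>\<^sup>+z. ennreal (gauss h z) * g (G (\<Lambda> y + z)) \<partial>lborel)
      = (\<integral>\<^sup>+z. ennreal (gauss h z) * (g (y + z) * ennreal (\<psi> y (y + z))) \<partial>lborel)" by simp
  have "(\<integral>\<^sup>+z. ennreal (gauss h z) * (g (G (\<Lambda> y + z)) * ennreal (1 / \<psi> y (G (\<Lambda> y + z)))) \<partial>lborel)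
      = (\<integral>\<^sup>+z. ennreal (gauss h z) * ((g (y + z) * ennreal (1 / \<psi> y (y + z))) * ennreal (\<psi> y (y + z))) \<partial>lborel)"
    by (rule eq1[of "\<lambda>v. g v * ennreal (1 / \<psi> y v)"]) (simp add: \<psi>_def)
  also have "\<dots> = (\<integral>\<^sup>+z. ennreal (gauss h z) * g (y + z) \<partial>lborel)"
    using \<psi>_pos[of y] by (intro nn_integral_cong) (simp add: mult.assoc ennreal_mult[symmetric] less_imp_le less_imp_neq[symmetric])
  finally show "(\<integral>\<^sup>+z. ennreal (gauss h z) * g (y + z) \<partial>lborel)
      = (\<integral>\<^sup>+z. ennreal (gauss h z) * (g (G (\<Lambda> y + z)) * ennreal (1 / \<psi> y (G (\<Lambda> y + z)))) \<partial>lborel)" by simp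
qed

text \<open>The path stopped after \<open>N\<close> steps, kept as an infinite sequence:
  \<open>seq_borel\<close> then serves for every \<open>N\<close>, and the induction over steps does
  not change the space.\<close>

definition frozen_path :: "nat \<Rightarrow> (nat \<Rightarrow> real) \<Rightarrow> nat \<Rightarrow> real" where
  "frozen_path N p i = p (min i N)"

abbreviation seq_borel :: "(nat \<Rightarrow> real) measure" where
  "seq_borel \<equiv> Pi\<^sub>M UNIV (\<lambda>_. borel)"

section \<open>From one step to whole chains\<close>

context brownian_setup
begin

definition dB :: "nat \<Rightarrow> 'a \<Rightarrow> nat \<Rightarrow> real" where
  "dB k \<omega> l = B (real (Suc l) / 2 ^ k) \<omega> - B (real l / 2 ^ k) \<omega>"

lemma chain_measurable:
  assumes a: "(\<lambda>(y, z). a y z) \<in> borel_measurable (borel \<Otimes>\<^sub>M borel)" and "l \<le> 2 ^ k"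
  shows "(\<lambda>\<omega>. chain a y0 (dB k \<omega>) l :: real) \<in> borel_measurable (F (real l / 2 ^ k))"
  using \<open>l \<le> 2 ^ k\<close>
proof (induction l)
  case (Suc l)
  have st: "0 \<le> real l / 2 ^ k" "real l / 2 ^ k \<le> real (Suc l) / 2 ^ k" "real (Suc l) / 2 ^ k \<le> 1"
    using grid_in_unit[of "Suc l" "2 ^ k"] Suc.prems by (auto simp: divide_right_mono)
  have [measurable]: "(\<lambda>\<omega>. chain a y0 (dB k \<omega>) l) \<in> borel_measurable (F (real (Suc l) / 2 ^ k))"
    using meas_mono[OF _ st] Suc by simp
  have [measurable]: "(\<lambda>\<omega>. dB k \<omega> l) \<in> borel_measurable (F (real (Suc l) / 2 ^ k))"
    using dB_measurable[OF st] by (simp add: dB_def)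
  have "(\<lambda>\<omega>. (\<lambda>(y, z). a y z) (chain a y0 (dB k \<omega>) l, dB k \<omega> l)) \<in> borel_measurable (F (real (Suc l) / 2 ^ k))"
    by (rule measurable_compose[OF _ a]) measurable
  then show ?case by simp
qed simp

lemma frozen_chain_measurable:
  assumes a: "(\<lambda>(y, z). a y z) \<in> borel_measurable (borel \<Otimes>\<^sub>M borel)" and N: "N \<le> 2 ^ k"
  shows "(\<lambda>\<omega>. frozen_path N (chain a y0 (dB k \<omega>))) \<in> measurable (F (real N / 2 ^ k)) seq_borel"
proof (rule measurable_PiM_single')
  fix i
  have i: "min i N \<le> 2 ^ k" "real (min i N) / 2 ^ k \<le> real N / 2 ^ k" "real N / 2 ^ k \<le> 1" "0 \<le> real (min i N) / 2 ^ k"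
    using N grid_in_unit[OF N] by (auto simp: divide_right_mono)
  show "(\<lambda>\<omega>. frozen_path N (chain a y0 (dB k \<omega>)) i) \<in> borel_measurable (F (real N / 2 ^ k))"
    unfolding frozen_path_def by (rule meas_mono[OF chain_measurable[OF a i(1)] i(4,2,3)])
qed auto

text \<open>The last step of the first chain is frozen and replaced by means of \<open>step\<close>;
  what results is a functional of the earlier steps, to which the induction hypothesis applies. An
  inequality in \<open>step\<close> covers both the Euler scheme and the exact changes of
  variables.\<close>

lemma chain_comparison:
  fixes \<psi> :: "real \<Rightarrow> real \<Rightarrow> ennreal"
  assumes a1: "(\<lambda>(y, z). a1 y z) \<in> borel_measurable (borel \<Otimes>\<^sub>M borel)"
    and a2: "(\<lambda>(y, z). a2 y z) \<in> borel_measurable (borel \<Otimes>\<^sub>M borel)"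
    and \<psi>: "(\<lambda>(y, z). \<psi> y z) \<in> borel_measurable (borel \<Otimes>\<^sub>M borel)"
    and step: "\<And>y g. g \<in> borel_measurable borel \<Longrightarrow>
      (\<integral>\<^sup>+z. ennreal (gauss ((1 / 2) ^ k) z) * g (a1 y z) \<partial>lborel)
        \<le> (\<integral>\<^sup>+z. ennreal (gauss ((1 / 2) ^ k) z) * (g (a2 y z) * \<psi> y (a2 y z)) \<partial>lborel)"
    and "N \<le> 2 ^ k" and "\<Phi> \<in> borel_measurable seq_borel"
  shows "(\<integral>\<^sup>+\<omega>. \<Phi> (frozen_path N (chain a1 y0 (dB k \<omega>))) \<partial>W)
    \<le> (\<integral>\<^sup>+\<omega>. \<Phi> (frozen_path N (chain a2 y0 (dB k \<omega>))) *
        (\<Prod>l<N. \<psi> (chain a2 y0 (dB k \<omega>) l) (chain a2 y0 (dB k \<omega>) (Suc l))) \<partial>W)"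
  using \<open>N \<le> 2 ^ k\<close> \<open>\<Phi> \<in> borel_measurable seq_borel\<close>
proof (induction N arbitrary: \<Phi>)
  case 0
  then show ?case by (simp add: frozen_path_def)
next
  case (Suc N)
  note \<Phi> [measurable] = Suc.prems(2)
  note [measurable (raw)] = measurable_compose[OF measurable_Pair a1, simplified]
    measurable_compose[OF measurable_Pair a2, simplified] measurable_compose[OF measurable_Pair \<psi>, simplified]
  have st: "0 \<le> real N / 2 ^ k" "real N / 2 ^ k < real (Suc N) / 2 ^ k" "real (Suc N) / 2 ^ k \<le> 1"
    "real (Suc N) / 2 ^ k - real N / 2 ^ k = (1 / 2) ^ k"
    using grid_in_unit[of "Suc N" "2 ^ k"] Suc.prems(1)
    by (auto simp: divide_strict_right_mono diff_divide_distrib[symmetric] power_one_over)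
  have N: "N \<le> 2 ^ k" using Suc.prems by simp
  \<comment> \<open>\<open>ext p y\<close> continues the path \<open>p\<close> after index N by the
    constant \<open>y\<close>, so the path stopped one step later is an \<open>ext\<close> of the
    path stopped at N.\<close>
  define ext where "ext p y = (\<lambda>i. if i \<le> N then p i else y)" for p :: "nat \<Rightarrow> real" and y :: real
  define \<gamma> where "\<gamma> z = ennreal (gauss ((1 / 2) ^ k) z)" for z
  have [measurable]: "\<gamma> \<in> borel_measurable borel" unfolding \<gamma>_def by measurable
  have ext: "(\<lambda>x. ext (f x) (g x)) \<in> measurable X seq_borel"
    if [measurable]: "f \<in> measurable X seq_borel" "g \<in> borel_measurable X" for f g and X :: "'x measure"
  proof (rule measurable_PiM_single')
    fix i
    have "(\<lambda>x. f x i) \<in> borel_measurable X" by measurable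
    then show "(\<lambda>x. ext (f x) (g x) i) \<in> borel_measurable X" by (simp add: ext_def)
  qed auto
  note [measurable] = ext
  have fp: "frozen_path (Suc N) (chain a y0 d) = ext (frozen_path N (chain a y0 d)) (a (frozen_path N (chain a y0 d) N) (d N))" for a d
    by (auto simp: fun_eq_iff frozen_path_def ext_def min_def le_Suc_eq)
  \<comment> \<open>The last step integrated out along the second chain; a functional of the first N
    steps only.\<close>
  define \<Phi>2 where "\<Phi>2 p = (\<integral>\<^sup>+z. \<gamma> z * (\<Phi> (ext p (a2 (p N) z)) * \<psi> (p N) (a2 (p N) z)) \<partial>lborel)" for p
  have m1: "(\<lambda>q. \<Phi> (ext (fst q) (a1 (fst q N) (snd q)))) \<in> borel_measurable (seq_borel \<Otimes>\<^sub>M borel)" by measurable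
  have m2: "(\<lambda>q. \<Phi> (ext (fst q) (a2 (fst q N) (snd q))) * \<psi> (fst q N) (a2 (fst q N) (snd q))) \<in> borel_measurable (seq_borel \<Otimes>\<^sub>M borel)" by measurable
  have m2': "(\<lambda>q. \<gamma> (snd q) * (\<Phi> (ext (fst q) (a2 (fst q N) (snd q))) * \<psi> (fst q N) (a2 (fst q N) (snd q)))) \<in> borel_measurable (seq_borel \<Otimes>\<^sub>M lborel)" by measurable
  have [measurable]: "\<Phi>2 \<in> borel_measurable seq_borel"
    using lborel.borel_measurable_nn_integral_fst[OF m2'] by (simp add: \<Phi>2_def[abs_def])
  have m3 [measurable]: "(\<lambda>z. \<gamma> z * (\<Phi> (ext p (a2 (p N) z)) * \<psi> (p N) (a2 (p N) z))) \<in> borel_measurable borel" for p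
    using measurable_Pair2[OF m2', of p] by (simp add: space_PiM)
  define R where "R p = (\<Prod>l<N. \<psi> (p l) (p (Suc l)))" for p :: "nat \<Rightarrow> real"
  have [measurable]: "R \<in> borel_measurable seq_borel" unfolding R_def by measurable
  have R_eq: "R (frozen_path N p) = (\<Prod>l<N. \<psi> (p l) (p (Suc l)))" for p
    by (auto simp: R_def frozen_path_def min_def intro!: prod.cong)
  have "(\<integral>\<^sup>+\<omega>. \<Phi> (frozen_path (Suc N) (chain a1 y0 (dB k \<omega>))) \<partial>W)
      = (\<integral>\<^sup>+\<omega>. (\<integral>\<^sup>+z. \<gamma> z * \<Phi> (ext (frozen_path N (chain a1 y0 (dB k \<omega>))) (a1 (frozen_path N (chain a1 y0 (dB k \<omega>)) N) z)) \<partial>lborel) \<partial>W)"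
    using dB_freeze[OF st(1,2,3) frozen_chain_measurable[OF a1 N] m1, of y0]
    unfolding fp st(4) by (simp add: dB_def \<gamma>_def)
  also have "\<dots> \<le> (\<integral>\<^sup>+\<omega>. \<Phi>2 (frozen_path N (chain a1 y0 (dB k \<omega>))) \<partial>W)"
  proof (rule nn_integral_mono)
    fix \<omega>
    have [measurable]: "(\<lambda>y. \<Phi> (ext p y)) \<in> borel_measurable borel" for p
      by (rule measurable_compose[OF ext \<Phi>]) (auto simp: space_PiM)
    show "(\<integral>\<^sup>+z. \<gamma> z * \<Phi> (ext (frozen_path N (chain a1 y0 (dB k \<omega>))) (a1 (frozen_path N (chain a1 y0 (dB k \<omega>)) N) z)) \<partial>lborel)
        \<le> \<Phi>2 (frozen_path N (chain a1 y0 (dB k \<omega>)))"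
      unfolding \<Phi>2_def \<gamma>_def by (rule step) measurable
  qed
  also have "\<dots> \<le> (\<integral>\<^sup>+\<omega>. \<Phi>2 (frozen_path N (chain a2 y0 (dB k \<omega>))) * R (frozen_path N (chain a2 y0 (dB k \<omega>))) \<partial>W)"
    unfolding R_eq by (intro Suc.IH N) measurable
  also have "\<dots> = (\<integral>\<^sup>+\<omega>. (\<integral>\<^sup>+z. \<gamma> z * (\<Phi> (ext (frozen_path N (chain a2 y0 (dB k \<omega>))) (a2 (frozen_path N (chain a2 y0 (dB k \<omega>)) N) z))
      * \<psi> (frozen_path N (chain a2 y0 (dB k \<omega>)) N) (a2 (frozen_path N (chain a2 y0 (dB k \<omega>)) N) z)
      * R (frozen_path N (chain a2 y0 (dB k \<omega>)))) \<partial>lborel) \<partial>W)"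
    unfolding \<Phi>2_def by (subst nn_integral_multc[symmetric]) (auto simp: mult.assoc intro!: nn_integral_cong)
  \<comment> \<open>The freezing is undone for the second chain, with the weight \<open>R\<close> of
    the earlier steps treated as part of the past.\<close>
  also have "\<dots> = (\<integral>\<^sup>+\<omega>. \<Phi> (frozen_path (Suc N) (chain a2 y0 (dB k \<omega>))) *
        (\<psi> (frozen_path N (chain a2 y0 (dB k \<omega>)) N) (a2 (frozen_path N (chain a2 y0 (dB k \<omega>)) N) (dB k \<omega> N)) * R (frozen_path N (chain a2 y0 (dB k \<omega>)))) \<partial>W)"
    using dB_freeze[OF st(1,2,3) frozen_chain_measurable[OF a2 N] borel_measurable_times_ennreal[OF m2 measurable_compose[OF measurable_fst \<open>R \<in> borel_measurable seq_borel\<close>]], of y0]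
    unfolding fp st(4) by (simp add: dB_def \<gamma>_def mult.assoc)
  also have "\<dots> = (\<integral>\<^sup>+\<omega>. \<Phi> (frozen_path (Suc N) (chain a2 y0 (dB k \<omega>))) *
        (\<Prod>l<Suc N. \<psi> (chain a2 y0 (dB k \<omega>) l) (chain a2 y0 (dB k \<omega>) (Suc l))) \<partial>W)"
    unfolding R_eq by (simp add: frozen_path_def mult.commute)
  finally show ?case .
qed

end

section \<open>Domination of the grid law\<close>

text \<open>Constant from index 2^k on, like \<open>frozen_path\<close>. All levels thus share the
  Polish space of real sequences, where inner regularity is available.\<close>

definition grid_seq :: "nat \<Rightarrow> (real \<Rightarrow> real) \<Rightarrow> nat \<Rightarrow> real" where
  "grid_seq k w i = w (real (min i (2 ^ k)) / 2 ^ k)"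

lemma tendsto_fun_iff:
  "(f \<longlongrightarrow> l) F \<longleftrightarrow> (\<forall>i. ((\<lambda>x. f x i) \<longlongrightarrow> l i) F)" for f :: "'x \<Rightarrow> 'i \<Rightarrow> 'b::topological_space"
  using limitin_componentwise[of "\<lambda>_::'i. euclidean::'b topology" UNIV f l F]
  by (simp add: euclidean_product_topology)

lemma sets_seq_borel: "sets seq_borel = sets borel"
  by (rule sets_PiM_equal_borel)

text \<open>For compact C the functions \<phi> j decrease to the indicator of C as the slope j
  grows, and finite Borel measures on real sequences are inner regular.\<close>

lemma emeasure_le_of_continuous_le:
  fixes \<mu> \<nu> :: "(nat \<Rightarrow> real) measure"
  assumes sets: "sets \<mu> = sets borel" "sets \<nu> = sets borel"
    and fin: "emeasure \<mu> (space \<mu>) \<noteq> \<infinity>" "emeasure \<nu> (space \<nu>) \<noteq> \<infinity>"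
    and le: "\<And>\<phi>. continuous_on UNIV \<phi> \<Longrightarrow> (\<And>p. 0 \<le> \<phi> p) \<Longrightarrow> (\<And>p. \<phi> p \<le> 1) \<Longrightarrow>
      (\<integral>\<^sup>+p. ennreal (\<phi> p) \<partial>\<mu>) \<le> ennreal K * (\<integral>\<^sup>+p. ennreal (\<phi> p) \<partial>\<nu>)"
    and A: "A \<in> sets borel"
  shows "emeasure \<mu> A \<le> ennreal K * emeasure \<nu> A"
proof -
  have compact: "emeasure \<mu> C \<le> ennreal K * emeasure \<nu> C" if C: "compact C" for C
  proof (cases "C = {}")
    case False
    have closed: "closed C" using C by (rule compact_imp_closed)
    define \<phi> where "\<phi> j p = max 0 (1 - real j * infdist p C)" for j :: nat and p
    have cont: "continuous_on UNIV (\<phi> j)" for j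
      unfolding \<phi>_def by (intro continuous_intros)
    have [measurable]: "\<phi> j \<in> borel_measurable borel" for j
      using cont by (rule borel_measurable_continuous_onI)
    have bd: "0 \<le> \<phi> j p" "\<phi> j p \<le> 1" for j p
      by (auto simp: \<phi>_def infdist_nonneg)
    have lim: "(\<lambda>j. ennreal (\<phi> j p)) \<longlonglongrightarrow> indicator C p" for p
    proof (cases "p \<in> C")
      case True
      then show ?thesis by (simp add: \<phi>_def)
    next
      case False
      then have pos: "0 < infdist p C"
        using in_closed_iff_infdist_zero[OF closed \<open>C \<noteq> {}\<close>, of p] infdist_nonneg[of p C] by simp
      obtain j0 :: nat where "1 / infdist p C < real j0" using reals_Archimedean2 by blast
      then have "\<phi> j p = 0" if "j \<ge> j0" for j
      proof -
        have "1 / infdist p C \<le> real j" using \<open>_ < real j0\<close> that by linarith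
        then show ?thesis using pos by (simp add: \<phi>_def field_simps)
      qed
      then have "\<forall>\<^sub>F j in sequentially. ennreal (\<phi> j p) = 0"
        unfolding eventually_sequentially by (metis ennreal_0)
      then show ?thesis using False tendsto_eventually by (simp add: tendsto_eventually)
    qed
    have conv: "(\<lambda>j. \<integral>\<^sup>+p. ennreal (\<phi> j p) \<partial>m) \<longlonglongrightarrow> (\<integral>\<^sup>+p. indicator C p \<partial>m)"
      if m: "sets m = sets borel" "emeasure m (space m) \<noteq> \<infinity>" for m
    proof (rule nn_integral_dominated_convergence[where w = "\<lambda>_. 1"])
      have meas: "borel_measurable m = (borel_measurable borel :: ((nat \<Rightarrow> real) \<Rightarrow> ennreal) set)"
        by (rule measurable_cong_sets[OF m(1) refl])
      show "(\<lambda>p. ennreal (\<phi> j p)) \<in> borel_measurable m" for j unfolding meas by measurable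
      show "(\<lambda>p. indicator C p :: ennreal) \<in> borel_measurable m" unfolding meas using borel_closed[OF closed] by (rule borel_measurable_indicator)
      show "(\<integral>\<^sup>+p. 1 \<partial>m) < \<infinity>" using m(2) by (simp add: less_top)
    qed (use bd lim in \<open>auto simp: ennreal_le_1\<close>)
    have "(\<integral>\<^sup>+p. indicator C p \<partial>\<mu>) \<le> ennreal K * (\<integral>\<^sup>+p. indicator C p \<partial>\<nu>)"
    proof (rule LIMSEQ_le)
      show "(\<lambda>j. ennreal K * (\<integral>\<^sup>+p. ennreal (\<phi> j p) \<partial>\<nu>)) \<longlonglongrightarrow> ennreal K * (\<integral>\<^sup>+p. indicator C p \<partial>\<nu>)"
        by (intro ennreal_tendsto_cmult conv sets fin) simp
      show "(\<lambda>j. \<integral>\<^sup>+p. ennreal (\<phi> j p) \<partial>\<mu>) \<longlonglongrightarrow> (\<integral>\<^sup>+p. indicator C p \<partial>\<mu>)"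
        by (intro conv sets fin)
    qed (use le[OF cont bd] in auto)
    then show ?thesis using closed sets by simp
  qed simp
  have "emeasure \<mu> A = (SUP C \<in> {C. C \<subseteq> A \<and> compact C}. emeasure \<mu> C)"
    by (rule inner_regular[OF sets(1) fin(1) A])
  also have "\<dots> \<le> ennreal K * emeasure \<nu> A"
  proof (rule SUP_least)
    fix C assume "C \<in> {C. C \<subseteq> A \<and> compact C}"
    then have "emeasure \<mu> C \<le> ennreal K * emeasure \<nu> C" "emeasure \<nu> C \<le> emeasure \<nu> A"
      using compact A sets by (auto intro!: emeasure_mono)
    then show "emeasure \<mu> C \<le> ennreal K * emeasure \<nu> A" by (meson mult_left_mono order_trans zero_le)
  qed
  finally show ?thesis .
qed

lemma (in brownian_setup) grid_seq_measurable:
  assumes "\<And>t. t \<in> {0..1} \<Longrightarrow> X t \<in> borel_measurable W"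
  shows "(\<lambda>\<omega>. grid_seq k (\<lambda>t. X t \<omega>)) \<in> measurable W seq_borel"
proof (rule measurable_PiM_single')
  fix i
  have "real (min i (2 ^ k)) / 2 ^ k \<in> {0..1}" using grid_in_unit[of "min i (2 ^ k)" "2 ^ k"] by simp
  then show "(\<lambda>\<omega>. grid_seq k (\<lambda>t. X t \<omega>) i) \<in> borel_measurable W"
    using assms by (simp add: grid_seq_def)
qed auto

lemma (in brownian_setup) chain_scaled_sum:
  "chain (\<lambda>u z. u + r * z) u0 (dB k \<omega>) l = u0 + r * (B (real l / 2 ^ k) \<omega> - B 0 \<omega>)"
  by (induction l) (auto simp: dB_def algebra_simps)

section \<open>The inverse of the Lamperti transform, the drift and its primitive\<close>

context lamperti
begin

lemma c_pos: "0 < c"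
  using \<sigma>_pos[of 0] \<sigma>_bound[of 0] by linarith

lemma \<sigma>_le: "\<sigma> y \<le> c"
  using \<sigma>_bound[of y] by linarith

text \<open>The derivative 1 / \<sigma> is at least 1 / c. Surjectivity, injectivity and the
  Lipschitz bound for the inverse all come from this.\<close>

lemma \<Lambda>_growth:
  assumes "y \<le> z"
  shows "(z - y) / c \<le> \<Lambda> z - \<Lambda> y"
proof -
  have "\<Lambda> y - y / c \<le> \<Lambda> z - z / c"
  proof (rule DERIV_nonneg_imp_nondecreasing[OF assms])
    fix v
    have "1 / c \<le> 1 / \<sigma> v" using \<sigma>_pos[of v] \<sigma>_le[of v] by (intro frac_le) auto
    moreover have "((\<lambda>y. \<Lambda> y - y / c) has_real_derivative 1 / \<sigma> v - 1 / c) (at v)"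
      using \<Lambda>_deriv[of v] c_pos by (auto intro!: derivative_eq_intros)
    ultimately show "\<exists>d. ((\<lambda>y. \<Lambda> y - y / c) has_real_derivative d) (at v) \<and> 0 \<le> d"
      by (intro exI[of _ "1 / \<sigma> v - 1 / c"]) auto
  qed
  then show ?thesis by (simp add: diff_divide_distrib)
qed

lemma \<Lambda>_surj: "\<exists>y. \<Lambda> y = z"
proof -
  define y where "y = \<bar>z - \<Lambda> 0\<bar> * c"
  have "0 \<le> y" "y / c = \<bar>z - \<Lambda> 0\<bar>" using c_pos by (auto simp: y_def)
  then have "\<Lambda> (- y) \<le> z" "z \<le> \<Lambda> y" using \<Lambda>_growth[of 0 y] \<Lambda>_growth[of "- y" 0] by auto
  then show ?thesis using IVT'[of \<Lambda> "- y" z y] \<open>0 \<le> y\<close> \<Lambda>_continuous by auto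
qed

definition G :: "real \<Rightarrow> real" where "G z = (SOME y. \<Lambda> y = z)"

lemma \<Lambda>_G: "\<Lambda> (G z) = z"
  unfolding G_def using someI_ex[OF \<Lambda>_surj] .

lemma G_lipschitz: "\<bar>G z - G w\<bar> \<le> c * \<bar>z - w\<bar>"
proof -
  have *: "\<bar>G z - G w\<bar> \<le> c * \<bar>z - w\<bar>" if "G w \<le> G z" for z w
    using \<Lambda>_growth[OF that] that c_pos unfolding \<Lambda>_G by (simp add: field_simps abs_if) (smt (verit) mult_left_mono)
  then show ?thesis using *[of z w] *[of w z] by (cases "G w \<le> G z") (auto simp: abs_minus_commute)
qed

lemma G_\<Lambda>: "G (\<Lambda> y) = y"
proof (rule ccontr)
  assume ne: "G (\<Lambda> y) \<noteq> y"
  have "\<Lambda> (G (\<Lambda> y)) = \<Lambda> y" by (rule \<Lambda>_G)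
  then show False
    using ne \<Lambda>_growth[of y "G (\<Lambda> y)"] \<Lambda>_growth[of "G (\<Lambda> y)" y] c_pos
    by (cases "y \<le> G (\<Lambda> y)") (auto simp: field_simps)
qed

lemma G_continuous: "continuous_on A G"
  using G_lipschitz c_pos by (intro lipschitz_on_continuous_on lipschitz_onI) (auto simp: dist_real_def)

lemma G_measurable [measurable]: "G \<in> borel_measurable borel"
  using G_continuous by (rule borel_measurable_continuous_onI)

lemma G_deriv: "(G has_real_derivative \<sigma> (G z)) (at z)"
proof -
  have "isCont G z" using G_continuous[of UNIV] by (simp add: continuous_on_eq_continuous_at)
  then have "(G has_real_derivative inverse (1 / \<sigma> (G z))) (at z)"
    using \<Lambda>_deriv[of "G z"] \<sigma>_nz[of "G z"] \<Lambda>_G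
    by (intro DERIV_inverse_function[where f = \<Lambda> and a = "z - 1" and b = "z + 1"]) auto
  then show ?thesis by simp
qed

definition drift :: "real \<Rightarrow> real" where "drift u = - \<sigma>' (G u) / 2"

definition potential :: "real \<Rightarrow> real" where "potential u = - ln (\<sigma> (G u)) / 2"

text \<open>Since G' = \<sigma> (G), the derivative of ln (\<sigma> (G)) is \<sigma>' (G). This
  gives the Ito drift of \<Lambda> M an explicit bounded primitive.\<close>

lemma potential_deriv: "(potential has_real_derivative drift u) (at u)"
proof -
  have "((\<lambda>u. \<sigma> (G u)) has_real_derivative \<sigma>' (G u) * \<sigma> (G u)) (at u)"
    by (rule DERIV_chain2[OF \<sigma>_deriv G_deriv])
  then show ?thesis unfolding potential_def[abs_def] drift_def
    using \<sigma>_pos[of "G u"] by (auto intro!: derivative_eq_intros)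
qed

lemma drift_deriv: "(drift has_real_derivative - \<sigma>'' (G u) * \<sigma> (G u) / 2) (at u)"
proof -
  have "((\<lambda>u. \<sigma>' (G u)) has_real_derivative \<sigma>'' (G u) * \<sigma> (G u)) (at u)"
    by (rule DERIV_chain2[OF \<sigma>'_deriv G_deriv])
  then show ?thesis unfolding drift_def[abs_def] by (auto intro!: derivative_eq_intros)
qed

lemma drift_deriv_bound: "\<bar>- \<sigma>'' (G u) * \<sigma> (G u) / 2\<bar> \<le> L * c / 2"
  using mult_mono[OF \<sigma>''_bound[of "G u"] \<sigma>_bound[of "G u"] L_nonneg abs_ge_zero] by (simp add: abs_mult)

lemma drift_lipschitz: "\<bar>drift y - drift z\<bar> \<le> L * c / 2 * \<bar>y - z\<bar>"
  by (rule lipschitz_of_deriv_bound[OF drift_deriv drift_deriv_bound])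

lemma drift_measurable [measurable]: "drift \<in> borel_measurable borel"
  using continuous_on_of_deriv[OF drift_deriv] by (rule borel_measurable_continuous_onI)

lemma potential_measurable [measurable]: "potential \<in> borel_measurable borel"
  using continuous_on_of_deriv[OF potential_deriv] by (rule borel_measurable_continuous_onI)

text \<open>The exponent is at most half of ln c - ln \<delta>; the factor 1/2 is given
  away.\<close>

lemma exp_potential_diff: "exp (potential v - potential u) \<le> c / \<delta>"
proof -
  have "ln (\<sigma> (G u)) \<le> ln c" "ln \<delta> \<le> ln (\<sigma> (G v))" "ln \<delta> \<le> ln (\<sigma> (G u))"
    using \<sigma>_pos \<sigma>_le \<sigma>_ge \<delta>_pos c_pos by (auto intro!: ln_mono)
  then have "potential v - potential u \<le> ln (c / \<delta>)"
    using c_pos \<delta>_pos by (simp add: potential_def ln_div)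
  then show ?thesis using c_pos \<delta>_pos by (metis divide_pos_pos exp_le_cancel_iff exp_ln)
qed

text \<open>The first factor bounds the product of the 2^k factors \<open>r\<close> left by
  rescaling, the second the telescoped exponential of the potential. Neither depends on the level of
  the grid.\<close>

definition law_const :: real where "law_const = exp (L * c) * (c / \<delta>)"

text \<open>The weights from \<open>euler_step_le\<close> multiply to r^(2^k) times one exponential
  of a difference of the potential. The power stays bounded because r is about 1 + L c / 2^(k +
  1).\<close>

lemma euler_domination:
  assumes k: "L * c * (1 / 2) ^ k \<le> 1 / 2" and f [measurable]: "f \<in> borel_measurable seq_borel"
  defines "r \<equiv> 1 / sqrt (1 - L * c * (1 / 2) ^ k)"
  shows "(\<integral>\<^sup>+\<omega>. f (frozen_path (2 ^ k) (chain (\<lambda>u z. u + z + drift u * (1 / 2) ^ k) u0 (dB k \<omega>))) \<partial>W)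
    \<le> ennreal law_const * (\<integral>\<^sup>+\<omega>. f (frozen_path (2 ^ k) (chain (\<lambda>u z. u + r * z) u0 (dB k \<omega>))) \<partial>W)"
proof -
  let ?p = "\<lambda>\<omega>. chain (\<lambda>u z. u + r * z) u0 (dB k \<omega>)"
  let ?q = "L * c * (1 / 2) ^ k"
  have q: "0 \<le> ?q" "?q < 1" using k L_nonneg c_pos by auto
  have r: "0 < r" using q by (simp add: r_def)
  have "(\<integral>\<^sup>+\<omega>. f (frozen_path (2 ^ k) (chain (\<lambda>u z. u + z + drift u * (1 / 2) ^ k) u0 (dB k \<omega>))) \<partial>W)
    \<le> (\<integral>\<^sup>+\<omega>. f (frozen_path (2 ^ k) (?p \<omega>)) *
        (\<Prod>l<2 ^ k. ennreal (r * exp (potential (?p \<omega> (Suc l)) - potential (?p \<omega> l)))) \<partial>W)"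
  proof (rule chain_comparison[where \<psi> = "\<lambda>u v. ennreal (r * exp (potential v - potential u))"])
    fix y and g :: "real \<Rightarrow> ennreal" assume "g \<in> borel_measurable borel"
    then show "(\<integral>\<^sup>+z. ennreal (gauss ((1 / 2) ^ k) z) * g (y + z + drift y * (1 / 2) ^ k) \<partial>lborel)
      \<le> (\<integral>\<^sup>+z. ennreal (gauss ((1 / 2) ^ k) z) * (g (y + r * z) * ennreal (r * exp (potential (y + r * z) - potential y))) \<partial>lborel)"
      unfolding r_def by (intro euler_step_le[OF potential_deriv drift_deriv drift_deriv_bound _ q(2)]) auto
  qed (auto simp: split_beta')
  also have "\<dots> \<le> (\<integral>\<^sup>+\<omega>. ennreal law_const * f (frozen_path (2 ^ k) (?p \<omega>)) \<partial>W)"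
  proof (intro nn_integral_mono)
    fix \<omega>
    have "(\<Prod>l<2 ^ k. r * exp (potential (?p \<omega> (Suc l)) - potential (?p \<omega> l)))
        = r ^ (2 ^ k) * exp (\<Sum>l<2 ^ k. potential (?p \<omega> (Suc l)) - potential (?p \<omega> l))"
      by (simp add: prod.distrib exp_sum)
    also have "(\<Sum>l<2 ^ k. potential (?p \<omega> (Suc l)) - potential (?p \<omega> l)) = potential (?p \<omega> (2 ^ k)) - potential (?p \<omega> 0)"
      by (rule sum_lessThan_telescope)
    also have "r ^ (2 ^ k) * exp (potential (?p \<omega> (2 ^ k)) - potential (?p \<omega> 0)) \<le> law_const"
      unfolding law_const_def
    proof (intro mult_mono exp_potential_diff)
      \<comment> \<open>With q for \<open>?q\<close>, the product is 1 + q (1 - 2 q), and the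
        hypothesis gives q <= 1 / 2.\<close>
      have "1 \<le> (1 - ?q) * (1 + 2 * ?q)"
        using mult_left_mono[OF k q(1)] by (simp add: algebra_simps)
      also have "\<dots> \<le> (1 - ?q) * exp (2 * ?q)"
        using q exp_ge_add_one_self[of "2 * ?q"] by (intro mult_left_mono) auto
      finally have "1 / (1 - ?q) \<le> exp (2 * ?q)" using q by (simp add: field_simps)
      then have "sqrt (1 / (1 - ?q)) \<le> sqrt (exp (2 * ?q))" by (rule real_sqrt_le_mono)
      also have "\<dots> = exp ?q" by (simp add: exp_double real_sqrt_power)
      finally have "r \<le> exp ?q" by (simp add: r_def real_sqrt_divide)
      then have "r ^ (2 ^ k) \<le> exp ?q ^ (2 ^ k)" using r by (intro power_mono) auto
      also have "\<dots> = exp (L * c)" by (simp add: exp_of_nat_mult[symmetric] power_one_over)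
      finally show "r ^ (2 ^ k) \<le> exp (L * c)" .
    qed auto
    finally have "(\<Prod>l<2 ^ k. ennreal (r * exp (potential (?p \<omega> (Suc l)) - potential (?p \<omega> l)))) \<le> ennreal law_const"
      using r by (subst prod_ennreal) (auto intro: ennreal_leI)
    then show "f (frozen_path (2 ^ k) (?p \<omega>)) * (\<Prod>l<2 ^ k. ennreal (r * exp (potential (?p \<omega> (Suc l)) - potential (?p \<omega> l))))
      \<le> ennreal law_const * f (frozen_path (2 ^ k) (?p \<omega>))"
      by (subst mult.commute) (intro mult_right_mono, auto)
  qed
  also have "\<dots> = ennreal law_const * (\<integral>\<^sup>+\<omega>. f (frozen_path (2 ^ k) (?p \<omega>)) \<partial>W)"
  proof (rule nn_integral_cmult)
    have "(\<lambda>\<omega>. frozen_path (2 ^ k) (?p \<omega>)) \<in> measurable W seq_borel"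
      by (rule meas_W[OF frozen_chain_measurable]) auto
    then show "(\<lambda>\<omega>. f (frozen_path (2 ^ k) (?p \<omega>))) \<in> borel_measurable W" by measurable
  qed
  finally show ?thesis .
qed

text \<open>The coarse level k is fixed while the level j of the Euler scheme tends to infinity; the
  constant of \<open>euler_domination\<close> is the same for all j. On the left the scheme
  converges pathwise to \<Lambda> M, on the right the scale \<open>r j\<close> tends to 1.\<close>

lemma grid_law_bound_continuous:
  assumes \<phi>: "continuous_on UNIV \<phi>" "\<And>p. 0 \<le> \<phi> p" "\<And>p. \<phi> p \<le> 1"
  shows "(\<integral>\<^sup>+\<omega>. ennreal (\<phi> (grid_seq k (\<lambda>t. \<Lambda> (M t \<omega>)))) \<partial>W)
    \<le> ennreal law_const * (\<integral>\<^sup>+\<omega>. ennreal (\<phi> (grid_seq k (\<lambda>t. \<Lambda> x + (B t \<omega> - B 0 \<omega>)))) \<partial>W)"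
proof -
  have [measurable]: "\<phi> \<in> borel_measurable seq_borel"
    using borel_measurable_continuous_onI[OF \<phi>(1)] by (simp add: measurable_cong_sets[OF sets_seq_borel refl])
  \<comment> \<open>Index in the fine grid j of the i-th point of the coarse grid k. It has this
    meaning only for j >= k, so the limits below run over j + k.\<close>
  define idx where "idx j i = min i (2 ^ k) * 2 ^ (j - k)" for j i :: nat
  have idx_le: "idx j i \<le> 2 ^ j" and idx_eq: "real (idx j i) / 2 ^ j = real (min i (2 ^ k)) / 2 ^ k" if "k \<le> j" for i j
  proof -
    have e: "(2::nat) ^ j = 2 ^ k * 2 ^ (j - k)" "(2::real) ^ j = 2 ^ k * 2 ^ (j - k)"
      using that by (simp_all add: power_add[symmetric])
    show "idx j i \<le> 2 ^ j" unfolding idx_def e(1) by (intro mult_right_mono) auto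
    show "real (idx j i) / 2 ^ j = real (min i (2 ^ k)) / 2 ^ k" unfolding idx_def e(2) by simp
  qed
  define r where "r j = 1 / sqrt (1 - L * c * (1 / 2) ^ j)" for j
  define V where "V j \<omega> = chain (\<lambda>u z. u + z + drift u * (1 / 2) ^ j) (\<Lambda> x) (dB j \<omega>)" for j \<omega>
  define S where "S j \<omega> = chain (\<lambda>u z. u + r j * z) (\<Lambda> x) (dB j \<omega>)" for j \<omega>
  have re: "(\<lambda>p i. p (idx j i)) \<in> measurable seq_borel seq_borel" for j
    by (rule measurable_PiM_single') auto
  have meas: "(\<lambda>\<omega>. ennreal (\<phi> (\<lambda>i. chain a (\<Lambda> x) (dB j \<omega>) (idx j i)))) \<in> borel_measurable W"
    if "(\<lambda>(y, z). a y z) \<in> borel_measurable (borel \<Otimes>\<^sub>M borel)" "k \<le> j" for a j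
  proof -
    have "(\<lambda>\<omega>. frozen_path (2 ^ j) (chain a (\<Lambda> x) (dB j \<omega>))) \<in> measurable W seq_borel"
      by (rule meas_W[OF frozen_chain_measurable[OF that(1)]]) auto
    from measurable_compose[OF measurable_compose[OF this re[of j]] \<open>\<phi> \<in> borel_measurable seq_borel\<close>]
    show ?thesis using idx_le[OF that(2)] by (simp add: frozen_path_def min_absorb1)
  qed
  have a1: "(\<lambda>(y, z). y + z + drift y * (1 / 2) ^ j) \<in> borel_measurable (borel \<Otimes>\<^sub>M borel)"
    and a2: "(\<lambda>(y, z). y + r j * z) \<in> borel_measurable (borel \<Otimes>\<^sub>M borel)" for j
    by (auto simp: split_beta')
  have half: "(\<lambda>j. L * c * (1 / 2) ^ j) \<longlonglongrightarrow> 0"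
    by (intro tendsto_mult_right_zero LIMSEQ_realpow_zero) auto
  then have "\<forall>\<^sub>F j in sequentially. L * c * (1 / 2) ^ j < 1 / 2" by (rule order_tendstoD) simp
  then have dom: "\<forall>\<^sub>F j in sequentially. (\<integral>\<^sup>+\<omega>. ennreal (\<phi> (\<lambda>i. V j \<omega> (idx j i))) \<partial>W)
      \<le> ennreal law_const * (\<integral>\<^sup>+\<omega>. ennreal (\<phi> (\<lambda>i. S j \<omega> (idx j i))) \<partial>W)"
    using eventually_ge_at_top[of k]
  proof eventually_elim
    case (elim j)
    have "(\<lambda>p. ennreal (\<phi> (\<lambda>i. p (idx j i)))) \<in> borel_measurable seq_borel"
      using measurable_compose[OF re[of j] \<open>\<phi> \<in> borel_measurable seq_borel\<close>] by simp
    from euler_domination[OF less_imp_le[OF elim(1)] this, of "\<Lambda> x"] show ?case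
      using idx_le[OF elim(2)] by (simp add: V_def S_def r_def frozen_path_def min_absorb1)
  qed
  have limV: "(\<lambda>j. \<integral>\<^sup>+\<omega>. ennreal (\<phi> (\<lambda>i. V (j + k) \<omega> (idx (j + k) i))) \<partial>W)
      \<longlonglongrightarrow> (\<integral>\<^sup>+\<omega>. ennreal (\<phi> (grid_seq k (\<lambda>t. \<Lambda> (M t \<omega>)))) \<partial>W)"
  proof (rule nn_integral_dominated_convergence[where w = "\<lambda>_. 1"])
    show "(\<lambda>\<omega>. ennreal (\<phi> (\<lambda>i. V (j + k) \<omega> (idx (j + k) i)))) \<in> borel_measurable W" for j
      unfolding V_def by (intro meas a1) simp
    have "\<Lambda> \<in> borel_measurable borel" using \<Lambda>_continuous by (rule borel_measurable_continuous_onI)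
    then have "(\<lambda>\<omega>. grid_seq k (\<lambda>t. \<Lambda> (M t \<omega>))) \<in> measurable W seq_borel"
      using measurable_compose[OF M_meas_W] by (intro grid_seq_measurable) auto
    then show "(\<lambda>\<omega>. ennreal (\<phi> (grid_seq k (\<lambda>t. \<Lambda> (M t \<omega>))))) \<in> borel_measurable W" by measurable
    show "(\<integral>\<^sup>+\<omega>. 1 \<partial>W) < \<infinity>" by (simp add: emeasure_space_1)
    have "AE \<omega> in W. \<omega> \<in> space W" by simp
    with ito_formula B_0
    show "AE \<omega> in W. (\<lambda>j. ennreal (\<phi> (\<lambda>i. V (j + k) \<omega> (idx (j + k) i)))) \<longlonglongrightarrow> ennreal (\<phi> (grid_seq k (\<lambda>t. \<Lambda> (M t \<omega>))))"
    proof eventually_elim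
      case (elim \<omega>)
      have u: "continuous_on {0..1} (\<lambda>t. \<Lambda> (M t \<omega>))"
        using continuous_on_compose2[OF \<Lambda>_continuous[of UNIV] M_continuous[OF elim(3)]] by simp
      have eq: "\<Lambda> (M t \<omega>) = \<Lambda> x + B t \<omega> + integral {0..t} (\<lambda>s. drift (\<Lambda> (M s \<omega>)))" if "t \<in> {0..1}" for t
        using elim(1) that by (simp add: drift_def G_\<Lambda>)
      have "(\<lambda>j. V j \<omega> (idx j i)) \<longlonglongrightarrow> grid_seq k (\<lambda>t. \<Lambda> (M t \<omega>)) i" for i
      proof (rule LIMSEQ_I)
        fix e :: real assume "0 < e"
        obtain K where K: "\<And>j l. j \<ge> K \<Longrightarrow> l \<le> 2 ^ j \<Longrightarrow> \<bar>\<Lambda> (M (real l / 2 ^ j) \<omega>) - V j \<omega> l\<bar> \<le> e / 2"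
          using euler_scheme_converges[OF u eq elim(2) drift_lipschitz continuous_on_of_deriv[OF drift_deriv] half_gt_zero[OF \<open>0 < e\<close>]]
          unfolding V_def dB_def[abs_def] by blast
        have "norm (V j \<omega> (idx j i) - grid_seq k (\<lambda>t. \<Lambda> (M t \<omega>)) i) < e" if "j \<ge> max K k" for j
        proof -
          have "\<bar>\<Lambda> (M (real (idx j i) / 2 ^ j) \<omega>) - V j \<omega> (idx j i)\<bar> \<le> e / 2"
            using that by (intro K idx_le) auto
          then show ?thesis using idx_eq[of j i] that \<open>0 < e\<close> by (simp add: grid_seq_def abs_minus_commute)
        qed
        then show "\<exists>no. \<forall>j\<ge>no. norm (V j \<omega> (idx j i) - grid_seq k (\<lambda>t. \<Lambda> (M t \<omega>)) i) < e" by blast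
      qed
      then have "(\<lambda>j. (\<lambda>i. V j \<omega> (idx j i))) \<longlonglongrightarrow> grid_seq k (\<lambda>t. \<Lambda> (M t \<omega>))"
        by (simp add: tendsto_fun_iff)
      then have "(\<lambda>j. (\<lambda>i. V (j + k) \<omega> (idx (j + k) i))) \<longlonglongrightarrow> grid_seq k (\<lambda>t. \<Lambda> (M t \<omega>))"
        by (rule LIMSEQ_ignore_initial_segment)
      then show ?case
        using continuous_on_tendsto_compose[OF \<phi>(1)] by (intro tendsto_ennrealI) auto
    qed
  qed (use \<phi> in \<open>auto simp: ennreal_le_1\<close>)
  have limS: "(\<lambda>j. \<integral>\<^sup>+\<omega>. ennreal (\<phi> (\<lambda>i. S (j + k) \<omega> (idx (j + k) i))) \<partial>W)
      \<longlonglongrightarrow> (\<integral>\<^sup>+\<omega>. ennreal (\<phi> (grid_seq k (\<lambda>t. \<Lambda> x + (B t \<omega> - B 0 \<omega>)))) \<partial>W)"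
  proof (rule nn_integral_dominated_convergence[where w = "\<lambda>_. 1"])
    show "(\<lambda>\<omega>. ennreal (\<phi> (\<lambda>i. S (j + k) \<omega> (idx (j + k) i)))) \<in> borel_measurable W" for j
      unfolding S_def by (intro meas a2) simp
    have "(\<lambda>\<omega>. \<Lambda> x + (B t \<omega> - B 0 \<omega>)) \<in> borel_measurable W" if "t \<in> {0..1}" for t
      using dB_meas_W[of 0 t] that by auto
    then have "(\<lambda>\<omega>. grid_seq k (\<lambda>t. \<Lambda> x + (B t \<omega> - B 0 \<omega>))) \<in> measurable W seq_borel"
      by (intro grid_seq_measurable)
    then show "(\<lambda>\<omega>. ennreal (\<phi> (grid_seq k (\<lambda>t. \<Lambda> x + (B t \<omega> - B 0 \<omega>))))) \<in> borel_measurable W" by measurable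
    show "(\<integral>\<^sup>+\<omega>. 1 \<partial>W) < \<infinity>" by (simp add: emeasure_space_1)
    have "r \<longlonglongrightarrow> 1 / sqrt (1 - 0)"
      unfolding r_def by (intro tendsto_intros half) auto
    then have "(\<lambda>j. r (j + k)) \<longlonglongrightarrow> 1 / sqrt (1 - 0)" by (rule LIMSEQ_ignore_initial_segment)
    then have r1: "(\<lambda>j. r (j + k)) \<longlonglongrightarrow> 1" by simp
    have "(\<lambda>j. S (j + k) \<omega> (idx (j + k) i)) \<longlonglongrightarrow> grid_seq k (\<lambda>t. \<Lambda> x + (B t \<omega> - B 0 \<omega>)) i" for \<omega> i
    proof -
      let ?t = "real (min i (2 ^ k)) / 2 ^ k"
      have "(\<lambda>j. \<Lambda> x + r (j + k) * (B ?t \<omega> - B 0 \<omega>)) \<longlonglongrightarrow> \<Lambda> x + 1 * (B ?t \<omega> - B 0 \<omega>)"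
        by (intro tendsto_intros r1)
      then show ?thesis using idx_eq unfolding S_def chain_scaled_sum by (simp add: grid_seq_def)
    qed
    then have S_lim: "(\<lambda>j. (\<lambda>i. S (j + k) \<omega> (idx (j + k) i))) \<longlonglongrightarrow> grid_seq k (\<lambda>t. \<Lambda> x + (B t \<omega> - B 0 \<omega>))" for \<omega>
      by (simp add: tendsto_fun_iff)
    show "AE \<omega> in W. (\<lambda>j. ennreal (\<phi> (\<lambda>i. S (j + k) \<omega> (idx (j + k) i)))) \<longlonglongrightarrow> ennreal (\<phi> (grid_seq k (\<lambda>t. \<Lambda> x + (B t \<omega> - B 0 \<omega>))))"
      using continuous_on_tendsto_compose[OF \<phi>(1) S_lim] by (intro AE_I2 tendsto_ennrealI) auto
  qed (use \<phi> in \<open>auto simp: ennreal_le_1\<close>)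
  show ?thesis
  proof (rule tendsto_le[OF _ _ limV])
    show "(\<lambda>j. ennreal law_const * (\<integral>\<^sup>+\<omega>. ennreal (\<phi> (\<lambda>i. S (j + k) \<omega> (idx (j + k) i))) \<partial>W))
      \<longlonglongrightarrow> ennreal law_const * (\<integral>\<^sup>+\<omega>. ennreal (\<phi> (grid_seq k (\<lambda>t. \<Lambda> x + (B t \<omega> - B 0 \<omega>)))) \<partial>W)"
      by (intro ennreal_tendsto_cmult limS) simp
    show "\<forall>\<^sub>F j in sequentially. (\<integral>\<^sup>+\<omega>. ennreal (\<phi> (\<lambda>i. V (j + k) \<omega> (idx (j + k) i))) \<partial>W)
      \<le> ennreal law_const * (\<integral>\<^sup>+\<omega>. ennreal (\<phi> (\<lambda>i. S (j + k) \<omega> (idx (j + k) i))) \<partial>W)"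
      by (rule eventually_sequentially_seg[THEN iffD2, OF dom])
  qed simp
qed

end

section \<open>The explicit likelihood ratio\<close>

context lamperti
begin

text \<open>The \<psi> of \<open>gauss_change_of_variables\<close> for s = 1 / \<sigma> and variance
  2^-k. The product \<open>likelihood\<close> is the density \<open>Z\<close> of the
  overview.\<close>

definition ratio :: "nat \<Rightarrow> real \<Rightarrow> real \<Rightarrow> real" where
  "ratio k y v = gauss ((1 / 2) ^ k) (\<Lambda> v - \<Lambda> y) * (1 / \<sigma> v) / gauss ((1 / 2) ^ k) (v - y)"

definition likelihood :: "nat \<Rightarrow> (nat \<Rightarrow> real) \<Rightarrow> real" where
  "likelihood k p = (\<Prod>l<2 ^ k. ratio k (p l) (p (Suc l)))"

lemma gauss_pos: "0 < gauss ((1 / 2) ^ k) z"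
  by (simp add: normal_density_pos)

lemma ratio_pos: "0 < ratio k y v"
  using gauss_pos \<sigma>_pos by (simp add: ratio_def)

lemma likelihood_pos: "0 < likelihood k p"
  using ratio_pos by (auto simp: likelihood_def intro: prod_pos)

lemma \<Lambda>_measurable [measurable]: "\<Lambda> \<in> borel_measurable borel"
  using \<Lambda>_continuous by (rule borel_measurable_continuous_onI)

lemma ratio_measurable [measurable]:
  assumes [measurable]: "f \<in> borel_measurable X" "g \<in> borel_measurable X"
  shows "(\<lambda>p. ratio k (f p) (g p)) \<in> borel_measurable X"
  unfolding ratio_def by measurable

lemma likelihood_measurable [measurable]: "likelihood k \<in> borel_measurable seq_borel"
  unfolding likelihood_def by measurable

text \<open>\<open>B 0\<close> vanishes only almost surely. Subtracting it makes the identities with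
  chains of increments hold for every \<omega>.\<close>

abbreviation xB :: "'a \<Rightarrow> real \<Rightarrow> real" where
  "xB \<omega> t \<equiv> x + (B t \<omega> - B 0 \<omega>)"

lemma frozen_grid: "frozen_path (2 ^ k) (\<lambda>l. w (real l / 2 ^ k)) = grid_seq k w"
  by (simp add: fun_eq_iff frozen_path_def grid_seq_def)

lemma chain_transformed:
  "chain (\<lambda>y z. G (\<Lambda> y + z)) x (dB k \<omega>) = (\<lambda>l. G (\<Lambda> x + (B (real l / 2 ^ k) \<omega> - B 0 \<omega>)))"
proof
  show "chain (\<lambda>y z. G (\<Lambda> y + z)) x (dB k \<omega>) l = G (\<Lambda> x + (B (real l / 2 ^ k) \<omega> - B 0 \<omega>))" for l
    by (induction l) (auto simp: G_\<Lambda> \<Lambda>_G dB_def add.assoc)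
qed

lemma chain_translated: "chain (\<lambda>y z. y + z) x (dB k \<omega>) = (\<lambda>l. xB \<omega> (real l / 2 ^ k))"
  using chain_scaled_sum[of 1 x k \<omega>] by auto

lemma likelihood_grid_seq:
  "ennreal (likelihood k (grid_seq k w)) = (\<Prod>l<2 ^ k. ennreal (ratio k (w (real l / 2 ^ k)) (w (real (Suc l) / 2 ^ k))))"
  using ratio_pos by (subst prod_ennreal) (auto simp: likelihood_def grid_seq_def min_def less_imp_le intro!: arg_cong[where f = ennreal] prod.cong)

text \<open>\<open>chain_comparison\<close> with the one-step change of variables, for which
  \<open>step\<close> holds with equality.\<close>

lemma transformed_law_le:
  assumes [measurable]: "\<Phi> \<in> borel_measurable seq_borel"
  shows "(\<integral>\<^sup>+\<omega>. \<Phi> (grid_seq k (\<lambda>t. G (\<Lambda> x + (B t \<omega> - B 0 \<omega>)))) \<partial>W)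
    \<le> (\<integral>\<^sup>+\<omega>. \<Phi> (grid_seq k (xB \<omega>)) * ennreal (likelihood k (grid_seq k (xB \<omega>))) \<partial>W)"
proof -
  have "(\<integral>\<^sup>+\<omega>. \<Phi> (frozen_path (2 ^ k) (chain (\<lambda>y z. G (\<Lambda> y + z)) x (dB k \<omega>))) \<partial>W)
    \<le> (\<integral>\<^sup>+\<omega>. \<Phi> (frozen_path (2 ^ k) (chain (\<lambda>y z. y + z) x (dB k \<omega>))) *
      (\<Prod>l<2 ^ k. ennreal (ratio k (chain (\<lambda>y z. y + z) x (dB k \<omega>) l) (chain (\<lambda>y z. y + z) x (dB k \<omega>) (Suc l)))) \<partial>W)"
  proof (rule chain_comparison)
    fix y and g :: "real \<Rightarrow> ennreal" assume "g \<in> borel_measurable borel"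
    then show "(\<integral>\<^sup>+z. ennreal (gauss ((1 / 2) ^ k) z) * g (G (\<Lambda> y + z)) \<partial>lborel)
      \<le> (\<integral>\<^sup>+z. ennreal (gauss ((1 / 2) ^ k) z) * (g (y + z) * ennreal (ratio k y (y + z))) \<partial>lborel)"
      unfolding ratio_def
      by (intro eq_refl gauss_change_of_variables(1)[where s = "\<lambda>v. 1 / \<sigma> v", OF \<Lambda>_deriv _ _ \<Lambda>_G G_\<Lambda> G_measurable])
        (auto intro!: continuous_intros \<sigma>_continuous simp: \<sigma>_nz \<sigma>_pos)
  qed (auto simp: split_beta')
  then show ?thesis
    unfolding chain_transformed chain_translated likelihood_grid_seq
      frozen_grid[of k "\<lambda>t. G (\<Lambda> x + (B t \<omega> - B 0 \<omega>))" for \<omega>] frozen_grid[of k "xB \<omega>" for \<omega>] .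
qed

text \<open>The comparison runs backwards, from the translated to the transformed chain, with the
  likelihood itself as functional; the weights 1 / \<open>ratio\<close> then cancel it pointwise and
  leave total mass 1.\<close>

lemma likelihood_integral_le: "(\<integral>\<^sup>+\<omega>. ennreal (likelihood k (grid_seq k (xB \<omega>))) \<partial>W) \<le> 1"
proof -
  let ?w = "\<lambda>\<omega> t. G (\<Lambda> x + (B t \<omega> - B 0 \<omega>))"
  have "(\<integral>\<^sup>+\<omega>. ennreal (likelihood k (frozen_path (2 ^ k) (chain (\<lambda>y z. y + z) x (dB k \<omega>)))) \<partial>W)
    \<le> (\<integral>\<^sup>+\<omega>. ennreal (likelihood k (frozen_path (2 ^ k) (chain (\<lambda>y z. G (\<Lambda> y + z)) x (dB k \<omega>)))) *
      (\<Prod>l<2 ^ k. ennreal (1 / ratio k (chain (\<lambda>y z. G (\<Lambda> y + z)) x (dB k \<omega>) l) (chain (\<lambda>y z. G (\<Lambda> y + z)) x (dB k \<omega>) (Suc l)))) \<partial>W)"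
  proof (rule chain_comparison)
    fix y and g :: "real \<Rightarrow> ennreal" assume "g \<in> borel_measurable borel"
    then show "(\<integral>\<^sup>+z. ennreal (gauss ((1 / 2) ^ k) z) * g (y + z) \<partial>lborel)
      \<le> (\<integral>\<^sup>+z. ennreal (gauss ((1 / 2) ^ k) z) * (g (G (\<Lambda> y + z)) * ennreal (1 / ratio k y (G (\<Lambda> y + z)))) \<partial>lborel)"
      unfolding ratio_def
      by (intro eq_refl gauss_change_of_variables(2)[where s = "\<lambda>v. 1 / \<sigma> v", OF \<Lambda>_deriv _ _ \<Lambda>_G G_\<Lambda> G_measurable])
        (auto intro!: continuous_intros \<sigma>_continuous simp: \<sigma>_nz \<sigma>_pos)
  qed (auto simp: split_beta')
  then have "(\<integral>\<^sup>+\<omega>. ennreal (likelihood k (grid_seq k (xB \<omega>))) \<partial>W)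
    \<le> (\<integral>\<^sup>+\<omega>. (\<Prod>l<2 ^ k. ennreal (ratio k (?w \<omega> (real l / 2 ^ k)) (?w \<omega> (real (Suc l) / 2 ^ k)))) *
      (\<Prod>l<2 ^ k. ennreal (1 / ratio k (?w \<omega> (real l / 2 ^ k)) (?w \<omega> (real (Suc l) / 2 ^ k)))) \<partial>W)"
    unfolding chain_transformed chain_translated frozen_grid[of k "xB \<omega>" for \<omega>]
      frozen_grid[of k "?w \<omega>" for \<omega>] likelihood_grid_seq[of k "?w \<omega>" for \<omega>] .
  also have "\<dots> = (\<integral>\<^sup>+\<omega>. 1 \<partial>W)"
    unfolding prod.distrib[symmetric]
    using ratio_pos by (intro nn_integral_cong prod.neutral) (simp add: ennreal_mult[symmetric] less_imp_le less_imp_neq[symmetric])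
  finally show ?thesis by (simp add: emeasure_space_1)
qed

text \<open>The domination of \<Lambda> M by \<Lambda> x + B, with all coordinates mapped back by
  \<open>G\<close>, followed by the change of variables that expresses G (\<Lambda> x + B) through x
  + B.\<close>

lemma grid_law_bound:
  assumes A: "A \<in> sets seq_borel"
  shows "emeasure W {\<omega>\<in>space W. grid_seq k (\<lambda>t. M t \<omega>) \<in> A}
    \<le> ennreal law_const * (\<integral>\<^sup>+\<omega>. indicator A (grid_seq k (xB \<omega>)) * ennreal (likelihood k (grid_seq k (xB \<omega>))) \<partial>W)"
proof -
  let ?u = "\<lambda>\<omega>. grid_seq k (\<lambda>t. \<Lambda> (M t \<omega>))" and ?v = "\<lambda>\<omega>. grid_seq k (\<lambda>t. \<Lambda> x + (B t \<omega> - B 0 \<omega>))"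
  have "?u \<in> measurable W seq_borel"
    using measurable_compose[OF M_meas_W \<Lambda>_measurable] by (intro grid_seq_measurable) auto
  then have u [measurable]: "?u \<in> borel_measurable W" by (simp add: measurable_cong_sets[OF refl sets_seq_borel])
  have "?v \<in> measurable W seq_borel"
    using dB_meas_W[of 0] by (intro grid_seq_measurable borel_measurable_add) auto
  then have v [measurable]: "?v \<in> borel_measurable W" by (simp add: measurable_cong_sets[OF refl sets_seq_borel])
  \<comment> \<open>Coordinatewise preimage under \<open>G\<close>: the grid values of \<Lambda> M
    lie in \<open>A'\<close> exactly when those of \<open>M\<close> lie in \<open>A\<close>.\<close>
  define A' where "A' = (\<lambda>p i. G (p i)) -` A"
  have "(\<lambda>p i. G (p i)) \<in> measurable seq_borel seq_borel" by (rule measurable_PiM_single') auto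
  from measurable_sets[OF this A] have A': "A' \<in> sets borel"
    unfolding A'_def sets_seq_borel by (simp add: space_PiM)
  have "emeasure (distr W borel ?u) A' \<le> ennreal law_const * emeasure (distr W borel ?v) A'"
  proof (rule emeasure_le_of_continuous_le[OF _ _ _ _ _ A'])
    interpret u: prob_space "distr W borel ?u" by (rule prob_space_distr[OF u])
    interpret v: prob_space "distr W borel ?v" by (rule prob_space_distr[OF v])
    show "emeasure (distr W borel ?u) (space (distr W borel ?u)) \<noteq> \<infinity>" "emeasure (distr W borel ?v) (space (distr W borel ?v)) \<noteq> \<infinity>"
      using u.emeasure_space_1 v.emeasure_space_1 by auto
    fix \<phi> :: "(nat \<Rightarrow> real) \<Rightarrow> real" assume \<phi>: "continuous_on UNIV \<phi>" "\<And>p. 0 \<le> \<phi> p" "\<And>p. \<phi> p \<le> 1"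
    have [measurable]: "\<phi> \<in> borel_measurable borel" using \<phi>(1) by (rule borel_measurable_continuous_onI)
    show "(\<integral>\<^sup>+p. ennreal (\<phi> p) \<partial>distr W borel ?u) \<le> ennreal law_const * (\<integral>\<^sup>+p. ennreal (\<phi> p) \<partial>distr W borel ?v)"
      using grid_law_bound_continuous[OF \<phi>] by (simp add: nn_integral_distr)
  qed auto
  moreover have "?u -` A' \<inter> space W = {\<omega>\<in>space W. grid_seq k (\<lambda>t. M t \<omega>) \<in> A}"
  proof -
    have "(\<lambda>i. G (?u \<omega> i)) = grid_seq k (\<lambda>t. M t \<omega>)" for \<omega> by (simp add: fun_eq_iff grid_seq_def G_\<Lambda>)
    then show ?thesis by (auto simp: A'_def)
  qed
  moreover have "emeasure (distr W borel ?v) A' = (\<integral>\<^sup>+\<omega>. indicator A (grid_seq k (\<lambda>t. G (\<Lambda> x + (B t \<omega> - B 0 \<omega>)))) \<partial>W)"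
  proof -
    have "emeasure (distr W borel ?v) A' = (\<integral>\<^sup>+\<omega>. indicator A' (?v \<omega>) \<partial>W)"
      using A' by (subst nn_integral_indicator[symmetric], simp, subst nn_integral_distr[OF v]) auto
    also have "\<dots> = (\<integral>\<^sup>+\<omega>. indicator A (grid_seq k (\<lambda>t. G (\<Lambda> x + (B t \<omega> - B 0 \<omega>)))) \<partial>W)"
    proof (rule nn_integral_cong)
      fix \<omega>
      have "(\<lambda>i. G (?v \<omega> i)) = grid_seq k (\<lambda>t. G (\<Lambda> x + (B t \<omega> - B 0 \<omega>)))" by (simp add: fun_eq_iff grid_seq_def)
      then show "indicator A' (?v \<omega>) = (indicator A (grid_seq k (\<lambda>t. G (\<Lambda> x + (B t \<omega> - B 0 \<omega>)))) :: ennreal)"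
        by (simp add: A'_def indicator_def)
    qed
    finally show ?thesis .
  qed
  moreover have "(\<integral>\<^sup>+\<omega>. indicator A (grid_seq k (\<lambda>t. G (\<Lambda> x + (B t \<omega> - B 0 \<omega>)))) \<partial>W)
    \<le> (\<integral>\<^sup>+\<omega>. indicator A (grid_seq k (xB \<omega>)) * ennreal (likelihood k (grid_seq k (xB \<omega>))) \<partial>W)"
    using A by (intro transformed_law_le) simp
  ultimately show ?thesis
    using A' by (simp add: emeasure_distr) (meson mult_left_mono order_trans zero_le)
qed

text \<open>The normalising constants of the two Gaussian densities cancel, and 2^-k removes the 1 /
  h in their exponents. The term - 1 of the limit is the quadratic variation of \<Lambda> M.\<close>

lemma ln_likelihood_tendsto:
  "AE \<omega> in W. (\<lambda>k. 1 / 2 ^ k * ln (likelihood k (grid_seq k (\<lambda>t. M t \<omega>))))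
    \<longlonglongrightarrow> 1 / 2 * (LINT s:{0..1}|lborel. (\<sigma> (M s \<omega>))\<^sup>2 - 1 - ln ((\<sigma> (M s \<omega>))\<^sup>2))"
proof -
  have one: "(1::real) \<in> {0..1}" by simp
  have fl: "nat \<lfloor>(1::real) * 2 ^ k\<rfloor> = 2 ^ k" for k
    by (metis floor_of_nat mult_1 nat_int of_nat_numeral of_nat_power)
  have "AE \<omega> in W. \<omega> \<in> space W" by simp
  with AE_sum_square_tendsto[OF one] AE_transformed_quadratic_variation show ?thesis
  proof eventually_elim
    case (elim \<omega>)
    define m where "m k l = M (real l / 2 ^ k) \<omega>" for k l
    have cont: "continuous_on {0..1} (\<lambda>s. f (M s \<omega>))" if "continuous_on UNIV f" for f :: "real \<Rightarrow> real"
      using continuous_on_compose2[OF that M_continuous[OF elim(3)]] by simp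
    have c\<sigma>: "continuous_on {0..1} (\<lambda>s. \<sigma> (M s \<omega>))" using cont[OF \<sigma>_continuous] .
    have cln: "continuous_on {0..1} (\<lambda>s. ln (\<sigma> (M s \<omega>)))"
      by (rule cont[of "\<lambda>y. ln (\<sigma> y)"]) (intro continuous_intros \<sigma>_continuous, simp add: \<sigma>_nz)
    \<comment> \<open>Right endpoints, since \<open>ratio\<close> contains \<sigma> at the point of
      arrival.\<close>
    have "(\<lambda>k. \<Sum>l<2 ^ k. ln (\<sigma> (m k (Suc l))) * (1 / 2 ^ k)) \<longlonglongrightarrow> integral {0..1} (\<lambda>s. ln (\<sigma> (M s \<omega>)))"
      using riemann_sum_tendsto[OF cln one, of 1] unfolding fl by (simp add: m_def)
    moreover have "(\<lambda>k. \<Sum>l<2 ^ k. (m k (Suc l) - m k l)\<^sup>2) \<longlonglongrightarrow> integral {0..1} (\<lambda>s. (\<sigma> (M s \<omega>))\<^sup>2)"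
      using elim(1) unfolding fl m_def .
    moreover have "(\<lambda>k. \<Sum>l<2 ^ k. (\<Lambda> (m k (Suc l)) - \<Lambda> (m k l))\<^sup>2) \<longlonglongrightarrow> 1"
      using elim(2) unfolding m_def .
    ultimately have lim: "(\<lambda>k. (\<Sum>l<2 ^ k. (m k (Suc l) - m k l)\<^sup>2) / 2 - (\<Sum>l<2 ^ k. (\<Lambda> (m k (Suc l)) - \<Lambda> (m k l))\<^sup>2) / 2
        - (\<Sum>l<2 ^ k. ln (\<sigma> (m k (Suc l))) * (1 / 2 ^ k)))
      \<longlonglongrightarrow> integral {0..1} (\<lambda>s. (\<sigma> (M s \<omega>))\<^sup>2) / 2 - 1 / 2 - integral {0..1} (\<lambda>s. ln (\<sigma> (M s \<omega>)))"
      by (intro tendsto_diff tendsto_divide tendsto_const) auto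
    have "1 / 2 ^ k * ln (likelihood k (grid_seq k (\<lambda>t. M t \<omega>)))
      = (\<Sum>l<2 ^ k. (m k (Suc l) - m k l)\<^sup>2) / 2 - (\<Sum>l<2 ^ k. (\<Lambda> (m k (Suc l)) - \<Lambda> (m k l))\<^sup>2) / 2
        - (\<Sum>l<2 ^ k. ln (\<sigma> (m k (Suc l))) * (1 / 2 ^ k))" for k
    proof -
      let ?h = "(1 / 2 :: real) ^ k"
      have ln_gauss: "ln (gauss ?h z) = ln (1 / sqrt (2 * pi * ?h)) - z\<^sup>2 / (2 * ?h)" for z
        by (simp add: normal_density_def ln_mult ln_div)
      have ln_ratio: "1 / 2 ^ k * ln (ratio k y v) = (v - y)\<^sup>2 / 2 - (\<Lambda> v - \<Lambda> y)\<^sup>2 / 2 - ln (\<sigma> v) * (1 / 2 ^ k)" for y v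
      proof -
        have "ln (ratio k y v) = ln (gauss ?h (\<Lambda> v - \<Lambda> y)) - ln (\<sigma> v) - ln (gauss ?h (v - y))"
          using gauss_pos[of k, THEN less_imp_neq, symmetric] \<sigma>_nz[of v] by (simp add: ratio_def ln_mult ln_div)
        also have "\<dots> = (v - y)\<^sup>2 / (2 * ?h) - (\<Lambda> v - \<Lambda> y)\<^sup>2 / (2 * ?h) - ln (\<sigma> v)" unfolding ln_gauss by simp
        finally show ?thesis by (simp add: field_simps power_one_over)
      qed
      have "ln (likelihood k (grid_seq k (\<lambda>t. M t \<omega>))) = (\<Sum>l<2 ^ k. ln (ratio k (m k l) (m k (Suc l))))"
        unfolding likelihood_def grid_seq_def m_def using ratio_pos[THEN less_imp_neq, symmetric]
        by (subst ln_prod) (auto simp: min_def intro!: sum.cong)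
      then have "1 / 2 ^ k * ln (likelihood k (grid_seq k (\<lambda>t. M t \<omega>))) = (\<Sum>l<2 ^ k. 1 / 2 ^ k * ln (ratio k (m k l) (m k (Suc l))))"
        by (simp only: sum_distrib_left)
      then show ?thesis unfolding ln_ratio sum_subtractf sum_divide_distrib .
    qed
    moreover have "1 / 2 * (LINT s:{0..1}|lborel. (\<sigma> (M s \<omega>))\<^sup>2 - 1 - ln ((\<sigma> (M s \<omega>))\<^sup>2))
      = integral {0..1} (\<lambda>s. (\<sigma> (M s \<omega>))\<^sup>2) / 2 - 1 / 2 - integral {0..1} (\<lambda>s. ln (\<sigma> (M s \<omega>)))"
    proof -
      have eq: "(\<sigma> (M s \<omega>))\<^sup>2 - 1 - ln ((\<sigma> (M s \<omega>))\<^sup>2) = (\<sigma> (M s \<omega>))\<^sup>2 - 1 - 2 * ln (\<sigma> (M s \<omega>))" for s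
        using \<sigma>_pos by (simp add: ln_realpow)
      have "(LINT s:{0..1}|lborel. (\<sigma> (M s \<omega>))\<^sup>2 - 1 - 2 * ln (\<sigma> (M s \<omega>)))
        = integral {0..1} (\<lambda>s. (\<sigma> (M s \<omega>))\<^sup>2 - 1 - 2 * ln (\<sigma> (M s \<omega>)))"
        by (intro set_borel_integral_eq_integral borel_integrable_atLeastAtMost' continuous_intros c\<sigma> cln)
      also have "\<dots> = integral {0..1} (\<lambda>s. (\<sigma> (M s \<omega>))\<^sup>2) - 1 - 2 * integral {0..1} (\<lambda>s. ln (\<sigma> (M s \<omega>)))"
        by (subst Henstock_Kurzweil_Integration.integral_diff, intro integrable_continuous_real continuous_intros c\<sigma>,
            intro integrable_continuous_real continuous_intros cln,
            subst Henstock_Kurzweil_Integration.integral_diff, intro integrable_continuous_real continuous_intros c\<sigma>) auto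
      finally show ?thesis unfolding eq by simp
    qed
    ultimately show ?case using lim by (simp only:)
  qed
qed

end

section \<open>Densities on path space\<close>

lemma path_sigma_generators:
  "{{w \<in> path_space. w t \<in> A} | t A. t \<in> T \<and> A \<in> sets borel} \<subseteq> Pow path_space"
  by auto

lemma space_path_sigma: "space (path_sigma T) = path_space"
  unfolding path_sigma_def by (rule space_measure_of[OF path_sigma_generators])

lemma sets_path_sigma:
  "sets (path_sigma T) = sigma_sets path_space {{w \<in> path_space. w t \<in> A} | t A. t \<in> T \<and> A \<in> sets borel}"
  unfolding path_sigma_def by (rule sets_measure_of[OF path_sigma_generators])

lemma coordinate_measurable:
  assumes "t \<in> T"
  shows "(\<lambda>w. w t) \<in> borel_measurable (path_sigma T)"
proof (rule measurableI)
  fix A :: "real set" assume "A \<in> sets borel"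
  then have "{w \<in> path_space. w t \<in> A} \<in> sets (path_sigma T)"
    unfolding sets_path_sigma using assms by (intro sigma_sets.Basic) auto
  moreover have "(\<lambda>w. w t) -` A \<inter> space (path_sigma T) = {w \<in> path_space. w t \<in> A}"
    by (auto simp: space_path_sigma)
  ultimately show "(\<lambda>w. w t) -` A \<inter> space (path_sigma T) \<in> sets (path_sigma T)" by simp
qed simp

lemma measurable_path_sigma:
  assumes "\<And>\<omega>. \<omega> \<in> space N \<Longrightarrow> f \<omega> \<in> path_space"
    and "\<And>t. t \<in> T \<Longrightarrow> (\<lambda>\<omega>. f \<omega> t) \<in> borel_measurable N"
  shows "f \<in> measurable N (path_sigma T)"
  unfolding path_sigma_def
proof (rule measurable_measure_of[OF path_sigma_generators])
  show "f \<in> space N \<rightarrow> path_space" using assms(1) by auto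
  fix Y assume "Y \<in> {{w \<in> path_space. w t \<in> A} | t A. t \<in> T \<and> A \<in> sets borel}"
  then obtain t A where Y: "Y = {w \<in> path_space. w t \<in> A}" "t \<in> T" "A \<in> sets borel" by auto
  have "f -` Y \<inter> space N = (\<lambda>\<omega>. f \<omega> t) -` A \<inter> space N" using assms(1) by (auto simp: Y(1))
  then show "f -` Y \<inter> space N \<in> sets N" using measurable_sets[OF assms(2)[OF Y(2)] Y(3)] by simp
qed

lemma sets_path_sigma_mono:
  assumes "S \<subseteq> T"
  shows "sets (path_sigma S) \<subseteq> sets (path_sigma T)"
  unfolding sets_path_sigma using assms by (intro sigma_sets_mono') blast

lemma subalgebra_grid_algebra:
  assumes "sets P = sets path_algebra"
  shows "subalgebra P (grid_algebra n)"
proof -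
  have "{real k / real n | k. k \<le> n} \<subseteq> {0..1}" using grid_in_unit by blast
  then have "sets (grid_algebra n) \<subseteq> sets P"
    unfolding assms grid_algebra_def path_algebra_def by (rule sets_path_sigma_mono)
  moreover have "space P = space (grid_algebra n)"
    using sets_eq_imp_space_eq[OF assms] by (simp add: space_path_sigma grid_algebra_def path_algebra_def)
  ultimately show ?thesis by (simp add: subalgebra_def)
qed

lemma grid_seq_measurable_grid_algebra: "grid_seq k \<in> measurable (grid_algebra (2 ^ k)) seq_borel"
proof (rule measurable_PiM_single')
  fix i
  have "real (min i (2 ^ k)) / real (2 ^ k) \<in> {real j / real (2 ^ k) | j. j \<le> 2 ^ k}" by force
  from coordinate_measurable[OF this]
  show "(\<lambda>w. grid_seq k w i) \<in> borel_measurable (grid_algebra (2 ^ k))"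
    by (simp add: grid_seq_def grid_algebra_def)
qed auto

text \<open>Each generator constrains one grid coordinate, so it is the preimage of a cylinder set
  under \<open>grid_seq\<close>. Grid events thus become events about sequences, for which the
  domination is stated.\<close>

lemma grid_algebra_sets:
  assumes "A \<in> sets (grid_algebra (2 ^ k))"
  shows "\<exists>A'\<in>sets seq_borel. A = {w \<in> path_space. grid_seq k w \<in> A'}"
proof -
  let ?V = "vimage_algebra path_space (grid_seq k) seq_borel"
  have "sigma_sets (space ?V) {{w \<in> path_space. w t \<in> A} | t A. t \<in> {real j / real (2 ^ k) | j. j \<le> 2 ^ k} \<and> A \<in> sets borel} \<subseteq> sets ?V"
  proof (rule sets.sigma_sets_subset, safe)
    fix j :: nat and C :: "real set" assume j: "j \<le> 2 ^ k" and C: "C \<in> sets borel"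
    have "(\<lambda>p. p j) -` C \<inter> space seq_borel \<in> sets seq_borel"
      using C by (intro measurable_sets[OF measurable_component_singleton]) auto
    then have "{p. p j \<in> C} \<in> sets seq_borel" by (simp add: space_PiM vimage_def)
    from in_vimage_algebra[OF this, of "grid_seq k" path_space]
    show "{w \<in> path_space. w (real j / real (2 ^ k)) \<in> C} \<in> sets ?V"
      using j by (simp add: grid_seq_def vimage_def Int_def min_absorb1 conj_commute)
  qed
  then have "A \<in> sets ?V" using assms by (auto simp: grid_algebra_def sets_path_sigma)
  then obtain A' where "A' \<in> sets seq_borel" "A = grid_seq k -` A' \<inter> path_space"
    by (auto simp: sets_vimage_algebra2 space_PiM)
  then show ?thesis by (intro bexI[of _ A']) auto
qed

lemma grid_seq_path_of: "grid_seq k (path_of X \<omega>) = grid_seq k (\<lambda>t. X t \<omega>)"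
proof -
  have "real (min i (2 ^ k)) / 2 ^ k \<in> {0..1}" for i :: nat
    using grid_in_unit[of "min i (2 ^ k)" "2 ^ k"] by simp
  then show ?thesis by (auto simp: fun_eq_iff grid_seq_def path_of_def)
qed

lemma (in brownian_setup) path_of_measurable:
  assumes "continuous_adapted W F X"
  shows "path_of X \<in> measurable W path_algebra"
  unfolding path_algebra_def
proof (rule measurable_path_sigma)
  fix \<omega> assume "\<omega> \<in> space W"
  then have "continuous_on {0..1} (\<lambda>t. X t \<omega>)" using assms by (auto simp: continuous_adapted_def)
  then have "continuous_on {0..1} (path_of X \<omega>)"
    by (rule continuous_on_cong[OF refl, THEN iffD1, rotated]) (simp add: path_of_def)
  then show "path_of X \<omega> \<in> path_space"
    by (auto simp: path_space_def path_of_def)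
next
  fix t :: real assume "t \<in> {0..1}"
  then show "(\<lambda>\<omega>. path_of X \<omega> t) \<in> borel_measurable W"
    using assms meas_W[of "X t" t] by (auto simp: continuous_adapted_def path_of_def)
qed

text \<open>A constant coefficient is Lipschitz with constant 0, so the bound on the Euler error
  \<rho> is 0.\<close>

lemma (in brownian_setup) translated_brownian_motion:
  assumes "sde_solution W F B (\<lambda>_. 1) x N" and t: "t \<in> {0..1}"
  shows "AE \<omega> in W. N t \<omega> = x + (B t \<omega> - B 0 \<omega>)"
proof -
  interpret N: diffusion W F B "\<lambda>_. 1" x 0 1 N
    by standard (use assms in auto)
  have [measurable]: "N.\<rho> 0 t \<in> borel_measurable W"
    using meas_W[OF N.\<rho>_measurable[of 0 t]] t by auto
  have "(\<integral>\<^sup>+\<omega>. ennreal ((N.\<rho> 0 t \<omega>)\<^sup>2) \<partial>W) = 0"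
    using N.\<rho>_nn_bound[of 0 t] t by simp
  then have "AE \<omega> in W. ennreal ((N.\<rho> 0 t \<omega>)\<^sup>2) = 0"
    by (subst (asm) nn_integral_0_iff_AE) auto
  with N.M_0 show ?thesis by eventually_elim (auto simp: N.\<rho>_def)
qed

section \<open>The grid density against the explicit likelihood\<close>

context lamperti
begin

lemma law_const_pos: "0 < law_const"
  using c_pos \<delta>_pos by (simp add: law_const_def)

text \<open>The domination gives absolute continuity at once. For the limit, Borel-Cantelli shows
  that the logarithms of density and likelihood eventually differ by at most a constant plus k, and
  k / 2^k tends to 0.\<close>

lemma density_asymptotics:
  assumes N: "sde_solution W F B (\<lambda>_. 1) x N"
    and Q: "Q = path_law W M" and P: "P = path_law W N"
  shows "\<forall>k. absolutely_continuous (grid_restr P (2 ^ k)) (grid_restr Q (2 ^ k))"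
    and "AE \<omega> in W. (\<lambda>k. 1 / 2 ^ k * ln (enn2real (grid_density Q P (2 ^ k) (path_of M \<omega>)))
        - 1 / 2 ^ k * ln (likelihood k (grid_seq k (\<lambda>t. M t \<omega>)))) \<longlonglongrightarrow> 0"
proof -
  have Mm [measurable]: "path_of M \<in> measurable W path_algebra"
    using sde by (intro path_of_measurable) (auto simp: sde_solution_def)
  have Nm [measurable]: "path_of N \<in> measurable W path_algebra"
    using N by (intro path_of_measurable) (auto simp: sde_solution_def)
  interpret Q: prob_space Q unfolding Q path_law_def by (rule prob_space_distr) simp
  interpret P: prob_space P unfolding P path_law_def by (rule prob_space_distr) simp
  have sets: "sets Q = sets path_algebra" "sets P = sets path_algebra" by (simp_all add: Q P path_law_def)
  note sub = subalgebra_grid_algebra[OF sets(1)] subalgebra_grid_algebra[OF sets(2)]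
  have space: "space (grid_restr P n) = path_space" "space (grid_restr Q n) = path_space" for n
    using sets_eq_imp_space_eq[OF sets(1)] sets_eq_imp_space_eq[OF sets(2)]
    by (simp_all add: space_restr_to_subalg path_algebra_def space_path_sigma)
  have sets_grid: "sets (grid_restr P n) = sets (grid_algebra n)" "sets (grid_restr Q n) = sets (grid_algebra n)" for n
    using sub sets_restr_to_subalg by blast+
  have fin: "prob_space (grid_restr P n)" "prob_space (grid_restr Q n)" for n
    using prob_space_restr_to_subalg[OF sub(2) P.prob_space_axioms] prob_space_restr_to_subalg[OF sub(1) Q.prob_space_axioms] by auto
  have meas_grid: "f \<in> borel_measurable (grid_algebra n) \<Longrightarrow> f \<in> borel_measurable (grid_restr P n)" for n and f :: "_ \<Rightarrow> ennreal"
    by (simp add: measurable_cong_sets[OF sets_grid(1) refl])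
  have emeasure_Q: "emeasure (grid_restr Q n) A = emeasure W {\<omega>\<in>space W. path_of M \<omega> \<in> A}"
    if "A \<in> sets (grid_algebra n)" for A n
  proof -
    have "A \<in> sets path_algebra" using that sub(1)[of n] sets by (auto simp: subalgebra_def)
    then show ?thesis
      unfolding emeasure_restr_to_subalg[OF sub(1) that]
      by (simp add: Q path_law_def emeasure_distr vimage_def Int_def conj_commute)
  qed
  have lik_meas: "(\<lambda>w. ennreal (likelihood k (grid_seq k w))) \<in> borel_measurable (grid_algebra (2 ^ k))" for k
    using measurable_compose[OF grid_seq_measurable_grid_algebra likelihood_measurable] by simp
  \<comment> \<open>Integrals under \<open>P\<close> become integrals over \<open>W\<close>: at each
    of countably many indices the grid value of \<open>N\<close> equals that of \<open>xB\<close>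
    almost surely.\<close>
  have int_P: "(\<integral>\<^sup>+w. g (grid_seq k w) \<partial>grid_restr P (2 ^ k)) = (\<integral>\<^sup>+\<omega>. g (grid_seq k (xB \<omega>)) \<partial>W)"
    if g: "g \<in> borel_measurable seq_borel" for g k
  proof -
    have gm: "(\<lambda>w. g (grid_seq k w)) \<in> borel_measurable (grid_algebra (2 ^ k))"
      by (rule measurable_compose[OF grid_seq_measurable_grid_algebra g])
    then have "(\<lambda>w. g (grid_seq k w)) \<in> borel_measurable path_algebra"
      using measurable_from_subalg[OF sub(2)] by (simp add: measurable_cong_sets[OF sets(2) refl])
    then have "(\<integral>\<^sup>+w. g (grid_seq k w) \<partial>grid_restr P (2 ^ k)) = (\<integral>\<^sup>+\<omega>. g (grid_seq k (\<lambda>t. N t \<omega>)) \<partial>W)"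
      using nn_integral_subalgebra2[OF sub(2) gm] by (simp add: P path_law_def nn_integral_distr grid_seq_path_of)
    also have "\<dots> = (\<integral>\<^sup>+\<omega>. g (grid_seq k (xB \<omega>)) \<partial>W)"
    proof (rule nn_integral_cong_AE)
      have "AE \<omega> in W. \<forall>i. grid_seq k (\<lambda>t. N t \<omega>) i = grid_seq k (xB \<omega>) i"
        unfolding AE_all_countable grid_seq_def
      proof
        fix i :: nat
        have "real (min i (2 ^ k)) / 2 ^ k \<in> {0..1}" using grid_in_unit[of "min i (2 ^ k)" "2 ^ k"] by simp
        then show "AE \<omega> in W. N (real (min i (2 ^ k)) / 2 ^ k) \<omega> = xB \<omega> (real (min i (2 ^ k)) / 2 ^ k)"
          by (rule translated_brownian_motion[OF N])
      qed
      then show "AE \<omega> in W. g (grid_seq k (\<lambda>t. N t \<omega>)) = g (grid_seq k (xB \<omega>))"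
        by eventually_elim (auto simp: fun_eq_iff[symmetric])
    qed
    finally show ?thesis .
  qed
  have Q_le: "emeasure (grid_restr Q (2 ^ k)) A
      \<le> ennreal law_const * (\<integral>\<^sup>+w. indicator A w * ennreal (likelihood k (grid_seq k w)) \<partial>grid_restr P (2 ^ k))"
    if A: "A \<in> sets (grid_algebra (2 ^ k))" for A k
  proof -
    obtain A' where A': "A' \<in> sets seq_borel" "A = {w \<in> path_space. grid_seq k w \<in> A'}" using grid_algebra_sets[OF A] by blast
    have "{\<omega>\<in>space W. path_of M \<omega> \<in> A} = {\<omega>\<in>space W. grid_seq k (\<lambda>t. M t \<omega>) \<in> A'}"
      using measurable_space[OF Mm] by (auto simp: A'(2) grid_seq_path_of path_algebra_def space_path_sigma)
    then have "emeasure (grid_restr Q (2 ^ k)) A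
        \<le> ennreal law_const * (\<integral>\<^sup>+\<omega>. indicator A' (grid_seq k (xB \<omega>)) * ennreal (likelihood k (grid_seq k (xB \<omega>))) \<partial>W)"
      unfolding emeasure_Q[OF A] using grid_law_bound[OF A'(1)] by simp
    also have "(\<integral>\<^sup>+\<omega>. indicator A' (grid_seq k (xB \<omega>)) * ennreal (likelihood k (grid_seq k (xB \<omega>))) \<partial>W)
      = (\<integral>\<^sup>+w. indicator A' (grid_seq k w) * ennreal (likelihood k (grid_seq k w)) \<partial>grid_restr P (2 ^ k))"
      by (intro int_P[symmetric, of "\<lambda>p. indicator A' p * ennreal (likelihood k p)"] borel_measurable_times_ennreal
        borel_measurable_indicator A'(1) measurable_compose[OF likelihood_measurable measurable_ennreal])
    also have "\<dots> = (\<integral>\<^sup>+w. indicator A w * ennreal (likelihood k (grid_seq k w)) \<partial>grid_restr P (2 ^ k))"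
      by (intro nn_integral_cong) (auto simp: A'(2) space indicator_def)
    finally show ?thesis .
  qed
  show ac: "\<forall>k. absolutely_continuous (grid_restr P (2 ^ k)) (grid_restr Q (2 ^ k))"
  proof
    fix k
    show "absolutely_continuous (grid_restr P (2 ^ k)) (grid_restr Q (2 ^ k))"
      unfolding absolutely_continuous_def
    proof
      fix A assume A: "A \<in> null_sets (grid_restr P (2 ^ k))"
      then have As: "A \<in> sets (grid_algebra (2 ^ k))" by (auto simp: null_sets_def sets_grid)
      have "AE w in grid_restr P (2 ^ k). indicator A w * ennreal (likelihood k (grid_seq k w)) = 0"
        using AE_not_in[OF A] by eventually_elim simp
      then have "(\<integral>\<^sup>+w. indicator A w * ennreal (likelihood k (grid_seq k w)) \<partial>grid_restr P (2 ^ k)) = (\<integral>\<^sup>+w. 0 \<partial>grid_restr P (2 ^ k))"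
        by (rule nn_integral_cong_AE)
      then have "emeasure (grid_restr Q (2 ^ k)) A = 0" using Q_le[OF As] by simp
      then show "A \<in> null_sets (grid_restr Q (2 ^ k))" using As by (auto simp: null_sets_def sets_grid)
    qed
  qed
  define D where "D k = grid_density Q P (2 ^ k)" for k
  define lik where "lik k w = likelihood k (grid_seq k w)" for k w
  have lik_pos: "0 < lik k w" for k w by (simp add: lik_def likelihood_pos)
  have D_meas: "D k \<in> borel_measurable (grid_restr P (2 ^ k))" for k
    unfolding D_def grid_density_def by measurable
  have L_meas: "(\<lambda>w. ennreal (lik k w)) \<in> borel_measurable (grid_restr P (2 ^ k))" for k
    unfolding lik_def using meas_grid lik_meas by blast
  have density: "emeasure (grid_restr Q (2 ^ k)) A = (\<integral>\<^sup>+w. D k w * indicator A w \<partial>grid_restr P (2 ^ k))"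
    if "A \<in> sets (grid_algebra (2 ^ k))" for A k
  proof -
    interpret Pk: prob_space "grid_restr P (2 ^ k)" by (rule fin)
    have "density (grid_restr P (2 ^ k)) (D k) = grid_restr Q (2 ^ k)"
      unfolding D_def grid_density_def using ac by (intro Pk.density_RN_deriv) (auto simp: sets_grid)
    then show ?thesis using emeasure_density[OF D_meas, of A k] that by (simp add: sets_grid)
  qed
  \<comment> \<open>The margin exp k makes the probabilities of both bad events summable, and after
    division by 2^k its logarithm vanishes in the limit.\<close>
  define U where "U k = {w \<in> path_space. ennreal (law_const * exp (real k) * lik k w) \<le> D k w}" for k
  define V where "V k = {w \<in> path_space. D k w * ennreal (exp (real k)) \<le> ennreal (lik k w)}" for k
  have UV: "U k \<in> sets (grid_algebra (2 ^ k))" "V k \<in> sets (grid_algebra (2 ^ k))" for k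
  proof -
    note [measurable] = D_meas[of k] L_meas[of k]
    have "(\<lambda>w. ennreal (law_const * exp (real k)) * ennreal (lik k w)) \<in> borel_measurable (grid_restr P (2 ^ k))" by measurable
    then have [measurable]: "(\<lambda>w. ennreal (law_const * exp (real k) * lik k w)) \<in> borel_measurable (grid_restr P (2 ^ k))"
      using law_const_pos by (simp add: ennreal_mult'' ennreal_mult' less_imp_le lik_pos)
    have "{w \<in> space (grid_restr P (2 ^ k)). ennreal (law_const * exp (real k) * lik k w) \<le> D k w} \<in> sets (grid_restr P (2 ^ k))" by measurable
    then show "U k \<in> sets (grid_algebra (2 ^ k))" unfolding U_def space sets_grid .
    have "{w \<in> space (grid_restr P (2 ^ k)). D k w * ennreal (exp (real k)) \<le> ennreal (lik k w)} \<in> sets (grid_restr P (2 ^ k))" by measurable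
    then show "V k \<in> sets (grid_algebra (2 ^ k))" unfolding V_def space sets_grid .
  qed
  have exp_inv: "ennreal (exp (- real k)) * ennreal (exp (real k)) = 1" for k
    by (simp add: ennreal_mult'[symmetric] exp_add[symmetric])
  have tail_U: "emeasure (grid_restr Q (2 ^ k)) (U k) \<le> ennreal (exp (- real k))" for k
  proof -
    interpret Qk: prob_space "grid_restr Q (2 ^ k)" by (rule fin)
    note [measurable] = D_meas[of k] L_meas[of k]
    have Us [measurable]: "U k \<in> sets (grid_restr P (2 ^ k))" using UV by (simp add: sets_grid)
    have "emeasure (grid_restr Q (2 ^ k)) (U k)
        \<le> ennreal law_const * (\<integral>\<^sup>+w. indicator (U k) w * ennreal (lik k w) \<partial>grid_restr P (2 ^ k))"
      using Q_le[OF UV(1)] by (simp add: lik_def)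
    also have "\<dots> = (\<integral>\<^sup>+w. ennreal law_const * (indicator (U k) w * ennreal (lik k w)) \<partial>grid_restr P (2 ^ k))"
      by (rule nn_integral_cmult[symmetric]) measurable
    \<comment> \<open>On \<open>U k\<close> the dominating integrand is at most exp (- k) times the
      density, so the mass of \<open>U k\<close> is at most exp (- k) times itself.\<close>
    also have "\<dots> \<le> (\<integral>\<^sup>+w. ennreal (exp (- real k)) * (D k w * indicator (U k) w) \<partial>grid_restr P (2 ^ k))"
    proof (rule nn_integral_mono)
      fix w
      show "ennreal law_const * (indicator (U k) w * ennreal (lik k w)) \<le> ennreal (exp (- real k)) * (D k w * indicator (U k) w)"
      proof (cases "w \<in> U k")
        case True
        have "ennreal law_const * ennreal (lik k w) = ennreal (exp (- real k)) * ennreal (law_const * exp (real k) * lik k w)"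
          using law_const_pos lik_pos[of k w] by (simp add: ennreal_mult'[symmetric] exp_minus field_simps)
        also have "\<dots> \<le> ennreal (exp (- real k)) * D k w"
          using True by (intro mult_left_mono) (auto simp: U_def)
        finally show ?thesis using True by simp
      qed simp
    qed
    also have "\<dots> = ennreal (exp (- real k)) * emeasure (grid_restr Q (2 ^ k)) (U k)"
      unfolding density[OF UV(1)] by (rule nn_integral_cmult) measurable
    also have "\<dots> \<le> ennreal (exp (- real k)) * 1"
      by (intro mult_left_mono Qk.measure_le_1) auto
    finally show ?thesis by simp
  qed
  have tail_V: "emeasure (grid_restr Q (2 ^ k)) (V k) \<le> ennreal (exp (- real k))" for k
  proof -
    note [measurable] = D_meas[of k] L_meas[of k]
    have Vs [measurable]: "V k \<in> sets (grid_restr P (2 ^ k))" using UV by (simp add: sets_grid)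
    have "emeasure (grid_restr Q (2 ^ k)) (V k) = (\<integral>\<^sup>+w. D k w * indicator (V k) w \<partial>grid_restr P (2 ^ k))"
      by (rule density[OF UV(2)])
    also have "\<dots> \<le> (\<integral>\<^sup>+w. ennreal (exp (- real k)) * ennreal (lik k w) \<partial>grid_restr P (2 ^ k))"
    proof (rule nn_integral_mono)
      fix w
      show "D k w * indicator (V k) w \<le> ennreal (exp (- real k)) * ennreal (lik k w)"
      proof (cases "w \<in> V k")
        case True
        have "D k w = ennreal (exp (- real k)) * (D k w * ennreal (exp (real k)))"
          using exp_inv[of k] by (metis mult.commute mult.left_commute mult.right_neutral)
        also have "\<dots> \<le> ennreal (exp (- real k)) * ennreal (lik k w)"
          using True by (intro mult_left_mono) (auto simp: V_def)
        finally show ?thesis using True by simp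
      qed simp
    qed
    also have "\<dots> = ennreal (exp (- real k)) * (\<integral>\<^sup>+w. ennreal (lik k w) \<partial>grid_restr P (2 ^ k))"
      by (rule nn_integral_cmult) measurable
    also have "(\<integral>\<^sup>+w. ennreal (lik k w) \<partial>grid_restr P (2 ^ k)) \<le> 1"
      unfolding lik_def using int_P[of "\<lambda>p. ennreal (likelihood k p)" k] likelihood_integral_le[of k] by simp
    finally show ?thesis by (simp add: mult_left_mono)
  qed
  have summable: "summable (\<lambda>k. exp (- real k))"
  proof -
    have "summable (\<lambda>k. exp (- 1 :: real) ^ k)" by (intro summable_geometric) simp
    then show ?thesis by (simp add: exp_of_nat_mult[symmetric])
  qed
  \<comment> \<open>Borel-Cantelli on \<open>W\<close>: the path of \<open>M\<close> lies in
    \<open>A k\<close> with the probability that its law \<open>Q\<close> gives to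
    \<open>A k\<close>.\<close>
  have bad: "AE \<omega> in W. eventually (\<lambda>k. \<omega> \<in> space W - {\<omega>\<in>space W. path_of M \<omega> \<in> A k}) sequentially"
    if A: "\<And>k. A k \<in> sets (grid_algebra (2 ^ k))" "\<And>k. emeasure (grid_restr Q (2 ^ k)) (A k) \<le> ennreal (exp (- real k))" for A
  proof (rule borel_cantelli_AE1)
    show "{\<omega>\<in>space W. path_of M \<omega> \<in> A k} \<in> events" for k
    proof -
      have "A k \<in> sets path_algebra" using A(1)[of k] sub(1)[of "2 ^ k"] sets by (auto simp: subalgebra_def)
      then show ?thesis using measurable_sets[OF Mm] by (simp add: vimage_def Int_def conj_commute)
    qed
    have "emeasure W {\<omega>\<in>space W. path_of M \<omega> \<in> A k} \<le> ennreal (exp (- real k))" for k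
      using A emeasure_Q by metis
    then have "norm (measure W {\<omega>\<in>space W. path_of M \<omega> \<in> A k}) \<le> exp (- real k)" for k
      by (simp add: emeasure_eq_measure)
    then show "summable (\<lambda>k. measure W {\<omega>\<in>space W. path_of M \<omega> \<in> A k})"
      by (rule summable_comparison_test'[OF summable])
  qed (simp add: emeasure_eq_measure)
  have "AE \<omega> in W. \<omega> \<in> space W" by simp
  with bad[of U, OF UV(1) tail_U] bad[of V, OF UV(2) tail_V]
  show "AE \<omega> in W. (\<lambda>k. 1 / 2 ^ k * ln (enn2real (grid_density Q P (2 ^ k) (path_of M \<omega>)))
        - 1 / 2 ^ k * ln (likelihood k (grid_seq k (\<lambda>t. M t \<omega>)))) \<longlonglongrightarrow> 0"
  proof eventually_elim
    case (elim \<omega>)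
    let ?w = "path_of M \<omega>"
    have w: "?w \<in> path_space"
      using measurable_space[OF Mm elim(3)] by (simp add: path_algebra_def space_path_sigma)
    have bound: "\<forall>\<^sub>F k in sequentially. norm (1 / 2 ^ k * ln (enn2real (D k ?w)) - 1 / 2 ^ k * ln (lik k ?w))
        \<le> (\<bar>ln law_const\<bar> + real k) / 2 ^ k"
      using elim(1,2)
    proof eventually_elim
      case (elim k)
      have 1: "D k ?w < ennreal (law_const * exp (real k) * lik k ?w)" using elim(1) w \<open>\<omega> \<in> space W\<close> by (auto simp: U_def)
      have 2: "ennreal (lik k ?w) < D k ?w * ennreal (exp (real k))" using elim(2) w \<open>\<omega> \<in> space W\<close> by (auto simp: V_def)
      \<comment> \<open>Off \<open>U k\<close> the density is finite, and off \<open>V k\<close> it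
        is positive, so the default values of \<open>enn2real\<close> at infinity and of
        \<open>ln\<close> at 0 do not enter.\<close>
      obtain d where d: "D k ?w = ennreal d" "0 \<le> d" using 1 by (cases "D k ?w") auto
      have up: "d < law_const * exp (real k) * lik k ?w" using 1 d by (simp add: ennreal_less_iff)
      have "ennreal (lik k ?w) < ennreal (d * exp (real k))" using 2 d by (simp add: ennreal_mult)
      then have lo: "lik k ?w < d * exp (real k)" using lik_pos[of k ?w] by (simp add: ennreal_less_iff)
      have "d \<noteq> 0" using lo lik_pos[of k ?w] by auto
      then have "0 < d" using d by simp
      have "ln d \<le> ln (law_const * exp (real k) * lik k ?w)" using up \<open>0 < d\<close> by (intro ln_mono) auto
      also have "\<dots> = ln law_const + real k + ln (lik k ?w)"
        using law_const_pos lik_pos[of k ?w] by (simp add: ln_mult)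
      finally have u: "ln d - ln (lik k ?w) \<le> \<bar>ln law_const\<bar> + real k" by linarith
      have "ln (lik k ?w) \<le> ln (d * exp (real k))" using lo lik_pos[of k ?w] by (intro ln_mono) auto
      also have "\<dots> = ln d + real k" using \<open>0 < d\<close> by (simp add: ln_mult)
      finally have "\<bar>ln d - ln (lik k ?w)\<bar> \<le> \<bar>ln law_const\<bar> + real k" using u by linarith
      then have "\<bar>ln d - ln (lik k ?w)\<bar> / 2 ^ k \<le> (\<bar>ln law_const\<bar> + real k) / 2 ^ k" by (rule divide_right_mono) simp
      then show ?case using d by (simp add: diff_divide_distrib[symmetric])
    qed
    have "(\<lambda>k. \<bar>ln law_const\<bar> * (1 / 2) ^ k + real k * (1 / 2) ^ k) \<longlonglongrightarrow> \<bar>ln law_const\<bar> * 0 + 0"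
      by (intro tendsto_intros LIMSEQ_realpow_zero powser_times_n_limit_0) auto
    then have "(\<lambda>k. (\<bar>ln law_const\<bar> + real k) / 2 ^ k) \<longlonglongrightarrow> 0"
      by (simp add: add_divide_distrib power_one_over)
    from Lim_null_comparison[OF bound this] show ?case
      by (simp add: D_def lik_def grid_seq_path_of)
  qed
qed

end

theorem proposition1:
  fixes \<sigma> \<sigma>' \<sigma>'' :: "real \<Rightarrow> real" and \<delta> L x :: real
    and W :: "'a measure" and F :: "real \<Rightarrow> 'a measure"
    and B M N :: "real \<Rightarrow> 'a \<Rightarrow> real"
    and Q P :: "(real \<Rightarrow> real) measure"
  assumes "\<And>y. (\<sigma> has_real_derivative \<sigma>' y) (at y)"
    and "\<And>y. (\<sigma>' has_real_derivative \<sigma>'' y) (at y)"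
    and "continuous_on UNIV \<sigma>''"
    and "0 < \<delta>" and "\<delta> \<le> 1"
    and "\<And>y. \<sigma> y \<in> {\<delta><..<1 / \<delta>}"
    and "max (SUP y. ereal \<bar>\<sigma>' y\<bar>) (SUP y. ereal \<bar>\<sigma>'' y\<bar>) < ereal L"
    and "filtered_prob_space W F"
    and "brownian_motion W F B"
    and "sde_solution W F B \<sigma> x M"
    and "sde_solution W F B (\<lambda>_. 1) x N"
    and "Q = path_law W M"
    and "P = path_law W N"
  shows "(\<forall>k. absolutely_continuous (grid_restr P (2 ^ k)) (grid_restr Q (2 ^ k))) \<and>
    (AE \<omega> in W.
      (\<lambda>k. 1 / 2 ^ k * ln (enn2real (grid_density Q P (2 ^ k) (path_of M \<omega>))))
        \<longlonglongrightarrow> 1 / 2 * (LINT s:{0..1}|lborel. (\<sigma> (M s \<omega>))\<^sup>2 - 1 - ln ((\<sigma> (M s \<omega>))\<^sup>2)))"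
proof -
  have "(SUP y. ereal \<bar>\<sigma>' y\<bar>) < ereal L" "(SUP y. ereal \<bar>\<sigma>'' y\<bar>) < ereal L"
    using assms(7) by auto
  then have bounds: "\<bar>\<sigma>' y\<bar> \<le> L" "\<bar>\<sigma>'' y\<bar> \<le> L" for y
    using SUP_upper[of y UNIV "\<lambda>y. ereal \<bar>\<sigma>' y\<bar>"] SUP_upper[of y UNIV "\<lambda>y. ereal \<bar>\<sigma>'' y\<bar>"]
    by (auto dest: order.strict_trans1)
  have \<sigma>_range: "\<delta> \<le> \<sigma> y" "\<bar>\<sigma> y\<bar> \<le> 1 / \<delta>" "\<sigma> y \<noteq> 0" for y
    using assms(6)[of y] assms(4) by auto
  have "isCont (\<lambda>y. 1 / \<sigma> y) y" for y
    using DERIV_isCont[OF assms(1)] \<sigma>_range(3) by (intro continuous_intros) auto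
  then obtain \<Lambda> where "\<And>y. (\<Lambda> has_vector_derivative 1 / \<sigma> y) (at y)"
    using einterval_antiderivative[of "- \<infinity>" "\<infinity>" "\<lambda>y. 1 / \<sigma> y"] by auto
  then have \<Lambda>: "(\<Lambda> has_real_derivative 1 / \<sigma> y) (at y)" for y
    by (simp add: has_real_derivative_iff_has_vector_derivative)
  \<comment> \<open>The upper bound \<open>c\<close> is instantiated by 1 / \<delta>, and the
    Lipschitz constant of \<sigma> is the bound L on its derivative.\<close>
  interpret lamperti W F B \<sigma> x L "1 / \<delta>" M \<sigma>' \<sigma>'' \<Lambda> \<delta>
    using assms \<sigma>_range bounds \<Lambda> lipschitz_of_deriv_bound[OF assms(1) bounds(1)] by unfold_locales auto
  note asymptotics = density_asymptotics[OF assms(11,12,13)]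
  from asymptotics(2) ln_likelihood_tendsto
  have "AE \<omega> in W.
      (\<lambda>k. 1 / 2 ^ k * ln (enn2real (grid_density Q P (2 ^ k) (path_of M \<omega>))))
        \<longlonglongrightarrow> 1 / 2 * (LINT s:{0..1}|lborel. (\<sigma> (M s \<omega>))\<^sup>2 - 1 - ln ((\<sigma> (M s \<omega>))\<^sup>2))"
  proof eventually_elim
    case (elim \<omega>)
    from tendsto_add[OF elim] show ?case by simp
  qed
  with asymptotics(1) show ?thesis by blast
qed

end
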